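(* Assume that the stochastic kernel $p(\cdot\,|x,a)$ is continuous in $(x,a)\in\mathsf X\times\mathsf A$ with respect to total variation distance, and consider the discounted cost criterion. For any given $\kappa>0$, there exist $\varepsilon>0$ and $n\ge1$ such that if $\overline\varphi_n$ is an optimal policy for $(\overline{\mathbf{CP}}_n^{\mathbf k-\varepsilon\mathbf 1})$ obtained by extending to $\mathsf X$ an optimal policy $\varphi_n\in\Phi_n$ for $(\mathbf{CP}_n^{\mathbf k-\varepsilon\mathbf 1})$, then $\overline\varphi_n\in\Phi$ is feasible for $(\mathbf{CP}^{\mathbf k})$ and the true cost $J(\overline\varphi_n,\gamma)$ of $\overline\varphi_n$ is within $\kappa$ of the optimal value of $(\mathbf{CP}^{\mathbf k})$.
   Context: **Model.** $\mathsf X$ (states) and $\mathsf A$ (actions) are compact metric spaces with their Borel $\sigma$-algebras; $d_{\mathsf X}$ is the metric of $\mathsf X$; every action is admissible in every state. $p(\cdot\,|x,a)$ is a stochastic kernel on $\mathsf X$ given $\mathsf X\times\mathsf A$ (transition probability); $c,d_1,\dots,d_q:\mathsf X\times\mathsf A\to[0,\infty)$ are continuous; $\gamma$ is a probability measure on $\mathsf X$ (initial distribution); $\mathbf k=(k_1,\dots,k_q)\in[0,\infty)^q$; $\mathbf 1=(1,\dots,1)\in\mathbb R^q$. A policy $\pi=\{\pi_t\}$ is a sequence of stochastic kernels on $\mathsf A$ given the history spaces $\mathsf H_t=(\mathsf X\times\mathsf A)^t\times\mathsf X$; $\Pi$ is the set of all policies; $\Phi$ is the set of stochastic kernels on $\mathsf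 A$ given $\mathsf X$, identified with the randomized stationary policies. $\mathbb E_\gamma^\pi$ is expectation under the law of $(X_t,A_t)_{t\ge0}$ determined by $\gamma$, $\pi$, $p$. **Discounted criterion.** Fix $\beta\in(0,1)$. $J(\pi,\gamma)=(1-\beta)\mathbb E_\gamma^\pi[\sum_{t\ge0}\beta^tc(X_t,A_t)]$, and $J_l(\pi,\gamma)$ is the same with $d_l$ in place of $c$. For $\mathbf m\in\mathbb R^q$, $(\mathbf{CP}^{\mathbf m})$: minimize $J(\pi,\gamma)$ over $\pi\in\Pi$ subject to $J_l(\pi,\gamma)\le m_l$, $l=1,\dots,q$. Standing assumption: there is $\pi\in\Pi$ with $J_l(\pi,\gamma)<k_l$ for all $l$. **Finite models.** For each $n\ge1$ let $\mathsf X_n=\{x_{n,1},\dots,x_{n,k_n}\}\subset\mathsf X$ be finite with $\min_i d_{\mathsf X}(x,x_{n,i})<1/n$ for all $x\in\mathsf X$; $Q_n:\mathsf X\to\mathsf X_n$ is a nearest-point map (ties broken so that $Q_n$ is measurable); $\mathcal S_{n,i}=Q_n^{-1}(x_{n,i})$; $i_n(x)$ is the index with $x\in\mathcal S_{n,i_n(x)}$. Let $\nu_n$ be a measure on $\mathsf X$ with $\nu_n(\mathcal S_{n,i})>0$ for all $i$, and let $\nu_{n,i}(\cdot)=\nu_n(\cdot)/\nu_n(\mathcal S_{n,i})$ be the probability measure on $\mathcal S_{n,i}$ obtained by restricting and normalizing $\nu_n$. MDP$_n$ has state space $\mathsf X_n$, action space $\mathsf A$, initial distribution $\gamma_n=\gamma\circ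 Q_n^{-1}$, and $p_n(x_{n,j}|x_{n,i},a)=\int_{\mathcal S_{n,i}}p(\mathcal S_{n,j}|x,a)\,\nu_{n,i}(dx)$, $c_n(x_{n,i},a)=\int_{\mathcal S_{n,i}}c(x,a)\,\nu_{n,i}(dx)$, $d_{l,n}(x_{n,i},a)=\int_{\mathcal S_{n,i}}d_l(x,a)\,\nu_{n,i}(dx)$. Its policies $\Pi_n$, randomized stationary policies $\Phi_n$ and discounted costs $J_n,J_{l,n}$ are defined as for the original model. $(\mathbf{CP}_n^{\mathbf m})$: minimize $J_n(\pi,\gamma_n)$ over $\pi\in\Pi_n$ subject to $J_{l,n}(\pi,\gamma_n)\le m_l$ for all $l$. The extension of $\varphi\in\Phi_n$ to $\mathsf X$ is $\overline\varphi\in\Phi$, $\overline\varphi(\cdot|x)=\varphi(\cdot|Q_n(x))$. **The model $\overline{\text{MDP}}_n$** has state space $\mathsf X$, action space $\mathsf A$, initial distribution $\gamma$, transition kernel $q_n(\cdot|x,a)=\int p(\cdot|z,a)\,\nu_{n,i_n(x)}(dz)$, cost $b_n(x,a)=\int c(z,a)\,\nu_{n,i_n(x)}(dz)$ and constraint functions $r_{l,n}(x,a)=\int d_l(z,a)\,\nu_{n,i_n(x)}(dz)$. $(\overline{\mathbf{CP}}_n^{\mathbf m})$: minimize over $\pi\in\Pi$ the $\beta$-discounted (normalized by $1-\beta$) cost of $b_n$ in $\overline{\text{MDP}}_n$ subject to the $\beta$-discounted (normalized) cost of $r_{l,n}$ in $\overline{\text{MDP}}_n$ being at most $m_l$ for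 all $l$. *)

theory Defs
  imports "HOL-Probability.Probability"
begin

section \<open>Markov decision processes and the law of the controlled process\<close>

record ('s, 'a) mdp =
  states :: "'s measure"
  actions :: "'a measure"
  trans :: "'s \<times> 'a \<Rightarrow> 's measure"
  init :: "'s measure"

definition wf_mdp :: "('s, 'a) mdp \<Rightarrow> bool" where
  "wf_mdp M \<longleftrightarrow>
     trans M \<in> states M \<Otimes>\<^sub>M actions M \<rightarrow>\<^sub>M prob_algebra (states M) \<and>
     init M \<in> space (prob_algebra (states M))"

text \<open>A history of length \<open>t\<close> is a pair of the past \<open>{0..<t} \<rightarrow> S \<times> A\<close> and the current state.
  Measurability into \<open>prob_algebra\<close> expresses that a map is a stochastic kernel.\<close>

definition history :: "('s, 'a) mdp \<Rightarrow> nat \<Rightarrow> ((nat \<Rightarrow> 's \<times> 'a) \<times> 's) measure" where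
  "history M t = PiM {0..<t} (\<lambda>_. states M \<Otimes>\<^sub>M actions M) \<Otimes>\<^sub>M states M"

type_synonym ('s, 'a) policy = "nat \<Rightarrow> (nat \<Rightarrow> 's \<times> 'a) \<times> 's \<Rightarrow> 'a measure"

definition policies :: "('s, 'a) mdp \<Rightarrow> ('s, 'a) policy set" where
  "policies M = {\<pi>. \<forall>t. \<pi> t \<in> history M t \<rightarrow>\<^sub>M prob_algebra (actions M)}"

definition stationary_kernels :: "('s, 'a) mdp \<Rightarrow> ('s \<Rightarrow> 'a measure) set" where
  "stationary_kernels M = states M \<rightarrow>\<^sub>M prob_algebra (actions M)"

definition stationary :: "('s \<Rightarrow> 'a measure) \<Rightarrow> ('s, 'a) policy" where
  "stationary \<phi> = (\<lambda>t h. \<phi> (snd h))"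

definition next_state :: "('s, 'a) mdp \<Rightarrow> nat \<Rightarrow> (nat \<Rightarrow> 's \<times> 'a) \<Rightarrow> 's measure" where
  "next_state M t \<omega> = (case t of 0 \<Rightarrow> init M | Suc u \<Rightarrow> trans M (\<omega> u))"

text \<open>Conditional law of \<open>(X\<^sub>t, A\<^sub>t)\<close> given \<open>(X\<^sub>s, A\<^sub>s)\<^sub>s\<^sub><\<^sub>t\<close>.\<close>

definition step :: "('s, 'a) mdp \<Rightarrow> ('s, 'a) policy \<Rightarrow> nat \<Rightarrow> (nat \<Rightarrow> 's \<times> 'a) \<Rightarrow> ('s \<times> 'a) measure"
  where
  "step M \<pi> t \<omega> =
     next_state M t \<omega> \<bind> (\<lambda>x. distr (\<pi> t (\<omega>, x)) (states M \<Otimes>\<^sub>M actions M) (Pair x))"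

text \<open>The Ionescu-Tulcea measure of the step kernels.  Outside its locale, \<open>projective_family.lim\<close>
  takes the index set, the finite-dimensional marginals and the coordinate spaces as arguments.\<close>

definition law :: "('s, 'a) mdp \<Rightarrow> ('s, 'a) policy \<Rightarrow> (nat \<Rightarrow> 's \<times> 'a) measure" where
  "law M \<pi> = projective_family.lim UNIV
     (Ionescu_Tulcea.CI (step M \<pi>) (\<lambda>_. states M \<Otimes>\<^sub>M actions M))
     (\<lambda>_. states M \<Otimes>\<^sub>M actions M)"

lemma Ionescu_Tulcea_step:
  assumes "wf_mdp M" and "\<pi> \<in> policies M"
  shows "Ionescu_Tulcea (step M \<pi>) (\<lambda>_. states M \<Otimes>\<^sub>M actions M)"
proof -
  let ?M = "\<lambda>_::nat. states M \<Otimes>\<^sub>M actions M"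
  have tr[measurable]: "trans M \<in> states M \<Otimes>\<^sub>M actions M \<rightarrow>\<^sub>M prob_algebra (states M)"
    and ini: "init M \<in> space (prob_algebra (states M))"
    using assms(1) by (auto simp: wf_mdp_def)
  have pol[measurable]: "\<pi> t \<in> PiM {0..<t} ?M \<Otimes>\<^sub>M states M \<rightarrow>\<^sub>M prob_algebra (actions M)" for t
    using assms(2) by (auto simp: policies_def history_def)
  have nx[measurable]: "next_state M t \<in> PiM {0..<t} ?M \<rightarrow>\<^sub>M prob_algebra (states M)" for t
  proof (cases t)
    case 0
    then show ?thesis using ini by (simp add: next_state_def[abs_def])
  next
    case (Suc u)
    have "(\<lambda>\<omega>. trans M (\<omega> u)) \<in> PiM {0..<Suc u} ?M \<rightarrow>\<^sub>M prob_algebra (states M)"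
      by measurable
    then show ?thesis using Suc by (simp add: next_state_def[abs_def])
  qed
  have st: "step M \<pi> t \<in> PiM {0..<t} ?M \<rightarrow>\<^sub>M prob_algebra (states M \<Otimes>\<^sub>M actions M)" for t
    unfolding step_def[abs_def] by measurable
  have "step M \<pi> t \<in> PiM {0..<t} ?M \<rightarrow>\<^sub>M subprob_algebra (states M \<Otimes>\<^sub>M actions M)" for t
    using st by (rule measurable_prob_algebraD)
  moreover have "prob_space (step M \<pi> t \<omega>)" if "\<omega> \<in> space (PiM {0..<t} ?M)" for t \<omega>
    using measurable_space[OF st that] by (simp add: space_prob_algebra)
  ultimately show ?thesis
    by (rule Ionescu_Tulcea.intro)
qed

section \<open>Discounted constrained problems\<close>

definition disc_cost :: "real \<Rightarrow> ('s, 'a) mdp \<Rightarrow> ('s \<times> 'a \<Rightarrow> real) \<Rightarrow> ('s, 'a) policy \<Rightarrow> real" where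
  "disc_cost \<beta> M f \<pi> = (1 - \<beta>) * (\<integral>\<omega>. (\<Sum>t. \<beta> ^ t * f (\<omega> t)) \<partial>law M \<pi>)"

definition feasible ::
  "real \<Rightarrow> ('s, 'a) mdp \<Rightarrow> nat \<Rightarrow> (nat \<Rightarrow> 's \<times> 'a \<Rightarrow> real) \<Rightarrow> (nat \<Rightarrow> real) \<Rightarrow> ('s, 'a) policy set"
  where
  "feasible \<beta> M q d m = {\<pi> \<in> policies M. \<forall>l\<in>{1..q}. disc_cost \<beta> M (d l) \<pi> \<le> m l}"

definition optimal ::
  "real \<Rightarrow> ('s, 'a) mdp \<Rightarrow> ('s \<times> 'a \<Rightarrow> real) \<Rightarrow> nat \<Rightarrow> (nat \<Rightarrow> 's \<times> 'a \<Rightarrow> real) \<Rightarrow> (nat \<Rightarrow> real)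
     \<Rightarrow> ('s, 'a) policy \<Rightarrow> bool" where
  "optimal \<beta> M c q d m \<pi> \<longleftrightarrow>
     \<pi> \<in> feasible \<beta> M q d m \<and>
     (\<forall>\<pi>'\<in>feasible \<beta> M q d m. disc_cost \<beta> M c \<pi> \<le> disc_cost \<beta> M c \<pi>')"

definition opt_value ::
  "real \<Rightarrow> ('s, 'a) mdp \<Rightarrow> ('s \<times> 'a \<Rightarrow> real) \<Rightarrow> nat \<Rightarrow> (nat \<Rightarrow> 's \<times> 'a \<Rightarrow> real) \<Rightarrow> (nat \<Rightarrow> real)
     \<Rightarrow> real" where
  "opt_value \<beta> M c q d m = (INF \<pi>\<in>feasible \<beta> M q d m. disc_cost \<beta> M c \<pi>)"

section \<open>Total variation\<close>

text \<open>Defined as a supremum over events; the normalization by 2, used by some authors, is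
  irrelevant for continuity.\<close>

definition tv_dist :: "'s measure \<Rightarrow> 's measure \<Rightarrow> real" where
  "tv_dist \<mu> \<nu> = (SUP B\<in>sets \<mu>. \<bar>measure \<mu> B - measure \<nu> B\<bar>)"

definition tv_continuous :: "('z::topological_space \<Rightarrow> 's measure) \<Rightarrow> bool" where
  "tv_continuous p \<longleftrightarrow> (\<forall>z. ((\<lambda>z'. tv_dist (p z') (p z)) \<longlongrightarrow> 0) (at z))"

section \<open>Original model, finite models and their extensions\<close>

definition borel_mdp ::
  "('x::topological_space \<times> 'a::topological_space \<Rightarrow> 'x measure) \<Rightarrow> 'x measure \<Rightarrow> ('x, 'a) mdp" where
  "borel_mdp p \<gamma> = \<lparr>states = borel, actions = borel, trans = p, init = \<gamma>\<rparr>"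

definition is_quantizer :: "nat \<Rightarrow> 'x::metric_space set \<Rightarrow> ('x \<Rightarrow> 'x) \<Rightarrow> bool" where
  "is_quantizer n Y Q \<longleftrightarrow>
     finite Y \<and> Y \<noteq> {} \<and> (\<forall>x. (MIN y\<in>Y. dist x y) < 1 / real n) \<and>
     Q \<in> borel \<rightarrow>\<^sub>M borel \<and> (\<forall>x. Q x \<in> Y \<and> dist x (Q x) = (MIN y\<in>Y. dist x y))"

text \<open>Cells are indexed by the grid points \<open>y \<in> Y\<close> themselves, so the cell containing \<open>x\<close> has
  index \<open>Q x\<close>.  \<open>cell_measure Q \<nu> y\<close> is \<open>\<nu>\<close> restricted to the cell of \<open>y\<close> and normalized, regarded as
  a measure on the whole space.\<close>

definition cell_measure :: "('x \<Rightarrow> 'x) \<Rightarrow> 'x measure \<Rightarrow> 'x \<Rightarrow> 'x measure" where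
  "cell_measure Q \<nu> y = uniform_measure \<nu> (Q -` {y})"

definition cell_avg :: "('x \<Rightarrow> 'x) \<Rightarrow> 'x measure \<Rightarrow> ('x \<times> 'a \<Rightarrow> real) \<Rightarrow> 'x \<times> 'a \<Rightarrow> real" where
  "cell_avg Q \<nu> f = (\<lambda>(y, a). \<integral>z. f (z, a) \<partial>cell_measure Q \<nu> y)"

definition finite_mdp ::
  "'x set \<Rightarrow> ('x \<Rightarrow> 'x) \<Rightarrow> 'x measure \<Rightarrow> ('x \<times> 'a::topological_space \<Rightarrow> 'x measure) \<Rightarrow> 'x measure
     \<Rightarrow> ('x, 'a) mdp" where
  "finite_mdp Y Q \<nu> p \<gamma> =
     \<lparr>states = count_space Y, actions = borel,
      trans = (\<lambda>(y, a). point_measure Y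
        (\<lambda>y'. \<integral>\<^sup>+z. emeasure (p (z, a)) (Q -` {y'}) \<partial>cell_measure Q \<nu> y)),
      init = distr \<gamma> (count_space Y) Q\<rparr>"

definition bar_mdp ::
  "('x::topological_space \<Rightarrow> 'x) \<Rightarrow> 'x measure \<Rightarrow> ('x \<times> 'a::topological_space \<Rightarrow> 'x measure)
     \<Rightarrow> 'x measure \<Rightarrow> ('x, 'a) mdp" where
  "bar_mdp Q \<nu> p \<gamma> =
     borel_mdp (\<lambda>(x, a). cell_measure Q \<nu> (Q x) \<bind> (\<lambda>z. p (z, a))) \<gamma>"

definition bar_cost :: "('x \<Rightarrow> 'x) \<Rightarrow> 'x measure \<Rightarrow> ('x \<times> 'a \<Rightarrow> real) \<Rightarrow> 'x \<times> 'a \<Rightarrow> real" where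
  "bar_cost Q \<nu> f = (\<lambda>(x, a). \<integral>z. f (z, a) \<partial>cell_measure Q \<nu> (Q x))"

definition extension :: "('x \<Rightarrow> 'x) \<Rightarrow> ('x \<Rightarrow> 'a measure) \<Rightarrow> 'x \<Rightarrow> 'a measure" where
  "extension Q \<phi> = (\<lambda>x. \<phi> (Q x))"

definition optimal_pair ::
  "real \<Rightarrow> ('x::topological_space \<times> 'a::topological_space \<Rightarrow> 'x measure) \<Rightarrow> 'x measure
     \<Rightarrow> ('x \<times> 'a \<Rightarrow> real) \<Rightarrow> nat \<Rightarrow> (nat \<Rightarrow> 'x \<times> 'a \<Rightarrow> real) \<Rightarrow> (nat \<Rightarrow> real)
     \<Rightarrow> 'x set \<Rightarrow> ('x \<Rightarrow> 'x) \<Rightarrow> 'x measure \<Rightarrow> ('x \<Rightarrow> 'a measure) \<Rightarrow> bool" where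
  "optimal_pair \<beta> p \<gamma> c q d m Y Q \<nu> \<phi> \<longleftrightarrow>
     \<phi> \<in> stationary_kernels (finite_mdp Y Q \<nu> p \<gamma>) \<and>
     optimal \<beta> (finite_mdp Y Q \<nu> p \<gamma>) (cell_avg Q \<nu> c) q (\<lambda>l. cell_avg Q \<nu> (d l)) m
       (stationary \<phi>) \<and>
     optimal \<beta> (bar_mdp Q \<nu> p \<gamma>) (bar_cost Q \<nu> c) q (\<lambda>l. bar_cost Q \<nu> (d l)) m
       (stationary (extension Q \<phi>))"

subsection \<open>Well-formedness of the three models\<close>

lemma wf_borel_mdp:
  assumes "p \<in> borel \<Otimes>\<^sub>M borel \<rightarrow>\<^sub>M prob_algebra borel" "prob_space \<gamma>" "sets \<gamma> = sets borel"
  shows "wf_mdp (borel_mdp p \<gamma>)"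
  using assms by (simp add: wf_mdp_def borel_mdp_def space_prob_algebra)

context
  fixes Y :: "'x::metric_space set" and Q :: "'x \<Rightarrow> 'x" and \<nu> :: "'x measure" and n :: nat
    and p :: "'x \<times> 'a::topological_space \<Rightarrow> 'x measure" and \<gamma> :: "'x measure"
  assumes quant: "is_quantizer n Y Q"
    and \<nu>: "finite_measure \<nu>" "sets \<nu> = sets borel"
    and pos: "\<And>y. y \<in> Y \<Longrightarrow> 0 < emeasure \<nu> (Q -` {y})"
    and p[measurable]: "p \<in> borel \<Otimes>\<^sub>M borel \<rightarrow>\<^sub>M prob_algebra borel"
    and \<gamma>: "prob_space \<gamma>" "sets \<gamma> = sets borel"
begin

lemma quantizer_facts:
  shows "finite Y" "Q x \<in> Y" "Q \<in> borel \<rightarrow>\<^sub>M count_space Y" "Q -` {y} \<in> sets borel"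
proof -
  show fin: "finite Y" and inY: "Q x \<in> Y" for x
    using quant by (auto simp: is_quantizer_def)
  have Q: "Q \<in> borel \<rightarrow>\<^sub>M borel"
    using quant by (simp add: is_quantizer_def)
  show cell: "Q -` {y} \<in> sets borel" for y
    using measurable_sets[OF Q, of "{y}"] by simp
  show "Q \<in> borel \<rightarrow>\<^sub>M count_space Y"
    using fin inY cell by (subst measurable_count_space_eq2) auto
qed

lemma cell_measure_prob:
  assumes "y \<in> Y"
  shows "cell_measure Q \<nu> y \<in> space (prob_algebra borel)"
  unfolding cell_measure_def space_prob_algebra
  using pos[OF assms] \<nu> finite_measure.emeasure_finite[OF \<nu>(1), of "Q -` {y}"]
  by (auto intro!: prob_space_uniform_measure)

lemma wf_bar_mdp: "wf_mdp (bar_mdp Q \<nu> p \<gamma>)"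
proof -
  have [measurable]: "(\<lambda>x. cell_measure Q \<nu> (Q x)) \<in> borel \<rightarrow>\<^sub>M prob_algebra borel"
    by (rule measurable_compose[OF quantizer_facts(3)])
       (use cell_measure_prob in \<open>auto simp: measurable_count_space_eq1\<close>)
  have "(\<lambda>(x, a). cell_measure Q \<nu> (Q x) \<bind> (\<lambda>z. p (z, a)))
      \<in> borel \<Otimes>\<^sub>M borel \<rightarrow>\<^sub>M prob_algebra borel"
    by measurable
  with \<gamma> show ?thesis
    unfolding bar_mdp_def by (intro wf_borel_mdp)
qed

lemma quantizer_fixes: "y \<in> Y \<Longrightarrow> Q y = y"
proof -
  assume y: "y \<in> Y"
  have "dist y (Q y) = (MIN z\<in>Y. dist y z)"
    using quant by (simp add: is_quantizer_def)
  also have "\<dots> \<le> dist y y"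
    using y quantizer_facts(1) by (intro Min_le) auto
  finally show "Q y = y" by simp
qed

lemma finite_mdp_trans:
  assumes y: "y \<in> Y"
  shows "trans (finite_mdp Y Q \<nu> p \<gamma>) (y, a) =
    distr (cell_measure Q \<nu> y \<bind> (\<lambda>z. p (z, a))) (count_space Y) Q"
proof (rule measure_eqI_countable[of _ Y])
  note cm = cell_measure_prob[OF y]
  have pa: "(\<lambda>z. p (z, a)) \<in> borel \<rightarrow>\<^sub>M prob_algebra borel" by measurable
  have sets_b: "sets (cell_measure Q \<nu> y \<bind> (\<lambda>z. p (z, a))) = sets borel"
    by (rule sets_bind'[OF cm pa])
  have Qb: "Q \<in> (cell_measure Q \<nu> y \<bind> (\<lambda>z. p (z, a))) \<rightarrow>\<^sub>M count_space Y"
    using quantizer_facts(3) measurable_cong_sets[OF sets_b refl] by auto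
  fix y' assume y': "y' \<in> Y"
  show "emeasure (trans (finite_mdp Y Q \<nu> p \<gamma>) (y, a)) {y'} =
    emeasure (distr (cell_measure Q \<nu> y \<bind> (\<lambda>z. p (z, a))) (count_space Y) Q) {y'}"
    using y' quantizer_facts(1) quantizer_facts(4)[of y'] sets_eq_imp_space_eq[OF sets_b]
    by (simp add: finite_mdp_def emeasure_distr[OF Qb] emeasure_point_measure_finite
        emeasure_bind_prob_algebra[OF cm pa])
next
  show "countable Y" using quantizer_facts(1) by (rule countable_finite)
qed (simp_all add: finite_mdp_def sets_point_measure)

lemma wf_finite_mdp: "wf_mdp (finite_mdp Y Q \<nu> p \<gamma>)"
proof -
  note [measurable] = quantizer_facts(3)
  have [measurable]: "cell_measure Q \<nu> \<in> count_space Y \<rightarrow>\<^sub>M prob_algebra borel"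
    using cell_measure_prob by (auto simp: measurable_count_space_eq1)
  have [measurable]: "id \<in> count_space Y \<rightarrow>\<^sub>M borel"
    by (simp add: measurable_count_space_eq1)
  have "(\<lambda>(y, a). distr (cell_measure Q \<nu> y \<bind> (\<lambda>z. p (z, a))) (count_space Y) Q)
      \<in> count_space Y \<Otimes>\<^sub>M borel \<rightarrow>\<^sub>M prob_algebra (count_space Y)"
    by measurable
  then have "trans (finite_mdp Y Q \<nu> p \<gamma>) \<in> count_space Y \<Otimes>\<^sub>M borel \<rightarrow>\<^sub>M prob_algebra (count_space Y)"
    by (rule measurable_cong[THEN iffD2, rotated])
       (clarsimp simp only: space_pair_measure space_count_space mem_Sigma_iff finite_mdp_trans prod.case)
  moreover have "distr \<gamma> (count_space Y) Q \<in> space (prob_algebra (count_space Y))"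
    using \<gamma> quantizer_facts(3) measurable_cong_sets[OF \<gamma>(2) refl]
    by (auto simp: space_prob_algebra intro!: prob_space.prob_space_distr)
  ultimately show ?thesis
    by (simp add: wf_mdp_def finite_mdp_def)
qed

end

end

theory Submission
  imports Defs
begin

text \<open>
Replacing the transition law by its average over a cell changes it, uniformly in state and action,
by an amount that tends to zero in total variation: a map that is continuous in total variation on
a compact space is uniformly so, and cells have diameter of order \<open>1/n\<close>. Under a fixed policy such
a perturbation \<open>\<delta>\<close> of one step costs at most \<open>t \<delta>\<close> after \<open>t\<close> steps (\<open>law_integral_compare\<close>), and
discounting makes the total finite. So the discounted costs of a policy in the original model and in
the extended model differ by at most some \<open>e\<^sub>n \<rightarrow> 0\<close>, uniformly over \<^emph>\<open>all\<close> policies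
(\<open>disc_cost_compare\<close>, \<open>extended_disc_cost_uniform\<close>).

Because transitions and costs of the extended model depend on the state only through its cell, all
that matters about a policy is how much discounted mass it puts on each cell and how actions are
distributed there. These data \<open>(s, \<phi>)\<close> satisfy a finite system of balance equations. Every policy
of the extended model and of the finite model yields a solution with the same costs
(\<open>policy_to_balanced\<close>, by conditioning the occupation measure on a cell), and conversely every
solution is realized by the stationary policy \<open>\<phi>\<close> in both models, since the balance equations
determine \<open>s\<close> from \<open>\<phi>\<close> (\<open>balanced_to_policy\<close>). Hence the two constrained problems are the same
finite problem. Its solutions are closed under convex combination of costs
(\<open>balanced_mixture\<close>) and it has an optimal solution whenever it is feasible, by weak
compactness of the probability measures on the action space (\<open>optimal_balanced_exists\<close>).

To choose \<open>\<epsilon>\<close>, mix a nearly optimal policy of the original problem with a small weight \<open>\<theta>\<close> of a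
policy that satisfies the constraints with slack \<open>s\<close>. In the extended model the mixture satisfies
the constraints with slack \<open>\<theta> s - e\<^sub>n\<close>, at least \<open>\<epsilon> = \<theta> s / 2\<close> for large \<open>n\<close>, and its cost
exceeds the optimal value only by \<open>O(\<theta>) + e\<^sub>n\<close> plus the error of the nearly optimal policy. An optimal
policy for the bounds \<open>k - \<epsilon>\<close> in the extended model is no worse than the mixture. Transferred back to
the original model, it loses another \<open>e\<^sub>n \<le> \<epsilon>\<close>: it stays feasible for the bounds \<open>k\<close>, and its
cost stays within \<open>\<kappa>\<close> of the optimal value.
\<close>

section \<open>Integrals against stochastic kernels\<close>

lemma (in prob_space) bounded_integral:
  fixes f :: "'a \<Rightarrow> real"
  assumes "f \<in> borel_measurable M" and "\<And>x. x \<in> space M \<Longrightarrow> \<bar>f x\<bar> \<le> C"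
  shows "integrable M f" and "\<bar>\<integral>x. f x \<partial>M\<bar> \<le> C"
proof -
  show int: "integrable M f"
    using assms by (intro integrable_const_bound[where B=C]) auto
  have "f x \<le> C \<and> - C \<le> f x" if "x \<in> space M" for x
    using assms(2)[OF that] by linarith
  then have "(\<integral>x. f x \<partial>M) \<le> (\<integral>x. C \<partial>M)" "(\<integral>x. - C \<partial>M) \<le> (\<integral>x. f x \<partial>M)"
    using int by (intro integral_mono; simp)+
  then show "\<bar>\<integral>x. f x \<partial>M\<bar> \<le> C"
    by (simp add: prob_space abs_le_iff)
qed

lemma prob_algebraD:
  assumes "\<mu> \<in> space (prob_algebra N)"
  shows "prob_space \<mu>" "sets \<mu> = sets N" "space \<mu> = space N"
  using assms by (auto simp: space_prob_algebra dest: sets_eq_imp_space_eq)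

lemma prob_algebra_bounded_integral:
  fixes f :: "'a \<Rightarrow> real"
  assumes \<mu>: "\<mu> \<in> space (prob_algebra N)"
    and f: "f \<in> borel_measurable N" "\<And>x. x \<in> space N \<Longrightarrow> \<bar>f x\<bar> \<le> C"
  shows "integrable \<mu> f" and "\<bar>\<integral>x. f x \<partial>\<mu>\<bar> \<le> C"
proof -
  note pa = prob_algebraD[OF \<mu>]
  have "f \<in> borel_measurable \<mu>"
    using f(1) measurable_cong_sets[OF pa(2) refl] by auto
  then show "integrable \<mu> f" "\<bar>\<integral>x. f x \<partial>\<mu>\<bar> \<le> C"
    using f(2) pa(3) by (auto intro!: prob_space.bounded_integral[OF pa(1)])
qed

text \<open>The kernel itself depends on \<open>x\<close>, so this is the integral of \<open>f\<close> against the image of \<open>K x\<close> on the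
graph over \<open>x\<close>, and that image depends measurably on \<open>x\<close>.\<close>

lemma kernel_integral_measurable:
  fixes f :: "'a \<times> 'b \<Rightarrow> real"
  assumes f[measurable]: "f \<in> borel_measurable (N \<Otimes>\<^sub>M L)" and K: "K \<in> N \<rightarrow>\<^sub>M prob_algebra L"
  shows "(\<lambda>x. \<integral>y. f (x, y) \<partial>K x) \<in> borel_measurable N"
proof -
  have "(\<lambda>x. distr (K x) (N \<Otimes>\<^sub>M L) (Pair x)) \<in> N \<rightarrow>\<^sub>M subprob_algebra (N \<Otimes>\<^sub>M L)"
    by (rule measurable_distr2[OF _ measurable_prob_algebraD[OF K]]) simp
  from measurable_compose[OF this integral_measurable_subprob_algebra[OF f]]
  have "(\<lambda>x. integral\<^sup>L (distr (K x) (N \<Otimes>\<^sub>M L) (\<lambda>y. (x, y))) f) \<in> borel_measurable N" .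
  then show ?thesis
  proof (rule measurable_cong[THEN iffD1, rotated])
    fix x assume x: "x \<in> space N"
    have "sets (K x) = sets L"
      by (rule prob_algebraD(2)[OF measurable_space[OF K x]])
    then have "Pair x \<in> K x \<rightarrow>\<^sub>M N \<Otimes>\<^sub>M L"
      unfolding measurable_cong_sets[OF \<open>sets (K x) = sets L\<close> refl] by (intro measurable_Pair1' x)
    then show "integral\<^sup>L (distr (K x) (N \<Otimes>\<^sub>M L) (\<lambda>y. (x, y))) f = (\<integral>y. f (x, y) \<partial>K x)"
      using f by (intro integral_distr)
  qed
qed

lemma integral_bind_prob_algebra:
  fixes f :: "'b \<Rightarrow> real"
  assumes A: "A \<in> space (prob_algebra N)" and B: "B \<in> N \<rightarrow>\<^sub>M prob_algebra L"
    and f: "f \<in> borel_measurable L" "\<And>x. x \<in> space L \<Longrightarrow> \<bar>f x\<bar> \<le> C"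
  shows "(\<integral>x. f x \<partial>(A \<bind> B)) = (\<integral>x. (\<integral>y. f y \<partial>B x) \<partial>A)"
proof -
  note Ap = prob_algebraD[OF A]
  have BA: "B \<in> A \<rightarrow>\<^sub>M subprob_algebra L"
    using measurable_prob_algebraD[OF B] measurable_cong_sets[OF Ap(2) refl] by blast
  have ne: "space N \<noteq> {}"
    using prob_space.not_empty[OF Ap(1)] Ap(3) by simp
  interpret A: prob_space A by fact
  have "(\<integral>x. f x \<partial>(A \<bind> B)) = (\<integral>x. f x \<partial>join (distr A (subprob_algebra L) B))"
    using bind_nonempty''[OF BA] ne Ap(3) by simp
  also have "\<dots> = (\<integral>M'. (\<integral>x. f x \<partial>M') \<partial>distr A (subprob_algebra L) B)"
  proof (rule integral_join[OF f, where B'=1])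
    show "finite_measure (distr A (subprob_algebra L) B)"
      by (intro A.finite_measure_distr BA)
    show "AE M' in distr A (subprob_algebra L) B. emeasure M' (space M') \<le> ennreal 1"
      by (auto simp: space_subprob_algebra intro!: subprob_space.emeasure_space_le_1)
  qed auto
  also have "\<dots> = (\<integral>x. (\<integral>y. f y \<partial>B x) \<partial>A)"
    using f(1) by (intro integral_distr BA) auto
  finally show ?thesis .
qed

section \<open>The law of the controlled process, one step at a time\<close>

context
  fixes M :: "('s, 'a) mdp" and \<pi> :: "('s, 'a) policy"
  assumes wf: "wf_mdp M" and pol: "\<pi> \<in> policies M"
begin

lemma transition_measurable: "trans M \<in> states M \<Otimes>\<^sub>M actions M \<rightarrow>\<^sub>M prob_algebra (states M)"
  using wf by (simp add: wf_mdp_def)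

lemma initial_prob: "init M \<in> space (prob_algebra (states M))"
  using wf by (simp add: wf_mdp_def)

lemma policy_measurable:
  "\<pi> t \<in> PiM {0..<t} (\<lambda>_. states M \<Otimes>\<^sub>M actions M) \<Otimes>\<^sub>M states M \<rightarrow>\<^sub>M prob_algebra (actions M)"
  using pol by (auto simp: policies_def history_def)

lemma next_state_measurable:
  "next_state M t \<in> PiM {0..<t} (\<lambda>_. states M \<Otimes>\<^sub>M actions M) \<rightarrow>\<^sub>M prob_algebra (states M)"
proof (cases t)
  case 0
  then show ?thesis using initial_prob by (simp add: next_state_def[abs_def])
next
  case (Suc u)
  note [measurable] = transition_measurable
  have "(\<lambda>\<omega>. trans M (\<omega> u)) \<in> PiM {0..<Suc u} (\<lambda>_. states M \<Otimes>\<^sub>M actions M) \<rightarrow>\<^sub>M prob_algebra (states M)"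
    by measurable
  then show ?thesis using Suc by (simp add: next_state_def[abs_def])
qed

lemma sets_law: "sets (law M \<pi>) = sets (PiM UNIV (\<lambda>_. states M \<Otimes>\<^sub>M actions M))"
proof -
  interpret IT: Ionescu_Tulcea "step M \<pi>" "\<lambda>_. states M \<Otimes>\<^sub>M actions M"
    by (rule Ionescu_Tulcea_step[OF wf pol])
  show ?thesis by (simp add: law_def)
qed

lemma restrict_measurable_law:
  "(\<lambda>\<omega>. restrict \<omega> J) \<in> law M \<pi> \<rightarrow>\<^sub>M PiM J (\<lambda>_. states M \<Otimes>\<^sub>M actions M)"
  by (subst measurable_cong_sets[OF sets_law refl]) (rule measurable_restrict_subset, simp)

lemma coordinate_measurable_law: "(\<lambda>\<omega>. \<omega> t) \<in> law M \<pi> \<rightarrow>\<^sub>M states M \<Otimes>\<^sub>M actions M"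
  by (subst measurable_cong_sets[OF sets_law refl]) measurable

text \<open>The law is a projective limit; this connects it to the finite-horizon measures of the
Ionescu-Tulcea construction, which satisfy a recursion in the horizon.\<close>

lemma law_marginal:
  "distr (law M \<pi>) (PiM {0..<t} (\<lambda>_. states M \<Otimes>\<^sub>M actions M)) (\<lambda>\<omega>. restrict \<omega> {0..<t}) =
    Ionescu_Tulcea.C (step M \<pi>) (\<lambda>_. states M \<Otimes>\<^sub>M actions M) 0 t (\<lambda>_. undefined)"
proof -
  let ?Z = "\<lambda>_::nat. states M \<Otimes>\<^sub>M actions M"
  interpret IT: Ionescu_Tulcea "step M \<pi>" ?Z
    by (rule Ionescu_Tulcea_step[OF wf pol])
  have "distr (law M \<pi>) (PiM {0..<t} ?Z) (\<lambda>\<omega>. restrict \<omega> {0..<t}) = IT.CI {0..<t}"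
    unfolding law_def by (rule IT.distr_lim) simp
  also have "\<dots> = IT.C 0 t (\<lambda>_. undefined)"
  proof (rule measure_eqI)
    show "sets (IT.CI {0..<t}) = sets (IT.C 0 t (\<lambda>_. undefined))"
      using IT.sets_C[of "\<lambda>_. undefined" 0 t] by (simp add: IT.CI_def)
    fix X assume "X \<in> sets (IT.CI {0..<t})"
    then have X: "X \<in> sets (PiM {0..<t} ?Z)" by (simp add: IT.CI_def)
    show "emeasure (IT.CI {0..<t}) X = emeasure (IT.C 0 t (\<lambda>_. undefined)) X"
      using IT.emeasure_CI[OF order_refl X] X sets.sets_into_space[OF X]
        by (simp add: prod_emb_id space_PiM)
  qed
  finally show ?thesis .
qed

lemma prob_space_law: "prob_space (law M \<pi>)"
proof -
  interpret IT: Ionescu_Tulcea "step M \<pi>" "\<lambda>_. states M \<Otimes>\<^sub>M actions M"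
    by (rule Ionescu_Tulcea_step[OF wf pol])
  have "prob_space (IT.C 0 0 (\<lambda>_. undefined))"
    by (rule IT.prob_space_C) simp
  then show ?thesis
    unfolding law_marginal[symmetric] by (rule prob_space_distrD[OF restrict_measurable_law])
qed

text \<open>The dynamic description of the law, from which everything else about it follows: append to the
past a state drawn from the transition law and then an action drawn from the policy.\<close>

lemma law_integral_Suc:
  fixes g :: "(nat \<Rightarrow> 's \<times> 'a) \<Rightarrow> real"
  assumes g: "g \<in> borel_measurable (PiM {0..<Suc t} (\<lambda>_. states M \<Otimes>\<^sub>M actions M))"
    and bound: "\<And>\<omega>. \<omega> \<in> space (PiM {0..<Suc t} (\<lambda>_. states M \<Otimes>\<^sub>M actions M)) \<Longrightarrow> \<bar>g \<omega>\<bar> \<le> C"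
  shows "(\<integral>\<omega>. g (restrict \<omega> {0..<Suc t}) \<partial>law M \<pi>) =
    (\<integral>\<omega>. (\<lambda>h. \<integral>x. (\<integral>a. g (h(t := (x, a))) \<partial>\<pi> t (h, x)) \<partial>next_state M t h)
      (restrict \<omega> {0..<t}) \<partial>law M \<pi>)"
proof -
  let ?Z = "\<lambda>_::nat. states M \<Otimes>\<^sub>M actions M"
  interpret IT: Ionescu_Tulcea "step M \<pi>" ?Z
    by (rule Ionescu_Tulcea_step[OF wf pol])
  note pol_t = policy_measurable[of t] and nx = next_state_measurable[of t]
  note g[measurable]
  let ?C = "\<lambda>t. IT.C 0 t (\<lambda>_. undefined)"
  let ?G = "\<lambda>h. \<integral>x. (\<integral>a. g (h(t := (x, a))) \<partial>\<pi> t (h, x)) \<partial>next_state M t h"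
  have u: "(\<lambda>_. undefined) \<in> space (PiM {0..<0::nat} ?Z)" by (simp add: space_PiM)
  have Cpa: "?C t \<in> space (prob_algebra (PiM {0..<t} ?Z))"
    using IT.prob_space_C[OF u, of t] IT.sets_C[OF u, of t] by (simp add: space_prob_algebra)
  have eP: "IT.eP t \<in> PiM {0..<t} ?Z \<rightarrow>\<^sub>M prob_algebra (PiM {0..<Suc t} ?Z)"
    unfolding prob_algebra_def
    using IT.prob_space_eP IT.measurable_eP[of t] by (intro measurable_restrict_space2) auto
  have upd: "(\<lambda>(h, z). h(t := z)) \<in> PiM {0..<t} ?Z \<Otimes>\<^sub>M (states M \<Otimes>\<^sub>M actions M) \<rightarrow>\<^sub>M PiM {0..<Suc t} ?Z"
    unfolding split_beta'
    by (rule measurable_fun_upd[where J="{0..<t}"]) auto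
  have inner: "(\<integral>\<omega>. g \<omega> \<partial>IT.eP t h) = ?G h" if h: "h \<in> space (PiM {0..<t} ?Z)" for h
  proof -
    have nxh: "next_state M t h \<in> space (prob_algebra (states M))"
      using measurable_space[OF nx h] .
    have [measurable]: "(\<lambda>x. \<pi> t (h, x)) \<in> states M \<rightarrow>\<^sub>M prob_algebra (actions M)"
      using measurable_compose[OF measurable_Pair1'[OF h] pol_t] .
    have stepK: "(\<lambda>x. distr (\<pi> t (h, x)) (states M \<Otimes>\<^sub>M actions M) (Pair x))
        \<in> states M \<rightarrow>\<^sub>M prob_algebra (states M \<Otimes>\<^sub>M actions M)"
      by measurable
    have updh[measurable]: "(\<lambda>z. h(t := z)) \<in> states M \<Otimes>\<^sub>M actions M \<rightarrow>\<^sub>M PiM {0..<Suc t} ?Z"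
      using measurable_compose[OF measurable_Pair1'[OF h] upd] by simp
    have gh[measurable]: "(\<lambda>z. g (h(t := z))) \<in> borel_measurable (states M \<Otimes>\<^sub>M actions M)"
      by measurable
    have "(\<integral>\<omega>. g \<omega> \<partial>IT.eP t h) = (\<integral>z. g (h(t := z)) \<partial>step M \<pi> t h)"
      unfolding IT.eP_def
      using updh measurable_cong_sets[OF IT.sets_P[OF h] refl] by (intro integral_distr g) blast
    also have "\<dots> = (\<integral>x. (\<integral>z. g (h(t := z)) \<partial>distr (\<pi> t (h, x)) (states M \<Otimes>\<^sub>M actions M) (Pair x)) \<partial>next_state M t h)"
      unfolding step_def
      by (rule integral_bind_prob_algebra[OF nxh stepK gh, where C=C])
         (use measurable_space[OF updh] bound in auto)
    also have "\<dots> = ?G h"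
    proof (rule Bochner_Integration.integral_cong[OF refl])
      fix x assume "x \<in> space (next_state M t h)"
      then have x: "x \<in> space (states M)" using prob_algebraD(3)[OF nxh] by simp
      have "(h, x) \<in> space (PiM {0..<t} ?Z \<Otimes>\<^sub>M states M)"
        using h x by (simp add: space_pair_measure)
      note s\<pi> = prob_algebraD(2)[OF measurable_space[OF pol_t this]]
      have "Pair x \<in> \<pi> t (h, x) \<rightarrow>\<^sub>M states M \<Otimes>\<^sub>M actions M"
        unfolding measurable_cong_sets[OF s\<pi> refl] by (intro measurable_Pair1' x)
      then show "(\<integral>z. g (h(t := z)) \<partial>distr (\<pi> t (h, x)) (states M \<Otimes>\<^sub>M actions M) (Pair x)) =
          (\<integral>a. g (h(t := (x, a))) \<partial>\<pi> t (h, x))"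
        by (intro integral_distr gh)
    qed
    finally show ?thesis .
  qed
  have "(\<integral>\<omega>. g (restrict \<omega> {0..<Suc t}) \<partial>law M \<pi>) = (\<integral>\<omega>. g \<omega> \<partial>?C (Suc t))"
    unfolding law_marginal[symmetric] by (rule integral_distr[symmetric, OF restrict_measurable_law g])
  also have "\<dots> = (\<integral>h. (\<integral>\<omega>. g \<omega> \<partial>IT.eP t h) \<partial>?C t)"
    using integral_bind_prob_algebra[OF Cpa eP g bound] by simp
  also have "\<dots> = (\<integral>h. ?G h \<partial>?C t)"
    using inner prob_algebraD(3)[OF Cpa] by (intro Bochner_Integration.integral_cong) auto
  also have "\<dots> = (\<integral>\<omega>. ?G (restrict \<omega> {0..<t}) \<partial>law M \<pi>)"
    unfolding law_marginal[symmetric]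
  proof (rule integral_distr[OF restrict_measurable_law])
    have "(\<lambda>h. \<integral>\<omega>. g \<omega> \<partial>IT.eP t h) \<in> borel_measurable (PiM {0..<t} ?Z)"
      by measurable
    then show "?G \<in> borel_measurable (PiM {0..<t} ?Z)"
      by (rule measurable_cong[THEN iffD1, rotated]) (rule inner)
  qed
  finally show ?thesis .
qed

end

context
  fixes M :: "('s, 'a) mdp" and \<pi> :: "('s, 'a) policy"
  assumes wf: "wf_mdp M" and pol: "\<pi> \<in> policies M"
begin

lemma restrict_in_space_law:
  assumes "\<omega> \<in> space (law M \<pi>)"
  shows "restrict \<omega> J \<in> space (PiM J (\<lambda>_. states M \<Otimes>\<^sub>M actions M))"
  by (rule measurable_space[OF restrict_measurable_law[OF wf pol] assms])

lemma coordinate_in_space_law: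
  assumes "\<omega> \<in> space (law M \<pi>)"
  shows "\<omega> t \<in> space (states M \<Otimes>\<^sub>M actions M)"
  by (rule measurable_space[OF coordinate_measurable_law[OF wf pol] assms])

lemma law_integral_state:
  fixes f :: "'s \<Rightarrow> real"
  assumes f: "f \<in> borel_measurable (states M)" "\<And>x. x \<in> space (states M) \<Longrightarrow> \<bar>f x\<bar> \<le> C"
  shows "(\<integral>\<omega>. f (fst (\<omega> t)) \<partial>law M \<pi>) =
    (\<integral>\<omega>. (\<integral>x. f x \<partial>next_state M t (restrict \<omega> {0..<t})) \<partial>law M \<pi>)"
proof -
  let ?Z = "\<lambda>_::nat. states M \<Otimes>\<^sub>M actions M"
  have c: "(\<lambda>\<omega>. \<omega> t) \<in> PiM {0..<Suc t} ?Z \<rightarrow>\<^sub>M states M \<Otimes>\<^sub>M actions M"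
    by (rule measurable_component_singleton) simp
  note g = measurable_compose[OF measurable_compose[OF c measurable_fst] f(1)]
    and gs = measurable_space[OF measurable_compose[OF c measurable_fst]]
  have "(\<integral>\<omega>. f (fst (\<omega> t)) \<partial>law M \<pi>) =
      (\<integral>\<omega>. (\<lambda>h. \<integral>x. (\<integral>a. f x \<partial>\<pi> t (h, x)) \<partial>next_state M t h) (restrict \<omega> {0..<t}) \<partial>law M \<pi>)"
    using law_integral_Suc[OF wf pol g, of C] gs f(2) by simp
  also have "\<dots> = (\<integral>\<omega>. (\<integral>x. f x \<partial>next_state M t (restrict \<omega> {0..<t})) \<partial>law M \<pi>)"
  proof (rule Bochner_Integration.integral_cong[OF refl])
    fix \<omega> assume "\<omega> \<in> space (law M \<pi>)"
    then have h: "restrict \<omega> {0..<t} \<in> space (PiM {0..<t} ?Z)" (is "?h \<in> _")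
      by (rule restrict_in_space_law)
    show "(\<integral>x. (\<integral>a. f x \<partial>\<pi> t (?h, x)) \<partial>next_state M t ?h) = (\<integral>x. f x \<partial>next_state M t ?h)"
    proof (rule Bochner_Integration.integral_cong[OF refl])
      fix x assume "x \<in> space (next_state M t ?h)"
      then have "(?h, x) \<in> space (PiM {0..<t} ?Z \<Otimes>\<^sub>M states M)"
        using h prob_algebraD(3)[OF measurable_space[OF next_state_measurable[OF wf pol] h]]
        by (simp add: space_pair_measure)
      then have "prob_space (\<pi> t (?h, x))"
        by (rule prob_algebraD(1)[OF measurable_space[OF policy_measurable[OF wf pol]]])
      then show "(\<integral>a. f x \<partial>\<pi> t (?h, x)) = f x"
        by (simp add: prob_space.prob_space)
    qed
  qed
  finally show ?thesis .
qed

lemma law_integral_initial: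
  fixes f :: "'s \<Rightarrow> real"
  assumes "f \<in> borel_measurable (states M)" "\<And>x. x \<in> space (states M) \<Longrightarrow> \<bar>f x\<bar> \<le> C"
  shows "(\<integral>\<omega>. f (fst (\<omega> 0)) \<partial>law M \<pi>) = (\<integral>x. f x \<partial>init M)"
  using law_integral_state[OF assms, of 0] prob_space.prob_space[OF prob_space_law[OF wf pol]]
  by (simp add: next_state_def)

lemma law_integral_transition:
  fixes f :: "'s \<Rightarrow> real"
  assumes "f \<in> borel_measurable (states M)" "\<And>x. x \<in> space (states M) \<Longrightarrow> \<bar>f x\<bar> \<le> C"
  shows "(\<integral>\<omega>. f (fst (\<omega> (Suc t))) \<partial>law M \<pi>) = (\<integral>\<omega>. (\<integral>x. f x \<partial>trans M (\<omega> t)) \<partial>law M \<pi>)"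
  using law_integral_state[OF assms, of "Suc t"] by (simp add: next_state_def)

end

lemma stationary_policy:
  assumes \<phi>: "\<phi> \<in> stationary_kernels M"
  shows "stationary \<phi> \<in> policies M"
proof -
  have "(\<lambda>h. \<phi> (snd h)) \<in> history M t \<rightarrow>\<^sub>M prob_algebra (actions M)" for t
    using measurable_compose[OF measurable_snd \<phi>[unfolded stationary_kernels_def]]
    unfolding history_def .
  then show ?thesis by (simp add: policies_def stationary_def)
qed

lemma law_integral_stationary:
  fixes f :: "'s \<times> 'a \<Rightarrow> real"
  assumes wf: "wf_mdp M" and \<phi>: "\<phi> \<in> stationary_kernels M"
    and f: "f \<in> borel_measurable (states M \<Otimes>\<^sub>M actions M)"
      "\<And>z. z \<in> space (states M \<Otimes>\<^sub>M actions M) \<Longrightarrow> \<bar>f z\<bar> \<le> C"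
  shows "(\<integral>\<omega>. f (\<omega> t) \<partial>law M (stationary \<phi>)) =
    (\<integral>\<omega>. (\<integral>a. f (fst (\<omega> t), a) \<partial>\<phi> (fst (\<omega> t))) \<partial>law M (stationary \<phi>))"
proof -
  let ?Z = "\<lambda>_::nat. states M \<Otimes>\<^sub>M actions M"
  note pol = stationary_policy[OF \<phi>]
  note \<phi>' = \<phi>[unfolded stationary_kernels_def]
  let ?F = "\<lambda>x. \<integral>a. f (x, a) \<partial>\<phi> x"
  have F: "?F \<in> borel_measurable (states M)"
    by (rule kernel_integral_measurable[OF f(1) \<phi>'])
  have F_bound: "\<bar>?F x\<bar> \<le> C" if x: "x \<in> space (states M)" for x
    by (rule prob_algebra_bounded_integral(2)[OF measurable_space[OF \<phi>' x]])
       (use measurable_compose[OF measurable_Pair1'[OF x] f(1)] f(2) x in \<open>auto simp: space_pair_measure\<close>)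
  have c: "(\<lambda>\<omega>. \<omega> t) \<in> PiM {0..<Suc t} ?Z \<rightarrow>\<^sub>M states M \<Otimes>\<^sub>M actions M"
    by (rule measurable_component_singleton) simp
  have "(\<integral>\<omega>. f (\<omega> t) \<partial>law M (stationary \<phi>)) =
     (\<integral>\<omega>. (\<integral>x. ?F x \<partial>next_state M t (restrict \<omega> {0..<t})) \<partial>law M (stationary \<phi>))"
    using law_integral_Suc[OF wf pol measurable_compose[OF c f(1)], of C] f(2) measurable_space[OF c]
    by (simp add: stationary_def)
  also have "\<dots> = (\<integral>\<omega>. ?F (fst (\<omega> t)) \<partial>law M (stationary \<phi>))"
    by (rule law_integral_state[OF wf pol F F_bound, symmetric])
  finally show ?thesis .
qed

text \<open>Telescoping over time: at each step the integrals against the two transition laws differ by at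
most \<open>\<delta>\<close>, and earlier differences are carried along without growth because averaging over later steps
does not increase the bound \<open>C\<close> of the integrand.\<close>

lemma law_integral_compare:
  fixes g :: "(nat \<Rightarrow> 's \<times> 'a) \<Rightarrow> real" and M M' :: "('s, 'a) mdp"
  assumes wf: "wf_mdp M" and wf': "wf_mdp M'"
    and same: "states M' = states M" "actions M' = actions M"
    and pol: "\<pi> \<in> policies M"
    and close: "\<And>t h f. h \<in> space (PiM {0..<t} (\<lambda>_. states M \<Otimes>\<^sub>M actions M)) \<Longrightarrow>
        f \<in> borel_measurable (states M) \<Longrightarrow> (\<And>x. x \<in> space (states M) \<Longrightarrow> \<bar>f x\<bar> \<le> C) \<Longrightarrow>
        \<bar>(\<integral>x. f x \<partial>next_state M t h) - (\<integral>x. f x \<partial>next_state M' t h)\<bar> \<le> \<delta>"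
    and g: "g \<in> borel_measurable (PiM {0..<t} (\<lambda>_. states M \<Otimes>\<^sub>M actions M))"
      "\<And>h. h \<in> space (PiM {0..<t} (\<lambda>_. states M \<Otimes>\<^sub>M actions M)) \<Longrightarrow> \<bar>g h\<bar> \<le> C"
  shows "\<bar>(\<integral>\<omega>. g (restrict \<omega> {0..<t}) \<partial>law M \<pi>) - (\<integral>\<omega>. g (restrict \<omega> {0..<t}) \<partial>law M' \<pi>)\<bar> \<le> real t * \<delta>"
  using g
proof (induction t arbitrary: g)
  case 0
  have pol': "\<pi> \<in> policies M'"
    using pol same by (simp add: policies_def history_def)
  show ?case
    using prob_space.prob_space[OF prob_space_law[OF wf pol]] prob_space.prob_space[OF prob_space_law[OF wf' pol']]
    by (simp add: restrict_def)
next
  case (Suc t)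
  let ?Z = "\<lambda>_::nat. states M \<Otimes>\<^sub>M actions M"
  have pol': "\<pi> \<in> policies M'"
    using pol same by (simp add: policies_def history_def)
  interpret P: prob_space "law M \<pi>" by (rule prob_space_law[OF wf pol])
  define k where "k h x = (\<integral>a. g (h(t := (x, a))) \<partial>\<pi> t (h, x))" for h x
  define G where "G h = (\<integral>x. k h x \<partial>next_state M t h)" for h
  define G' where "G' h = (\<integral>x. k h x \<partial>next_state M' t h)" for h
  have E: "(\<integral>\<omega>. g (restrict \<omega> {0..<Suc t}) \<partial>law M \<pi>) = (\<integral>\<omega>. G (restrict \<omega> {0..<t}) \<partial>law M \<pi>)"
    unfolding G_def k_def by (rule law_integral_Suc[OF wf pol Suc.prems])
  have E': "(\<integral>\<omega>. g (restrict \<omega> {0..<Suc t}) \<partial>law M' \<pi>) = (\<integral>\<omega>. G' (restrict \<omega> {0..<t}) \<partial>law M' \<pi>)"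
    unfolding G'_def k_def by (rule law_integral_Suc[OF wf' pol', unfolded same, OF Suc.prems])
  note policy_K = policy_measurable[OF wf pol, of t]
  have upd: "(\<lambda>((h, x), a). h(t := (x, a))) \<in> (PiM {0..<t} ?Z \<Otimes>\<^sub>M states M) \<Otimes>\<^sub>M actions M \<rightarrow>\<^sub>M PiM {0..<Suc t} ?Z"
    unfolding split_beta'
    by (rule measurable_fun_upd[where J="{0..<t}"]) auto
  have k: "(\<lambda>(h, x). k h x) \<in> borel_measurable (PiM {0..<t} ?Z \<Otimes>\<^sub>M states M)"
    using kernel_integral_measurable[OF measurable_compose[OF upd Suc.prems(1)] policy_K]
    by (simp add: k_def split_beta' del: fun_upd_apply)
  have k_bound: "\<bar>k h x\<bar> \<le> C" if hx: "h \<in> space (PiM {0..<t} ?Z)" "x \<in> space (states M)" for h x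
  proof -
    have hx': "(h, x) \<in> space (PiM {0..<t} ?Z \<Otimes>\<^sub>M states M)"
      using hx by (simp add: space_pair_measure)
    note m = measurable_compose[OF measurable_Pair1'[OF hx'] upd]
    have m': "(\<lambda>a. h(t := (x, a))) \<in> actions M \<rightarrow>\<^sub>M PiM {0..<Suc t} ?Z"
      using m by simp
    show ?thesis unfolding k_def
      by (rule prob_algebra_bounded_integral(2)[OF measurable_space[OF policy_K hx']
            measurable_compose[OF m' Suc.prems(1)] Suc.prems(2)[OF measurable_space[OF m']]])
  qed
  have kh: "(\<lambda>x. k h x) \<in> borel_measurable (states M)" if "h \<in> space (PiM {0..<t} ?Z)" for h
    using measurable_compose[OF measurable_Pair1'[OF that] k] by simp
  have G: "G \<in> borel_measurable (PiM {0..<t} ?Z)"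
    using kernel_integral_measurable[OF k next_state_measurable[OF wf pol, of t]] by (simp add: G_def[abs_def])
  have G': "G' \<in> borel_measurable (PiM {0..<t} ?Z)"
    using kernel_integral_measurable[OF k, of "next_state M' t"] next_state_measurable[OF wf' pol', of t] same
    by (simp add: G'_def[abs_def])
  have G_bound: "\<bar>G h\<bar> \<le> C" if h: "h \<in> space (PiM {0..<t} ?Z)" for h
    unfolding G_def
    by (rule prob_algebra_bounded_integral(2)[OF measurable_space[OF next_state_measurable[OF wf pol] h] kh[OF h] k_bound[OF h]])
  have G'_bound: "\<bar>G' h\<bar> \<le> C" if h: "h \<in> space (PiM {0..<t} ?Z)" for h
    unfolding G'_def
    by (rule prob_algebra_bounded_integral(2)[OF _ kh[OF h] k_bound[OF h]])
       (use measurable_space[OF next_state_measurable[OF wf' pol'], of h t] h same in simp_all)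
  have GG': "\<bar>G h - G' h\<bar> \<le> \<delta>" if h: "h \<in> space (PiM {0..<t} ?Z)" for h
    unfolding G_def G'_def by (rule close[OF h kh[OF h] k_bound[OF h]])
  note rs = restrict_measurable_law[OF wf pol, of "{0..<t}"]
  have int: "integrable (law M \<pi>) (\<lambda>\<omega>. G (restrict \<omega> {0..<t}))"
      "integrable (law M \<pi>) (\<lambda>\<omega>. G' (restrict \<omega> {0..<t}))"
    using G_bound G'_bound restrict_in_space_law[OF wf pol]
    by (auto intro!: P.bounded_integral(1)[where C=C] measurable_compose[OF rs] G G')
  have "\<bar>(\<integral>\<omega>. G (restrict \<omega> {0..<t}) \<partial>law M \<pi>) - (\<integral>\<omega>. G' (restrict \<omega> {0..<t}) \<partial>law M \<pi>)\<bar> \<le> \<delta>"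
    unfolding Bochner_Integration.integral_diff[OF int, symmetric]
    using GG' restrict_in_space_law[OF wf pol]
    by (intro P.bounded_integral(2) borel_measurable_diff measurable_compose[OF rs] G G') auto
  moreover have "\<bar>(\<integral>\<omega>. G' (restrict \<omega> {0..<t}) \<partial>law M \<pi>) - (\<integral>\<omega>. G' (restrict \<omega> {0..<t}) \<partial>law M' \<pi>)\<bar> \<le> real t * \<delta>"
    by (rule Suc.IH[OF G' G'_bound])
  ultimately show ?case
    unfolding E E' by (simp add: distrib_right)
qed

section \<open>Discounted costs and the occupation measure\<close>

lemma integral_pmf_nat:
  fixes g :: "nat \<Rightarrow> real"
  assumes "\<And>t. \<bar>g t\<bar> \<le> C"
  shows "(\<lambda>t. pmf p t * g t) sums (\<integral>t. g t \<partial>measure_pmf p)"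
proof -
  have "integrable (measure_pmf p) g"
    using assms by (intro measure_pmf.bounded_integral(1)) auto
  then have "integrable (count_space UNIV) (\<lambda>t. pmf p t * g t)"
    unfolding measure_pmf_eq_density by (subst (asm) integrable_density) auto
  then show ?thesis
    using sums_integral_count_space_nat[of "\<lambda>t. pmf p t * g t"]
    unfolding measure_pmf_eq_density by (subst integral_density) auto
qed

text \<open>The law of the pair \<open>(X\<^sub>T, A\<^sub>T)\<close> at an independent geometrically distributed time \<open>T\<close>, where
\<open>P(T = t) = (1 - \<beta>) \<beta>\<^sup>t\<close>. Discounted costs are integrals against it.\<close>

definition occupation :: "real \<Rightarrow> ('s, 'a) mdp \<Rightarrow> ('s, 'a) policy \<Rightarrow> ('s \<times> 'a) measure" where
  "occupation \<beta> M \<pi> = measure_pmf (geometric_pmf (1 - \<beta>)) \<bind>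
     (\<lambda>t. distr (law M \<pi>) (states M \<Otimes>\<^sub>M actions M) (\<lambda>\<omega>. \<omega> t))"

context
  fixes M :: "('s, 'a) mdp" and \<pi> :: "('s, 'a) policy" and \<beta> :: real
  assumes wf: "wf_mdp M" and pol: "\<pi> \<in> policies M" and discount: "0 < \<beta>" "\<beta> < 1"
begin

lemma coordinate_kernel:
  "(\<lambda>t. distr (law M \<pi>) (states M \<Otimes>\<^sub>M actions M) (\<lambda>\<omega>. \<omega> t)) \<in>
    count_space UNIV \<rightarrow>\<^sub>M prob_algebra (states M \<Otimes>\<^sub>M actions M)"
  using prob_space.prob_space_distr[OF prob_space_law[OF wf pol] coordinate_measurable_law[OF wf pol]]
  by (simp add: measurable_count_space_eq1 space_prob_algebra)

lemma geometric_in_prob_algebra: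
  "measure_pmf p \<in> space (prob_algebra (count_space UNIV))"
  by (simp add: space_prob_algebra prob_space_measure_pmf)

lemma occupation_prob: "occupation \<beta> M \<pi> \<in> space (prob_algebra (states M \<Otimes>\<^sub>M actions M))"
  unfolding occupation_def
  using prob_space_bind'[OF geometric_in_prob_algebra coordinate_kernel]
    sets_bind'[OF geometric_in_prob_algebra coordinate_kernel]
  by (simp add: space_prob_algebra)

lemma coordinate_integral_bound:
  fixes f :: "'s \<times> 'a \<Rightarrow> real"
  assumes f: "f \<in> borel_measurable (states M \<Otimes>\<^sub>M actions M)"
    "\<And>z. z \<in> space (states M \<Otimes>\<^sub>M actions M) \<Longrightarrow> \<bar>f z\<bar> \<le> C"
  shows "integrable (law M \<pi>) (\<lambda>\<omega>. f (\<omega> t))" and "\<bar>\<integral>\<omega>. f (\<omega> t) \<partial>law M \<pi>\<bar> \<le> C"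
  by (rule prob_space.bounded_integral[OF prob_space_law[OF wf pol]
        measurable_compose[OF coordinate_measurable_law[OF wf pol] f(1)]],
      rule f(2)[OF coordinate_in_space_law[OF wf pol]], assumption)+

lemma occupation_integral_sums:
  fixes f :: "'s \<times> 'a \<Rightarrow> real"
  assumes f: "f \<in> borel_measurable (states M \<Otimes>\<^sub>M actions M)"
    "\<And>z. z \<in> space (states M \<Otimes>\<^sub>M actions M) \<Longrightarrow> \<bar>f z\<bar> \<le> C"
  shows "(\<lambda>t. (1 - \<beta>) * (\<beta> ^ t * (\<integral>\<omega>. f (\<omega> t) \<partial>law M \<pi>))) sums (\<integral>z. f z \<partial>occupation \<beta> M \<pi>)"
proof -
  have "(\<integral>z. f z \<partial>occupation \<beta> M \<pi>) =
      (\<integral>t. (\<integral>z. f z \<partial>distr (law M \<pi>) (states M \<Otimes>\<^sub>M actions M) (\<lambda>\<omega>. \<omega> t)) \<partial>measure_pmf (geometric_pmf (1 - \<beta>)))"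
    unfolding occupation_def
    by (rule integral_bind_prob_algebra[OF geometric_in_prob_algebra coordinate_kernel f])
  also have "\<dots> = (\<integral>t. (\<integral>\<omega>. f (\<omega> t) \<partial>law M \<pi>) \<partial>measure_pmf (geometric_pmf (1 - \<beta>)))"
    by (intro Bochner_Integration.integral_cong refl integral_distr coordinate_measurable_law[OF wf pol] f)
  finally show ?thesis
    using integral_pmf_nat[of "\<lambda>t. \<integral>\<omega>. f (\<omega> t) \<partial>law M \<pi>" C "geometric_pmf (1 - \<beta>)"]
      coordinate_integral_bound(2)[OF f] discount
    by (simp add: mult_ac)
qed

lemma disc_cost_sums:
  fixes f :: "'s \<times> 'a \<Rightarrow> real"
  assumes f: "f \<in> borel_measurable (states M \<Otimes>\<^sub>M actions M)"
    "\<And>z. z \<in> space (states M \<Otimes>\<^sub>M actions M) \<Longrightarrow> \<bar>f z\<bar> \<le> C"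
  shows "(\<lambda>t. (1 - \<beta>) * (\<beta> ^ t * (\<integral>\<omega>. f (\<omega> t) \<partial>law M \<pi>))) sums disc_cost \<beta> M f \<pi>"
proof -
  interpret P: prob_space "law M \<pi>" by (rule prob_space_law[OF wf pol])
  let ?g = "\<lambda>t \<omega>. \<beta> ^ t * f (\<omega> t)"
  have m: "(\<lambda>\<omega>. f (\<omega> t)) \<in> borel_measurable (law M \<pi>)" for t
    by (rule measurable_compose[OF coordinate_measurable_law[OF wf pol] f(1)])
  have bd: "norm (?g t \<omega>) \<le> C * \<beta> ^ t" if "\<omega> \<in> space (law M \<pi>)" for t \<omega>
    using f(2)[OF coordinate_in_space_law[OF wf pol that]] discount
    by (simp add: abs_mult mult.commute mult_right_mono)
  have geo: "summable (\<lambda>t. C * \<beta> ^ t)"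
    using discount by (intro summable_mult summable_geometric) auto
  have "(\<lambda>t. \<integral>\<omega>. ?g t \<omega> \<partial>law M \<pi>) sums (\<integral>\<omega>. (\<Sum>t. ?g t \<omega>) \<partial>law M \<pi>)"
  proof (rule sums_integral)
    show "integrable (law M \<pi>) (?g t)" for t
      by (intro integrable_mult_right coordinate_integral_bound(1)[OF f])
    show "AE \<omega> in law M \<pi>. summable (\<lambda>t. norm (?g t \<omega>))"
      using bd by (intro AE_I2 summable_comparison_test'[OF geo]) auto
    have m: "(\<lambda>\<omega>. norm (?g t \<omega>)) \<in> borel_measurable (law M \<pi>)" for t
      using m[of t] by simp
    have "norm (\<integral>\<omega>. norm (?g t \<omega>) \<partial>law M \<pi>) \<le> C * \<beta> ^ t" for t
      using P.bounded_integral(2)[OF m, of t "C * \<beta> ^ t"] bd[of _ t] by simp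
    then show "summable (\<lambda>t. \<integral>\<omega>. norm (?g t \<omega>) \<partial>law M \<pi>)"
      by (intro summable_comparison_test'[OF geo])
  qed
  from sums_mult[OF this, of "1 - \<beta>"] show ?thesis
    by (simp add: disc_cost_def)
qed

lemma disc_cost_eq_occupation_integral:
  fixes f :: "'s \<times> 'a \<Rightarrow> real"
  assumes f: "f \<in> borel_measurable (states M \<Otimes>\<^sub>M actions M)"
    "\<And>z. z \<in> space (states M \<Otimes>\<^sub>M actions M) \<Longrightarrow> \<bar>f z\<bar> \<le> C"
  shows "disc_cost \<beta> M f \<pi> = (\<integral>z. f z \<partial>occupation \<beta> M \<pi>)"
  by (rule sums_unique2[OF disc_cost_sums[OF f] occupation_integral_sums[OF f]])

text \<open>The geometric time is zero with probability \<open>1 - \<beta>\<close>; otherwise the process has just made a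
transition out of the pair observed at an again geometric time.\<close>

lemma occupation_balance:
  fixes f :: "'s \<Rightarrow> real"
  assumes f: "f \<in> borel_measurable (states M)" "\<And>x. x \<in> space (states M) \<Longrightarrow> \<bar>f x\<bar> \<le> C"
  shows "(\<integral>z. f (fst z) \<partial>occupation \<beta> M \<pi>) =
    (1 - \<beta>) * (\<integral>x. f x \<partial>init M) + \<beta> * (\<integral>z. (\<integral>x. f x \<partial>trans M z) \<partial>occupation \<beta> M \<pi>)"
proof -
  let ?a = "\<lambda>t. \<integral>\<omega>. f (fst (\<omega> t)) \<partial>law M \<pi>"
  let ?b = "\<lambda>t. \<integral>\<omega>. (\<integral>x. f x \<partial>trans M (\<omega> t)) \<partial>law M \<pi>"
  note T = transition_measurable[OF wf pol]
  have A: "(\<lambda>t. (1 - \<beta>) * (\<beta> ^ t * ?a t)) sums (\<integral>z. f (fst z) \<partial>occupation \<beta> M \<pi>)"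
    by (rule occupation_integral_sums[of "\<lambda>z. f (fst z)" C])
       (use measurable_compose[OF measurable_fst f(1)] f(2) in \<open>auto simp: space_pair_measure\<close>)
  have B: "(\<lambda>t. (1 - \<beta>) * (\<beta> ^ t * ?b t)) sums (\<integral>z. (\<integral>x. f x \<partial>trans M z) \<partial>occupation \<beta> M \<pi>)"
  proof (rule occupation_integral_sums[of "\<lambda>z. \<integral>x. f x \<partial>trans M z" C])
    show "(\<lambda>z. \<integral>x. f x \<partial>trans M z) \<in> borel_measurable (states M \<Otimes>\<^sub>M actions M)"
      by (rule measurable_compose[OF measurable_prob_algebraD[OF T] integral_measurable_subprob_algebra[OF f(1)]])
    show "\<bar>\<integral>x. f x \<partial>trans M z\<bar> \<le> C" if "z \<in> space (states M \<Otimes>\<^sub>M actions M)" for z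
      by (rule prob_algebra_bounded_integral(2)[OF measurable_space[OF T that] f])
  qed
  have "(1 - \<beta>) * (\<beta> ^ Suc t * ?a (Suc t)) = \<beta> * ((1 - \<beta>) * (\<beta> ^ t * ?b t))" for t
    using law_integral_transition[OF wf pol f, of t] by simp
  then have "(\<lambda>t. (1 - \<beta>) * (\<beta> ^ Suc t * ?a (Suc t))) sums
      (\<beta> * (\<integral>z. (\<integral>x. f x \<partial>trans M z) \<partial>occupation \<beta> M \<pi>))"
    using sums_mult[OF B, of \<beta>] by presburger
  then have "(\<lambda>t. (1 - \<beta>) * (\<beta> ^ t * ?a t)) sums
      (\<beta> * (\<integral>z. (\<integral>x. f x \<partial>trans M z) \<partial>occupation \<beta> M \<pi>) + (1 - \<beta>) * (\<beta> ^ 0 * ?a 0))"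
    by (subst sums_Suc_iff[symmetric])
  from sums_unique2[OF A this] show ?thesis
    using law_integral_initial[OF wf pol f] by simp
qed

end

text \<open>The time-\<open>t\<close> costs differ by at most \<open>(t + 1) \<delta> + \<epsilon>\<close>, and
\<open>(1 - \<beta>) \<Sum>\<^sub>t (t + 1) \<beta>\<^sup>t = 1 / (1 - \<beta>)\<close>.\<close>

lemma disc_cost_compare:
  fixes f f' :: "'s \<times> 'a \<Rightarrow> real" and M M' :: "('s, 'a) mdp"
  assumes wf: "wf_mdp M" and wf': "wf_mdp M'"
    and same: "states M' = states M" "actions M' = actions M"
    and pol: "\<pi> \<in> policies M" and discount: "0 < \<beta>" "\<beta> < 1"
    and close: "\<And>t h g. h \<in> space (PiM {0..<t} (\<lambda>_. states M \<Otimes>\<^sub>M actions M)) \<Longrightarrow>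
        g \<in> borel_measurable (states M) \<Longrightarrow> (\<And>x. x \<in> space (states M) \<Longrightarrow> \<bar>g x\<bar> \<le> C) \<Longrightarrow>
        \<bar>(\<integral>x. g x \<partial>next_state M t h) - (\<integral>x. g x \<partial>next_state M' t h)\<bar> \<le> \<delta>"
    and f: "f \<in> borel_measurable (states M \<Otimes>\<^sub>M actions M)"
      "\<And>z. z \<in> space (states M \<Otimes>\<^sub>M actions M) \<Longrightarrow> \<bar>f z\<bar> \<le> C"
    and f': "f' \<in> borel_measurable (states M \<Otimes>\<^sub>M actions M)"
      "\<And>z. z \<in> space (states M \<Otimes>\<^sub>M actions M) \<Longrightarrow> \<bar>f z - f' z\<bar> \<le> \<epsilon>"
  shows "\<bar>disc_cost \<beta> M f \<pi> - disc_cost \<beta> M' f' \<pi>\<bar> \<le> \<delta> / (1 - \<beta>) + \<epsilon>"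
proof -
  let ?Z = "states M \<Otimes>\<^sub>M actions M"
  have pol': "\<pi> \<in> policies M'"
    using pol same by (simp add: policies_def history_def)
  have f'_bound: "\<bar>f' z\<bar> \<le> C + \<epsilon>" if "z \<in> space ?Z" for z
    using f(2)[OF that] f'(2)[OF that] by linarith
  let ?a = "\<lambda>t. \<integral>\<omega>. f (\<omega> t) \<partial>law M \<pi>" and ?a' = "\<lambda>t. \<integral>\<omega>. f' (\<omega> t) \<partial>law M' \<pi>"
  have diff: "\<bar>?a t - ?a' t\<bar> \<le> real (Suc t) * \<delta> + \<epsilon>" for t
  proof -
    have c: "(\<lambda>\<omega>. \<omega> t) \<in> PiM {0..<Suc t} (\<lambda>_. ?Z) \<rightarrow>\<^sub>M ?Z"
      by (rule measurable_component_singleton) simp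
    have "\<bar>?a t - (\<integral>\<omega>. f (\<omega> t) \<partial>law M' \<pi>)\<bar> \<le> real (Suc t) * \<delta>"
    proof -
      have "\<bar>(\<integral>\<omega>. f (restrict \<omega> {0..<Suc t} t) \<partial>law M \<pi>) - (\<integral>\<omega>. f (restrict \<omega> {0..<Suc t} t) \<partial>law M' \<pi>)\<bar>
          \<le> real (Suc t) * \<delta>"
      proof (rule law_integral_compare[where g="\<lambda>\<omega>. f (\<omega> t)" and C=C, OF wf wf' same pol])
        show "\<bar>f (h t)\<bar> \<le> C" if "h \<in> space (PiM {0..<Suc t} (\<lambda>_. ?Z))" for h
          by (rule f(2)[OF measurable_space[OF c that]])
      qed (fact close measurable_compose[OF c f(1)])+
      then show ?thesis by simp
    qed
    moreover have "\<bar>(\<integral>\<omega>. f (\<omega> t) \<partial>law M' \<pi>) - ?a' t\<bar> \<le> \<epsilon>"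
    proof -
      note i = coordinate_integral_bound[OF wf' pol' discount, unfolded same]
      have "(\<integral>\<omega>. f (\<omega> t) \<partial>law M' \<pi>) - ?a' t = (\<integral>\<omega>. f (\<omega> t) - f' (\<omega> t) \<partial>law M' \<pi>)"
        by (rule Bochner_Integration.integral_diff[symmetric, OF i(1)[OF f] i(1)[OF f'(1) f'_bound]])
      also have "\<bar>\<dots>\<bar> \<le> \<epsilon>"
        by (rule i(2)[of "\<lambda>z. f z - f' z", OF borel_measurable_diff[OF f(1) f'(1)] f'(2)])
      finally show ?thesis .
    qed
    ultimately show ?thesis by linarith
  qed
  have "(\<lambda>t. real (Suc t) * \<beta> ^ t) sums (1 / (1 - \<beta>)\<^sup>2)"
    using geometric_deriv_sums[of \<beta>] discount by simp
  from sums_mult[OF this, of "(1 - \<beta>) * \<delta>"]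
  have "(\<lambda>t. (1 - \<beta>) * \<delta> * (real (Suc t) * \<beta> ^ t)) sums (\<delta> / (1 - \<beta>))"
    using discount by (simp add: power2_eq_square)
  moreover have "(\<lambda>t. (1 - \<beta>) * \<epsilon> * \<beta> ^ t) sums \<epsilon>"
    using sums_mult[OF geometric_sums[of \<beta>], of "(1 - \<beta>) * \<epsilon>"] discount by simp
  ultimately have bound: "(\<lambda>t. (1 - \<beta>) * \<delta> * (real (Suc t) * \<beta> ^ t) + (1 - \<beta>) * \<epsilon> * \<beta> ^ t) sums (\<delta> / (1 - \<beta>) + \<epsilon>)"
    by (rule sums_add)
  have S: "(\<lambda>t. (1 - \<beta>) * (\<beta> ^ t * ?a t) - (1 - \<beta>) * (\<beta> ^ t * ?a' t)) sums
      (disc_cost \<beta> M f \<pi> - disc_cost \<beta> M' f' \<pi>)"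
    using disc_cost_sums[OF wf pol discount f]
      disc_cost_sums[OF wf' pol' discount, unfolded same, OF f'(1) f'_bound]
    by (rule sums_diff)
  have term_le: "\<bar>(1 - \<beta>) * (\<beta> ^ t * ?a t) - (1 - \<beta>) * (\<beta> ^ t * ?a' t)\<bar> \<le>
      (1 - \<beta>) * \<delta> * (real (Suc t) * \<beta> ^ t) + (1 - \<beta>) * \<epsilon> * \<beta> ^ t" for t
  proof -
    have "\<bar>(1 - \<beta>) * (\<beta> ^ t * ?a t) - (1 - \<beta>) * (\<beta> ^ t * ?a' t)\<bar> = (1 - \<beta>) * \<beta> ^ t * \<bar>?a t - ?a' t\<bar>"
      using discount by (simp add: abs_mult right_diff_distrib[symmetric] mult.assoc)
    also have "\<dots> \<le> (1 - \<beta>) * \<beta> ^ t * (real (Suc t) * \<delta> + \<epsilon>)"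
      using discount by (intro mult_left_mono diff) auto
    finally show ?thesis by (simp add: algebra_simps)
  qed
  show ?thesis
  proof (rule abs_leI)
    show "disc_cost \<beta> M f \<pi> - disc_cost \<beta> M' f' \<pi> \<le> \<delta> / (1 - \<beta>) + \<epsilon>"
      by (rule sums_le[OF _ S bound]) (use term_le in \<open>force simp: abs_le_iff\<close>)
    show "- (disc_cost \<beta> M f \<pi> - disc_cost \<beta> M' f' \<pi>) \<le> \<delta> / (1 - \<beta>) + \<epsilon>"
      by (rule sums_le[OF _ sums_minus[OF S] bound]) (use term_le in \<open>force simp: abs_le_iff\<close>)
  qed
qed

section \<open>Mixing and conditioning of action distributions\<close>

text \<open>The identity is stated with the weights unnormalized so that it also holds, trivially, when both are
zero; this spares case distinctions on cells that are never visited.\<close>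

lemma mixture_prob_algebra:
  fixes w1 w2 :: real
  assumes w: "0 \<le> w1" "0 \<le> w2" and \<mu>: "\<mu>1 \<in> space (prob_algebra A)" "\<mu>2 \<in> space (prob_algebra A)"
  obtains \<mu> where "\<mu> \<in> space (prob_algebra A)"
    "\<And>f :: 'a \<Rightarrow> real. f \<in> borel_measurable A \<Longrightarrow> (\<exists>C. \<forall>a\<in>space A. \<bar>f a\<bar> \<le> C) \<Longrightarrow>
       (w1 + w2) * (\<integral>a. f a \<partial>\<mu>) = w1 * (\<integral>a. f a \<partial>\<mu>1) + w2 * (\<integral>a. f a \<partial>\<mu>2)"
proof (cases "w1 + w2 = 0")
  case True
  then have "w1 = 0" "w2 = 0" using w by auto
  then show ?thesis using that[OF \<mu>(1)] by simp
next
  case False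
  define \<theta> where "\<theta> = w1 / (w1 + w2)"
  have \<theta>: "0 \<le> \<theta>" "\<theta> \<le> 1" "(w1 + w2) * \<theta> = w1" "(w1 + w2) * (1 - \<theta>) = w2"
    using w False by (auto simp: \<theta>_def field_simps)
  let ?b = "measure_pmf (bernoulli_pmf \<theta>)" and ?K = "\<lambda>b. if b then \<mu>1 else \<mu>2"
  have b: "?b \<in> space (prob_algebra (count_space UNIV))"
    by (simp add: space_prob_algebra prob_space_measure_pmf)
  have K: "?K \<in> count_space UNIV \<rightarrow>\<^sub>M prob_algebra A"
    using \<mu> by (simp add: measurable_count_space_eq1)
  show ?thesis
  proof (rule that)
    show "?b \<bind> ?K \<in> space (prob_algebra A)"
      using prob_space_bind'[OF b K] sets_bind'[OF b K] by (simp add: space_prob_algebra)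
    fix f :: "'a \<Rightarrow> real" assume f: "f \<in> borel_measurable A" "\<exists>C. \<forall>a\<in>space A. \<bar>f a\<bar> \<le> C"
    then obtain C where "\<And>a. a \<in> space A \<Longrightarrow> \<bar>f a\<bar> \<le> C" by blast
    from integral_bind_prob_algebra[OF b K f(1) this]
    have I_eq: "(\<integral>a. f a \<partial>(?b \<bind> ?K)) = (\<integral>a. f a \<partial>\<mu>1) * \<theta> + (\<integral>a. f a \<partial>\<mu>2) * (1 - \<theta>)"
      using \<theta>(1,2) by simp
    have "(w1 + w2) * (\<integral>a. f a \<partial>(?b \<bind> ?K)) =
        ((w1 + w2) * \<theta>) * (\<integral>a. f a \<partial>\<mu>1) + ((w1 + w2) * (1 - \<theta>)) * (\<integral>a. f a \<partial>\<mu>2)"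
      unfolding I_eq by (simp add: algebra_simps)
    then show "(w1 + w2) * (\<integral>a. f a \<partial>(?b \<bind> ?K)) = w1 * (\<integral>a. f a \<partial>\<mu>1) + w2 * (\<integral>a. f a \<partial>\<mu>2)"
      unfolding \<theta>(3,4) .
  qed
qed

text \<open>Conditional law of the second coordinate given that the first lies in \<open>E\<close>. Multiplying by the mass of
\<open>E\<close> covers null events, where any probability measure serves.\<close>

lemma conditional_prob_algebra:
  assumes \<zeta>: "\<zeta> \<in> space (prob_algebra (S \<Otimes>\<^sub>M A))" and E: "E \<in> sets S"
  obtains \<mu> where "\<mu> \<in> space (prob_algebra A)"
    "\<And>f :: 'a \<Rightarrow> real. f \<in> borel_measurable A \<Longrightarrow> (\<exists>C. \<forall>a\<in>space A. \<bar>f a\<bar> \<le> C) \<Longrightarrow>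
       measure \<zeta> (E \<times> space A) * (\<integral>a. f a \<partial>\<mu>) = (\<integral>z. indicator E (fst z) * f (snd z) \<partial>\<zeta>)"
proof -
  note \<zeta>' = prob_algebraD[OF \<zeta>]
  interpret Z: prob_space \<zeta> by (rule \<zeta>'(1))
  have snd: "snd \<in> \<zeta> \<rightarrow>\<^sub>M A"
    unfolding measurable_cong_sets[OF \<zeta>'(2) refl] by (rule measurable_snd)
  have fst: "fst \<in> \<zeta> \<rightarrow>\<^sub>M S"
    unfolding measurable_cong_sets[OF \<zeta>'(2) refl] by (rule measurable_fst)
  let ?E = "E \<times> space A"
  have Es: "?E \<in> sets \<zeta>"
    using E unfolding \<zeta>'(2) by (intro pair_measureI) auto
  have ind: "indicator ?E z = (indicator E (fst z) :: real)" if "z \<in> space \<zeta>" for z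
    using that \<zeta>'(3) by (auto simp: space_pair_measure indicator_def)
  show ?thesis
  proof (cases "emeasure \<zeta> ?E = 0")
    case True
    then have "AE z in \<zeta>. z \<notin> ?E" using Es by (intro AE_not_in null_setsI)
    then have z: "AE z in \<zeta>. indicator E (fst z) * f (snd z) = 0" for f :: "'a \<Rightarrow> real"
      using AE_space by eventually_elim (use \<zeta>'(3) in \<open>auto simp: space_pair_measure indicator_def\<close>)
    have m0: "measure \<zeta> ?E = 0" using True by (simp add: measure_def)
    show ?thesis
    proof (rule that)
      show "distr \<zeta> A snd \<in> space (prob_algebra A)"
        using Z.prob_space_distr[OF snd] by (simp add: space_prob_algebra)
    qed (simp add: m0 integral_eq_zero_AE[OF z])
  next
    case False
    let ?U = "uniform_measure \<zeta> ?E"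
    have fin: "emeasure \<zeta> ?E \<noteq> \<infinity>" by simp
    interpret U: prob_space ?U
      by (rule prob_space_uniform_measure[OF False fin])
    have snd': "snd \<in> ?U \<rightarrow>\<^sub>M A"
      unfolding measurable_cong_sets[OF sets_uniform_measure refl] by (rule snd)
    have m: "measure \<zeta> ?E > 0" 
      using False by (simp add: Z.emeasure_eq_measure zero_less_measure_iff)
    show ?thesis
    proof (rule that)
      show "distr ?U A snd \<in> space (prob_algebra A)"
        using U.prob_space_distr[OF snd'] by (simp add: space_prob_algebra)
      fix f :: "'a \<Rightarrow> real" assume f: "f \<in> borel_measurable A"
      have fs: "(\<lambda>z. f (snd z)) \<in> borel_measurable \<zeta>"
        by (rule measurable_compose[OF snd f])
      have "(\<integral>a. f a \<partial>distr ?U A snd) = (\<integral>z. f (snd z) \<partial>?U)"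
        by (rule integral_distr[OF snd' f])
      also have "\<dots> = (\<integral>z. (indicator ?E z / measure \<zeta> ?E) * f (snd z) \<partial>\<zeta>)"
      proof -
        have "?U = density \<zeta> (\<lambda>z. ennreal (indicator ?E z / measure \<zeta> ?E))"
          unfolding uniform_measure_def
          using m Es[measurable]
          by (intro density_cong) (measurable, simp_all add: Z.emeasure_eq_measure divide_ennreal[symmetric] ennreal_indicator)
        then show ?thesis
          using fs Es m by (simp only:) (subst integral_density; simp)
      qed
      also have "\<dots> = (\<integral>z. (indicator E (fst z) * f (snd z)) / measure \<zeta> ?E \<partial>\<zeta>)"
        by (intro Bochner_Integration.integral_cong refl) (simp add: ind)
      finally show "measure \<zeta> ?E * (\<integral>a. f a \<partial>distr ?U A snd) = (\<integral>z. indicator E (fst z) * f (snd z) \<partial>\<zeta>)"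
        using m by simp
    qed
  qed
qed

section \<open>Balance equations of a finite model\<close>

text \<open>Here \<open>P y (y', a)\<close> is the probability of moving from \<open>y'\<close> to \<open>y\<close> under action \<open>a\<close>: the target comes first,
so that \<open>P y\<close> is itself a cost function on state-action pairs.\<close>

locale finite_model =
  fixes Y :: "'y set" and A :: "'a measure" and g :: "'y \<Rightarrow> real" and P :: "'y \<Rightarrow> 'y \<times> 'a \<Rightarrow> real"
    and \<beta> :: real
  assumes finite_Y: "finite Y" and discount: "0 < \<beta>" "\<beta> < 1"
    and g_sum: "(\<Sum>y\<in>Y. g y) = 1"
    and P_measurable: "\<And>y y'. y \<in> Y \<Longrightarrow> y' \<in> Y \<Longrightarrow> (\<lambda>a. P y (y', a)) \<in> borel_measurable A"
    and P_nonneg: "\<And>y z. y \<in> Y \<Longrightarrow> z \<in> Y \<times> space A \<Longrightarrow> 0 \<le> P y z"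
    and P_sum: "\<And>z. z \<in> Y \<times> space A \<Longrightarrow> (\<Sum>y\<in>Y. P y z) = 1"
begin

definition randomized :: "('y \<Rightarrow> 'a measure) \<Rightarrow> bool" where
  "randomized \<phi> \<longleftrightarrow> (\<forall>y\<in>Y. \<phi> y \<in> space (prob_algebra A))"

definition bounded_cost :: "('y \<times> 'a \<Rightarrow> real) \<Rightarrow> bool" where
  "bounded_cost F \<longleftrightarrow> (\<forall>y\<in>Y. (\<lambda>a. F (y, a)) \<in> borel_measurable A) \<and>
     (\<exists>C. \<forall>z\<in>Y \<times> space A. \<bar>F z\<bar> \<le> C)"

definition cost :: "('y \<times> 'a \<Rightarrow> real) \<Rightarrow> ('y \<Rightarrow> real) \<Rightarrow> ('y \<Rightarrow> 'a measure) \<Rightarrow> real" where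
  "cost F s \<phi> = (\<Sum>y\<in>Y. s y * (\<integral>a. F (y, a) \<partial>\<phi> y))"

text \<open>\<open>s y\<close> is the normalized discounted time spent in \<open>y\<close> under the stationary policy \<open>\<phi>\<close>.\<close>

definition balanced :: "('y \<Rightarrow> real) \<Rightarrow> ('y \<Rightarrow> 'a measure) \<Rightarrow> bool" where
  "balanced s \<phi> \<longleftrightarrow> (\<forall>y\<in>Y. 0 \<le> s y \<and> s y = (1 - \<beta>) * g y + \<beta> * cost (P y) s \<phi>)"

lemma P_le_1: "y \<in> Y \<Longrightarrow> z \<in> Y \<times> space A \<Longrightarrow> P y z \<le> 1"
  using P_sum[of z] P_nonneg[of _ z] finite_Y member_le_sum[of y Y "\<lambda>y. P y z"] by auto

lemma bounded_cost_P: "y \<in> Y \<Longrightarrow> bounded_cost (P y)"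
  using P_measurable P_nonneg P_le_1 unfolding bounded_cost_def
  by (auto intro!: exI[of _ 1] simp: abs_le_iff)

lemma bounded_cost_integrable:
  assumes "bounded_cost F" "randomized \<phi>" "y \<in> Y"
  shows "integrable (\<phi> y) (\<lambda>a. F (y, a))"
proof -
  obtain C where C: "\<And>z. z \<in> Y \<times> space A \<Longrightarrow> \<bar>F z\<bar> \<le> C"
    using assms(1) by (auto simp: bounded_cost_def)
  show ?thesis
    by (rule prob_algebra_bounded_integral(1)[where N=A and C=C])
       (use assms C in \<open>auto simp: bounded_cost_def randomized_def\<close>)
qed

lemma expected_P_sum:
  assumes \<phi>: "randomized \<phi>" and y': "y' \<in> Y"
  shows "(\<Sum>y\<in>Y. \<integral>a. P y (y', a) \<partial>\<phi> y') = 1"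
proof -
  have pa: "\<phi> y' \<in> space (prob_algebra A)" using assms by (simp add: randomized_def)
  note pa' = prob_algebraD[OF pa]
  have "(\<Sum>y\<in>Y. \<integral>a. P y (y', a) \<partial>\<phi> y') = (\<integral>a. (\<Sum>y\<in>Y. P y (y', a)) \<partial>\<phi> y')"
    using bounded_cost_integrable[OF bounded_cost_P \<phi> y']
    by (intro Bochner_Integration.integral_sum[symmetric])
  also have "\<dots> = (\<integral>a. 1 \<partial>\<phi> y')"
    using P_sum y' pa'(3) by (intro Bochner_Integration.integral_cong) auto
  also have "\<dots> = 1" using prob_space.prob_space[OF pa'(1)] by simp
  finally show ?thesis .
qed

lemma expected_P_nonneg:
  assumes \<phi>: "randomized \<phi>" and y: "y \<in> Y" "y' \<in> Y"
  shows "0 \<le> (\<integral>a. P y (y', a) \<partial>\<phi> y')"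
proof -
  have "space (\<phi> y') = space A"
    using assms by (auto simp: randomized_def dest: prob_algebraD)
  then show ?thesis using P_nonneg y by (intro integral_nonneg_AE AE_I2) auto
qed

lemma sum_cost_P:
  assumes \<phi>: "randomized \<phi>"
  shows "(\<Sum>y\<in>Y. cost (P y) s \<phi>) = (\<Sum>y\<in>Y. s y)"
proof -
  have "(\<Sum>y\<in>Y. cost (P y) s \<phi>) = (\<Sum>y'\<in>Y. \<Sum>y\<in>Y. s y' * (\<integral>a. P y (y', a) \<partial>\<phi> y'))"
    unfolding cost_def by (rule sum.swap)
  also have "\<dots> = (\<Sum>y'\<in>Y. s y' * 1)"
    using expected_P_sum[OF \<phi>] by (intro sum.cong refl) (simp add: sum_distrib_left[symmetric])
  finally show ?thesis by simp
qed

lemma balanced_sum: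
  assumes \<phi>: "randomized \<phi>" and s: "balanced s \<phi>"
  shows "(\<Sum>y\<in>Y. s y) = 1"
proof -
  have "(\<Sum>y\<in>Y. s y) = (\<Sum>y\<in>Y. (1 - \<beta>) * g y + \<beta> * cost (P y) s \<phi>)"
    using s by (intro sum.cong) (auto simp: balanced_def)
  also have "\<dots> = (1 - \<beta>) + \<beta> * (\<Sum>y\<in>Y. s y)"
    using g_sum sum_cost_P[OF \<phi>] by (simp add: sum.distrib sum_distrib_left[symmetric])
  finally have "(1 - \<beta>) * (\<Sum>y\<in>Y. s y) = 1 - \<beta>" by (simp add: algebra_simps)
  then show ?thesis using discount by simp
qed

text \<open>For fixed \<open>\<phi>\<close> the right-hand side of the balance equation is a contraction with factor \<open>\<beta>\<close> in the
\<open>\<ell>\<^sup>1\<close> norm, since the transition probabilities out of each state sum to one.\<close>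

lemma balanced_unique:
  assumes \<phi>: "randomized \<phi>" and s: "balanced s \<phi>" "balanced s' \<phi>" and y: "y \<in> Y"
  shows "s y = s' y"
proof -
  let ?D = "\<lambda>y. \<bar>s y - s' y\<bar>"
  have "?D y \<le> \<beta> * cost (P y) ?D \<phi>" if y: "y \<in> Y" for y
  proof -
    have "s y - s' y = \<beta> * (\<Sum>y'\<in>Y. (s y' - s' y') * (\<integral>a. P y (y', a) \<partial>\<phi> y'))"
    proof -
      have "s y - s' y = \<beta> * (cost (P y) s \<phi> - cost (P y) s' \<phi>)"
        using s y unfolding balanced_def by (metis add_diff_cancel_left right_diff_distrib)
      then show ?thesis by (simp add: cost_def sum_subtractf left_diff_distrib)
    qed
    also have "\<bar>\<dots>\<bar> \<le> \<beta> * (\<Sum>y'\<in>Y. \<bar>(s y' - s' y') * (\<integral>a. P y (y', a) \<partial>\<phi> y')\<bar>)"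
      using discount sum_abs[of _ Y] unfolding abs_mult[of \<beta>] by (simp add: mult_left_mono)
    also have "\<dots> = \<beta> * cost (P y) ?D \<phi>"
      using expected_P_nonneg[OF \<phi> y] by (simp add: cost_def abs_mult)
    finally show ?thesis .
  qed
  then have "(\<Sum>y\<in>Y. ?D y) \<le> (\<Sum>y\<in>Y. \<beta> * cost (P y) ?D \<phi>)"
    by (rule sum_mono)
  also have "\<dots> = \<beta> * (\<Sum>y\<in>Y. ?D y)"
    by (simp add: sum_distrib_left[symmetric] sum_cost_P[OF \<phi>])
  finally have "(1 - \<beta>) * (\<Sum>y\<in>Y. ?D y) \<le> 0" by (simp add: algebra_simps)
  then have "(\<Sum>y\<in>Y. ?D y) \<le> 0" using discount by (simp add: mult_le_0_iff)
  moreover have "?D y \<le> (\<Sum>y\<in>Y. ?D y)"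
    using y finite_Y by (intro member_le_sum) auto
  ultimately show ?thesis by simp
qed

text \<open>The occupation measures \<open>s y \<phi> y\<close> form a convex set; in terms of \<open>(s, \<phi>)\<close> the action distribution at \<open>y\<close> is
weighted by the time each solution spends there.\<close>

lemma balanced_mixture:
  assumes \<phi>1: "randomized \<phi>1" "balanced s1 \<phi>1" and \<phi>2: "randomized \<phi>2" "balanced s2 \<phi>2"
    and \<theta>: "0 \<le> \<theta>" "\<theta> \<le> 1"
  obtains s \<phi> where "randomized \<phi>" "balanced s \<phi>"
    "\<And>F. bounded_cost F \<Longrightarrow> cost F s \<phi> = \<theta> * cost F s1 \<phi>1 + (1 - \<theta>) * cost F s2 \<phi>2"
proof -
  define s where "s y = \<theta> * s1 y + (1 - \<theta>) * s2 y" for y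
  have "\<exists>\<mu>. \<mu> \<in> space (prob_algebra A) \<and>
    (\<forall>f :: 'a \<Rightarrow> real. f \<in> borel_measurable A \<longrightarrow> (\<exists>C. \<forall>a\<in>space A. \<bar>f a\<bar> \<le> C) \<longrightarrow>
       s y * (\<integral>a. f a \<partial>\<mu>) = \<theta> * s1 y * (\<integral>a. f a \<partial>\<phi>1 y) + (1 - \<theta>) * s2 y * (\<integral>a. f a \<partial>\<phi>2 y))" if y: "y \<in> Y" for y
    using mixture_prob_algebra[of "\<theta> * s1 y" "(1 - \<theta>) * s2 y" "\<phi>1 y" A "\<phi>2 y"] assms y
    unfolding s_def randomized_def balanced_def by (smt (verit) mult_nonneg_nonneg)
  then obtain \<phi> where \<phi>: "\<And>y. y \<in> Y \<Longrightarrow> \<phi> y \<in> space (prob_algebra A)"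
    and \<phi>_int: "\<And>y f. y \<in> Y \<Longrightarrow> f \<in> borel_measurable A \<Longrightarrow> \<exists>C::real. \<forall>a\<in>space A. \<bar>f a\<bar> \<le> C \<Longrightarrow>
       s y * (\<integral>a. f a \<partial>\<phi> y) = \<theta> * s1 y * (\<integral>a. f a \<partial>\<phi>1 y) + (1 - \<theta>) * s2 y * (\<integral>a. f a \<partial>\<phi>2 y)"
    by metis
  have r: "randomized \<phi>" using \<phi> by (simp add: randomized_def)
  have c: "cost F s \<phi> = \<theta> * cost F s1 \<phi>1 + (1 - \<theta>) * cost F s2 \<phi>2" if F: "bounded_cost F" for F
  proof -
    have "s y * (\<integral>a. F (y, a) \<partial>\<phi> y) =
        \<theta> * (s1 y * (\<integral>a. F (y, a) \<partial>\<phi>1 y)) + (1 - \<theta>) * (s2 y * (\<integral>a. F (y, a) \<partial>\<phi>2 y))" if y: "y \<in> Y" for y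
      using \<phi>_int[OF y, of "\<lambda>a. F (y, a)"] F y by (fastforce simp: bounded_cost_def mult.assoc)
    then show ?thesis by (simp add: cost_def sum.distrib sum_distrib_left)
  qed
  have "balanced s \<phi>"
    unfolding balanced_def
  proof (intro ballI conjI)
    fix y assume y: "y \<in> Y"
    have e: "s1 y = (1 - \<beta>) * g y + \<beta> * cost (P y) s1 \<phi>1" "s2 y = (1 - \<beta>) * g y + \<beta> * cost (P y) s2 \<phi>2"
      and n: "0 \<le> s1 y" "0 \<le> s2 y"
      using \<phi>1 \<phi>2 y by (auto simp: balanced_def)
    show "0 \<le> s y" using n \<theta> by (simp add: s_def)
    show "s y = (1 - \<beta>) * g y + \<beta> * cost (P y) s \<phi>"
      unfolding c[OF bounded_cost_P[OF y]] s_def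
      by (subst e(1), subst e(2)) (simp add: algebra_simps)
  qed
  with r c show ?thesis using that by blast
qed

end

section \<open>Models that aggregate to a finite model\<close>

text \<open>The state enters the dynamics only through \<open>Q\<close>. Two instances are used: the extended model with
the quantizer, and the finite model with the identity.\<close>

locale aggregated_mdp = finite_model Y A g P \<beta>
  for Y :: "'y set" and A :: "'a measure" and g P \<beta> +
  fixes M :: "('s, 'a) mdp" and Q :: "'s \<Rightarrow> 'y"
  assumes wf: "wf_mdp M" and actions_A: "actions M = A" and Q: "Q \<in> states M \<rightarrow>\<^sub>M count_space Y"
    and init_cell: "\<And>y. y \<in> Y \<Longrightarrow> measure (init M) {x \<in> space (states M). Q x = y} = g y"
    and trans_cell: "\<And>x a y. x \<in> space (states M) \<Longrightarrow> a \<in> space A \<Longrightarrow> y \<in> Y \<Longrightarrow>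
      measure (trans M (x, a)) {x' \<in> space (states M). Q x' = y} = P y (Q x, a)"
begin

lemma Q_in: "x \<in> space (states M) \<Longrightarrow> Q x \<in> Y"
  using measurable_space[OF Q] by simp

lemma cell_sets: "{x \<in> space (states M). Q x = y} \<in> sets (states M)" if "y \<in> Y"
proof -
  have "{x \<in> space (states M). Q x = y} = Q -` {y} \<inter> space (states M)" by auto
  then show ?thesis using measurable_sets[OF Q, of "{y}"] that by simp
qed

definition lift :: "('y \<times> 'a \<Rightarrow> real) \<Rightarrow> 's \<times> 'a \<Rightarrow> real" where
  "lift F = (\<lambda>(x, a). F (Q x, a))"

lemma lift_measurable: "bounded_cost F \<Longrightarrow> lift F \<in> borel_measurable (states M \<Otimes>\<^sub>M A)"
proof -
  assume F: "bounded_cost F"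
  have "F \<in> borel_measurable (count_space Y \<Otimes>\<^sub>M A)"
    by (rule measurable_pair_measure_countable1)
       (use finite_Y F in \<open>auto simp: countable_finite bounded_cost_def\<close>)
  moreover have "(\<lambda>z. (Q (fst z), snd z)) \<in> states M \<Otimes>\<^sub>M A \<rightarrow>\<^sub>M count_space Y \<Otimes>\<^sub>M A"
    by (intro measurable_Pair measurable_snd measurable_compose[OF measurable_fst Q])
  ultimately show ?thesis
    unfolding lift_def split_beta' by (rule measurable_compose[rotated])
qed

lemma lift_bounded: "bounded_cost F \<Longrightarrow> \<exists>C. \<forall>z\<in>space (states M \<Otimes>\<^sub>M A). \<bar>lift F z\<bar> \<le> C"
  unfolding bounded_cost_def lift_def by (fastforce simp: space_pair_measure dest: Q_in)

lemma disc_cost_lift: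
  assumes F: "bounded_cost F" and pol: "\<pi> \<in> policies M"
  shows "disc_cost \<beta> M (lift F) \<pi> = (\<integral>z. lift F z \<partial>occupation \<beta> M \<pi>)"
proof -
  obtain C where "\<And>z. z \<in> space (states M \<Otimes>\<^sub>M A) \<Longrightarrow> \<bar>lift F z\<bar> \<le> C"
    using lift_bounded[OF F] by blast
  then show ?thesis
    using disc_cost_eq_occupation_integral[OF wf pol discount, of "lift F" C] lift_measurable[OF F]
    by (simp add: actions_A)
qed

text \<open>For \<open>\<pi>\<close> stationary with kernel \<open>\<phi>\<close> on the cells, this is the solution \<open>s\<close> of the balance equation of \<open>\<phi>\<close>.\<close>

definition cell_mass :: "('s, 'a) policy \<Rightarrow> 'y \<Rightarrow> real" where
  "cell_mass \<pi> y = measure (occupation \<beta> M \<pi>) ({x \<in> space (states M). Q x = y} \<times> space A)"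

lemma occupation_in_prob_algebra:
  "\<pi> \<in> policies M \<Longrightarrow> occupation \<beta> M \<pi> \<in> space (prob_algebra (states M \<Otimes>\<^sub>M A))"
  using occupation_prob[OF wf _ discount] by (simp add: actions_A)

lemma cell_mass_balance:
  assumes pol: "\<pi> \<in> policies M" and y: "y \<in> Y"
  shows "cell_mass \<pi> y = (1 - \<beta>) * g y + \<beta> * disc_cost \<beta> M (lift (P y)) \<pi>"
proof -
  let ?E = "{x \<in> space (states M). Q x = y}"
  note T = transition_measurable[OF wf pol] and I = initial_prob[OF wf pol]
  note occ = prob_algebraD[OF occupation_in_prob_algebra[OF pol]]
  have E: "(indicator ?E :: 's \<Rightarrow> real) \<in> borel_measurable (states M)" "\<And>x. \<bar>indicator ?E x\<bar> \<le> (1::real)"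
    using cell_sets[OF y] by (auto simp: indicator_def)
  have "cell_mass \<pi> y = (\<integral>z. indicator (?E \<times> space A) z \<partial>occupation \<beta> M \<pi>)"
  proof -
    have "?E \<times> space A \<in> sets (occupation \<beta> M \<pi>)"
      using cell_sets[OF y] unfolding occ(2) by (intro pair_measureI) auto
    then show ?thesis
      using sets.sets_into_space by (simp add: cell_mass_def Int_absorb2)
  qed
  also have "\<dots> = (\<integral>z. indicator ?E (fst z) \<partial>occupation \<beta> M \<pi>)"
    using occ(3) by (intro Bochner_Integration.integral_cong) (auto simp: space_pair_measure indicator_def)
  also have "\<dots> = (1 - \<beta>) * (\<integral>x. indicator ?E x \<partial>init M) + \<beta> * (\<integral>z. (\<integral>x. indicator ?E x \<partial>trans M z) \<partial>occupation \<beta> M \<pi>)"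
    by (rule occupation_balance[OF wf pol discount E])
  also have "(\<integral>x. indicator ?E x \<partial>init M) = g y"
    using init_cell[OF y] prob_algebraD(3)[OF I] by (simp add: Int_absorb2)
  also have "(\<integral>z. (\<integral>x. indicator ?E x \<partial>trans M z) \<partial>occupation \<beta> M \<pi>) = (\<integral>z. lift (P y) z \<partial>occupation \<beta> M \<pi>)"
  proof (rule Bochner_Integration.integral_cong[OF refl])
    fix z assume "z \<in> space (occupation \<beta> M \<pi>)"
    then have z: "z \<in> space (states M \<Otimes>\<^sub>M A)" using occ(3) by simp
    then have "space (trans M z) = space (states M)"
      using prob_algebraD(3)[OF measurable_space[OF T, of z]] actions_A by simp
    then show "(\<integral>x. indicator ?E x \<partial>trans M z) = lift (P y) z"
      using z trans_cell[of "fst z" "snd z" y] y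
      by (cases z) (auto simp: lift_def space_pair_measure Int_absorb2)
  qed
  also have "\<dots> = disc_cost \<beta> M (lift (P y)) \<pi>"
    by (rule disc_cost_lift[OF bounded_cost_P[OF y] pol, symmetric])
  finally show ?thesis .
qed

text \<open>If \<open>\<phi>\<close> describes how actions are distributed on each cell, in the sense that it gives the right
costs, then the balance of the occupation measure becomes the balance equation: transition
probabilities into a cell are themselves such costs.\<close>

lemma balanced_cell_mass:
  assumes pol: "\<pi> \<in> policies M"
    and agg: "\<And>F. bounded_cost F \<Longrightarrow> disc_cost \<beta> M (lift F) \<pi> = cost F (cell_mass \<pi>) \<phi>"
  shows "balanced (cell_mass \<pi>) \<phi>"
  unfolding balanced_def
proof (intro ballI conjI)
  fix y assume y: "y \<in> Y"
  show "0 \<le> cell_mass \<pi> y" by (simp add: cell_mass_def)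
  show "cell_mass \<pi> y = (1 - \<beta>) * g y + \<beta> * cost (P y) (cell_mass \<pi>) \<phi>"
    using cell_mass_balance[OF pol y] agg[OF bounded_cost_P[OF y]] by simp
qed

lemma disc_cost_by_cells:
  assumes F: "bounded_cost F" and pol: "\<pi> \<in> policies M"
  shows "disc_cost \<beta> M (lift F) \<pi> =
    (\<Sum>y\<in>Y. \<integral>z. indicator {x \<in> space (states M). Q x = y} (fst z) * F (y, snd z) \<partial>occupation \<beta> M \<pi>)"
proof -
  let ?E = "\<lambda>y. {x \<in> space (states M). Q x = y}"
  note occ = prob_algebraD[OF occupation_in_prob_algebra[OF pol]]
  obtain C where C: "\<And>z. z \<in> Y \<times> space A \<Longrightarrow> \<bar>F z\<bar> \<le> C"
    using F by (auto simp: bounded_cost_def)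
  have int: "integrable (occupation \<beta> M \<pi>) (\<lambda>z. indicator (?E y) (fst z) * F (y, snd z))" if y: "y \<in> Y" for y
  proof (rule prob_algebra_bounded_integral(1)[OF occupation_in_prob_algebra[OF pol], where C="\<bar>C\<bar>"])
    have m: "(\<lambda>a. F (y, a)) \<in> borel_measurable A"
      using F y by (simp add: bounded_cost_def)
    show "(\<lambda>z. indicator (?E y) (fst z) * F (y, snd z)) \<in> borel_measurable (states M \<Otimes>\<^sub>M A)"
      by (intro borel_measurable_times measurable_compose[OF measurable_snd m]
          measurable_compose[OF measurable_fst borel_measurable_indicator] cell_sets y)
    show "\<bar>indicator (?E y) (fst z) * F (y, snd z)\<bar> \<le> \<bar>C\<bar>" if "z \<in> space (states M \<Otimes>\<^sub>M A)" for z
      using C[of "(y, snd z)"] y that by (auto simp: space_pair_measure indicator_def abs_mult)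
  qed
  have "(\<integral>z. lift F z \<partial>occupation \<beta> M \<pi>) =
      (\<integral>z. (\<Sum>y\<in>Y. indicator (?E y) (fst z) * F (y, snd z)) \<partial>occupation \<beta> M \<pi>)"
  proof (rule Bochner_Integration.integral_cong[OF refl])
    fix z assume "z \<in> space (occupation \<beta> M \<pi>)"
    then have z: "fst z \<in> space (states M)" using occ(3) by (auto simp: space_pair_measure)
    then have "(\<Sum>y\<in>Y. indicator (?E y) (fst z) * F (y, snd z)) = (\<Sum>y\<in>Y. if y = Q (fst z) then F (y, snd z) else 0)"
      by (intro sum.cong) (auto simp: indicator_def)
    also have "\<dots> = lift F z"
      using Q_in[OF z] finite_Y by (simp add: lift_def split_beta')
    finally show "lift F z = (\<Sum>y\<in>Y. indicator (?E y) (fst z) * F (y, snd z))" ..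
  qed
  also have "\<dots> = (\<Sum>y\<in>Y. \<integral>z. indicator (?E y) (fst z) * F (y, snd z) \<partial>occupation \<beta> M \<pi>)"
    by (rule Bochner_Integration.integral_sum[OF int])
  finally show ?thesis using disc_cost_lift[OF F pol] by simp
qed

text \<open>Arbitrary history-dependent policies reduce to solutions of the balance equation: take for \<open>\<phi> y\<close> the
conditional law of the action, under the occupation measure, given that the state is in the cell \<open>y\<close>.\<close>

theorem policy_to_balanced:
  assumes pol: "\<pi> \<in> policies M"
  obtains s \<phi> where "randomized \<phi>" "balanced s \<phi>"
    "\<And>F. bounded_cost F \<Longrightarrow> disc_cost \<beta> M (lift F) \<pi> = cost F s \<phi>"
proof -
  let ?E = "\<lambda>y. {x \<in> space (states M). Q x = y}" and ?\<zeta> = "occupation \<beta> M \<pi>"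
  \<comment> \<open>Bundled into one predicate so that the choice of \<open>\<phi>\<close> is a plain choice.\<close>
  define R where "R y \<mu> \<longleftrightarrow> \<mu> \<in> space (prob_algebra A) \<and>
      (\<forall>f :: 'a \<Rightarrow> real. f \<in> borel_measurable A \<longrightarrow> (\<exists>C. \<forall>a\<in>space A. \<bar>f a\<bar> \<le> C) \<longrightarrow>
        cell_mass \<pi> y * (\<integral>a. f a \<partial>\<mu>) = (\<integral>z. indicator (?E y) (fst z) * f (snd z) \<partial>?\<zeta>))" for y \<mu>
  have "\<exists>\<mu>. R y \<mu>" if "y \<in> Y" for y
  proof (rule conditional_prob_algebra[OF occupation_in_prob_algebra[OF pol] cell_sets[OF that]])
  qed (auto simp: R_def cell_mass_def)
  then obtain \<phi> where \<phi>: "\<And>y. y \<in> Y \<Longrightarrow> R y (\<phi> y)" by metis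
  have agg: "disc_cost \<beta> M (lift F) \<pi> = cost F (cell_mass \<pi>) \<phi>" if F: "bounded_cost F" for F
  proof -
    have "cell_mass \<pi> y * (\<integral>a. F (y, a) \<partial>\<phi> y) = (\<integral>z. indicator (?E y) (fst z) * F (y, snd z) \<partial>?\<zeta>)" if y: "y \<in> Y" for y
      by (rule \<phi>[OF y, unfolded R_def, THEN conjunct2, rule_format]) (use F y in \<open>auto simp: bounded_cost_def\<close>)
    then show ?thesis unfolding disc_cost_by_cells[OF F pol] cost_def by simp
  qed
  show ?thesis
    by (rule that[OF _ balanced_cell_mass[OF pol agg] agg]) (use \<phi> in \<open>auto simp: randomized_def R_def\<close>)
qed

lemma randomized_stationary:
  assumes \<phi>: "randomized \<phi>"
  shows "(\<lambda>x. \<phi> (Q x)) \<in> stationary_kernels M"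
  unfolding stationary_kernels_def actions_A
  by (rule measurable_compose[OF Q]) (use \<phi> in \<open>auto simp: randomized_def measurable_count_space_eq1\<close>)

text \<open>Under the stationary policy, \<open>F\<close> and its average \<open>G\<close> over the actions have the same cost, so
\<open>\<phi>\<close> together with the cell masses satisfies the balance equation; by uniqueness these masses are \<open>s\<close>.\<close>

theorem balanced_to_policy:
  assumes \<phi>: "randomized \<phi>" and s: "balanced s \<phi>" and F: "bounded_cost F"
  shows "disc_cost \<beta> M (lift F) (stationary (\<lambda>x. \<phi> (Q x))) = cost F s \<phi>"
proof -
  define \<pi> where "\<pi> = stationary (\<lambda>x. \<phi> (Q x))"
  have pol: "\<pi> \<in> policies M"
    unfolding \<pi>_def by (rule stationary_policy[OF randomized_stationary[OF \<phi>]])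
  have agg: "disc_cost \<beta> M (lift F) \<pi> = cost F (cell_mass \<pi>) \<phi>" if F: "bounded_cost F" for F
  proof -
    define G where "G = (\<lambda>(y, a :: 'a). \<integral>a'. F (y, a') \<partial>\<phi> y)"
    obtain C where C: "\<And>z. z \<in> Y \<times> space A \<Longrightarrow> \<bar>F z\<bar> \<le> C"
      using F by (auto simp: bounded_cost_def)
    have "\<bar>G z\<bar> \<le> C" if "z \<in> Y \<times> space A" for z
      unfolding G_def split_beta'
      by (rule prob_algebra_bounded_integral(2)[where N=A])
         (use that C F \<phi> in \<open>auto simp: bounded_cost_def randomized_def\<close>)
    then have G: "bounded_cost G" by (auto simp: bounded_cost_def G_def)
    obtain C where C: "\<And>z. z \<in> space (states M \<Otimes>\<^sub>M A) \<Longrightarrow> \<bar>lift F z\<bar> \<le> C"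
      using lift_bounded[OF F] by blast
    obtain C' where C': "\<And>z. z \<in> space (states M \<Otimes>\<^sub>M A) \<Longrightarrow> \<bar>lift G z\<bar> \<le> C'"
      using lift_bounded[OF G] by blast
    have same: "(\<integral>\<omega>. lift F (\<omega> t) \<partial>law M \<pi>) = (\<integral>\<omega>. lift G (\<omega> t) \<partial>law M \<pi>)" for t
      unfolding \<pi>_def
      using law_integral_stationary[OF wf randomized_stationary[OF \<phi>], of "lift F" C t] lift_measurable[OF F] C
      by (simp add: actions_A lift_def G_def split_beta')
    have "disc_cost \<beta> M (lift F) \<pi> = disc_cost \<beta> M (lift G) \<pi>"
      using disc_cost_sums[OF wf pol discount, of "lift F" C] disc_cost_sums[OF wf pol discount, of "lift G" C']
        lift_measurable[OF F] lift_measurable[OF G] C C'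
      unfolding actions_A same by (blast intro: sums_unique2)
    also have "\<dots> = cost F (cell_mass \<pi>) \<phi>"
      unfolding disc_cost_by_cells[OF G pol] cost_def
    proof (rule sum.cong[OF refl])
      fix y assume y: "y \<in> Y"
      let ?E = "{x \<in> space (states M). Q x = y}"
      note occ = prob_algebraD[OF occupation_in_prob_algebra[OF pol]]
      have "?E \<times> space A \<in> sets (occupation \<beta> M \<pi>)"
        using cell_sets[OF y] unfolding occ(2) by (intro pair_measureI) auto
      then have "cell_mass \<pi> y = (\<integral>z. indicator (?E \<times> space A) z \<partial>occupation \<beta> M \<pi>)"
        using sets.sets_into_space by (simp add: cell_mass_def Int_absorb2)
      also have "\<dots> = (\<integral>z. indicator ?E (fst z) \<partial>occupation \<beta> M \<pi>)"
        using occ(3) by (intro Bochner_Integration.integral_cong) (auto simp: space_pair_measure indicator_def)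
      finally show "(\<integral>z. indicator ?E (fst z) * G (y, snd z) \<partial>occupation \<beta> M \<pi>) =
          cell_mass \<pi> y * (\<integral>a. F (y, a) \<partial>\<phi> y)"
        by (simp add: G_def)
    qed
    finally show ?thesis .
  qed
  have "cost F (cell_mass \<pi>) \<phi> = cost F s \<phi>"
    unfolding cost_def using balanced_unique[OF \<phi> balanced_cell_mass[OF pol agg] s] by (intro sum.cong) auto
  then show ?thesis using agg[OF F] by (simp add: \<pi>_def)
qed

end

context aggregated_mdp
begin

text \<open>Optimality over the finite problem is optimality over all policies, since policies and solutions of
the balance equation produce the same cost vectors.\<close>

lemma optimal_lift:
  assumes \<phi>: "randomized \<phi>" "balanced s \<phi>" "\<And>l. l \<in> {1..q} \<Longrightarrow> cost (F l) s \<phi> \<le> m l"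
    and F: "bounded_cost F0" "\<And>l. l \<in> {1..q} \<Longrightarrow> bounded_cost (F l)"
    and minimal: "\<And>s' \<phi>'. randomized \<phi>' \<Longrightarrow> balanced s' \<phi>' \<Longrightarrow> (\<forall>l\<in>{1..q}. cost (F l) s' \<phi>' \<le> m l) \<Longrightarrow>
      cost F0 s \<phi> \<le> cost F0 s' \<phi>'"
  shows "optimal \<beta> M (lift F0) q (\<lambda>l. lift (F l)) m (stationary (\<lambda>x. \<phi> (Q x)))"
  unfolding optimal_def
proof
  show "stationary (\<lambda>x. \<phi> (Q x)) \<in> feasible \<beta> M q (\<lambda>l. lift (F l)) m"
    using stationary_policy[OF randomized_stationary[OF \<phi>(1)]] \<phi>(3) balanced_to_policy[OF \<phi>(1,2) F(2)]
    by (simp add: feasible_def)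
  show "\<forall>\<pi>\<in>feasible \<beta> M q (\<lambda>l. lift (F l)) m.
      disc_cost \<beta> M (lift F0) (stationary (\<lambda>x. \<phi> (Q x))) \<le> disc_cost \<beta> M (lift F0) \<pi>"
  proof
    fix \<pi> assume \<pi>: "\<pi> \<in> feasible \<beta> M q (\<lambda>l. lift (F l)) m"
    then have "\<pi> \<in> policies M" by (simp add: feasible_def)
    then obtain s' \<phi>' where \<phi>': "randomized \<phi>'" "balanced s' \<phi>'"
      and eq: "\<And>F. bounded_cost F \<Longrightarrow> disc_cost \<beta> M (lift F) \<pi> = cost F s' \<phi>'"
      using policy_to_balanced by blast
    have "\<forall>l\<in>{1..q}. cost (F l) s' \<phi>' \<le> m l"
      using \<pi> eq[OF F(2)] by (auto simp: feasible_def)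
    from minimal[OF \<phi>' this] show "disc_cost \<beta> M (lift F0) (stationary (\<lambda>x. \<phi> (Q x))) \<le> disc_cost \<beta> M (lift F0) \<pi>"
      using balanced_to_policy[OF \<phi>(1,2) F(1)] eq[OF F(1)] by simp
  qed
qed

end

section \<open>Weak compactness of probability measures on a compact metric space\<close>

text \<open>The binary membership sequence of a point, read in base 3. Base 3 leaves gaps between the codes of
different sequences, so that close codes force agreement on a long initial segment.\<close>

definition ternary_code :: "(nat \<Rightarrow> 'a set) \<Rightarrow> 'a \<Rightarrow> real" where
  "ternary_code B a = (\<Sum>i. indicator (B i) a * (1 / 3) ^ i)"

lemma ternary_code_summable: "summable (\<lambda>i. indicator (B i) a * (1 / 3 :: real) ^ i)"
  by (rule summable_comparison_test'[of "\<lambda>i. (1 / 3) ^ i"]) (auto simp: indicator_def)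

lemma ternary_code_range: "0 \<le> ternary_code B a" "ternary_code B a \<le> 3 / 2"
proof -
  show "0 \<le> ternary_code B a"
    unfolding ternary_code_def by (intro suminf_nonneg ternary_code_summable) auto
  have "ternary_code B a \<le> (\<Sum>i. (1 / 3) ^ i)"
    unfolding ternary_code_def
    by (intro suminf_le ternary_code_summable summable_geometric) (auto simp: indicator_def)
  then show "ternary_code B a \<le> 3 / 2" by (simp add: suminf_geometric)
qed

text \<open>At the first index \<open>j\<close> of disagreement the codes differ by \<open>3\<^sup>-\<^sup>j\<close>, of which later digits can cancel
at most half.\<close>

lemma ternary_code_separates:
  assumes close: "\<bar>ternary_code B a - ternary_code B b\<bar> < (1 / 3) ^ N / 2" and i: "i \<le> N"
  shows "a \<in> B i \<longleftrightarrow> b \<in> B i"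
proof (rule ccontr)
  assume "\<not> (a \<in> B i \<longleftrightarrow> b \<in> B i)"
  then obtain j where j: "\<not> (a \<in> B j \<longleftrightarrow> b \<in> B j)" and min: "\<And>l. l < j \<Longrightarrow> (a \<in> B l \<longleftrightarrow> b \<in> B l)"
    and "j \<le> i"
    using exists_least_iff[of "\<lambda>j. \<not> (a \<in> B j \<longleftrightarrow> b \<in> B j)"] by (metis not_le)
  define e :: "nat \<Rightarrow> real" where "e l = (indicator (B l) a - indicator (B l) b) * (1 / 3) ^ l" for l
  have e_sum: "summable e"
    unfolding e_def left_diff_distrib by (intro summable_diff ternary_code_summable)
  have diff: "ternary_code B a - ternary_code B b = (\<Sum>l. e l)"
    unfolding ternary_code_def e_def left_diff_distrib
    by (intro suminf_diff ternary_code_summable)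
  have "(\<Sum>l. e l) = (\<Sum>l. e (l + Suc j)) + (\<Sum>l<Suc j. e l)"
    by (rule suminf_split_initial_segment[OF e_sum])
  also have "(\<Sum>l<Suc j. e l) = e j"
    using min by (simp add: e_def indicator_def)
  finally have s: "(\<Sum>l. e l) = (\<Sum>l. e (l + Suc j)) + e j" .
  have geo: "(\<lambda>l. (1 / 3 :: real) ^ (l + Suc j)) sums ((1 / 3) ^ j / 2)"
    using sums_mult[OF geometric_sums[of "1 / 3 :: real"], of "(1 / 3) ^ Suc j"]
    by (simp add: power_add mult.commute)
  have "\<bar>\<Sum>l. e (l + Suc j)\<bar> \<le> (\<Sum>l. (1 / 3 :: real) ^ (l + Suc j))"
    using norm_suminf_le[OF _ sums_summable[OF geo], of "\<lambda>l. e (l + Suc j)"]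
    by (auto simp: e_def indicator_def abs_mult)
  also have "\<dots> = (1 / 3) ^ j / 2" using geo by (rule sums_unique[symmetric])
  finally have "\<bar>\<Sum>l. e (l + Suc j)\<bar> \<le> (1 / 3) ^ j / 2" .
  moreover have "\<bar>e j\<bar> = (1 / 3) ^ j" using j by (auto simp: e_def indicator_def)
  ultimately have "(1 / 3) ^ j / 2 \<le> \<bar>ternary_code B a - ternary_code B b\<bar>"
    unfolding diff s by linarith
  moreover have "(1 / 3 :: real) ^ N \<le> (1 / 3) ^ j"
    using \<open>j \<le> i\<close> i by (intro power_decreasing) auto
  ultimately show False using close by linarith
qed

text \<open>A Borel embedding of a compact metric space into an interval whose inverse is uniformly continuous and
so extends to the closure of the image. Uniformity comes from compactness: finitely many small
basic open sets cover the space, and points with close codes share one of them.\<close>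

lemma compact_ternary_code:
  assumes compact: "compact (UNIV :: 'a::polish_space set)"
  obtains h :: "'a::polish_space \<Rightarrow> real" and k where "h \<in> borel_measurable borel" "\<And>a. h a \<in> {0..3/2}"
    "continuous_on (closure (range h)) k" "\<And>a. k (h a) = a"
proof -
  obtain B0 :: "'a set set" where B0: "countable B0" "topological_basis B0"
    using ex_countable_basis by blast
  define B where "B = from_nat_into (insert UNIV B0)"
  have B_open: "open (B i)" for i
    using from_nat_into[of "insert UNIV B0" i] topological_basis_open[OF B0(2)] by (auto simp: B_def)
  have B_basis: "\<exists>i. a \<in> B i \<and> B i \<subseteq> U" if "open U" "a \<in> U" for U :: "'a set" and a
    using topological_basisE[OF B0(2) that] from_nat_into_surj[of "insert UNIV B0"] B0(1)
    unfolding B_def by (metis countable_insert insertI2)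
  define h where "h = ternary_code B"
  have h_meas: "h \<in> borel_measurable borel"
    unfolding h_def ternary_code_def[abs_def]
    using B_open by (intro borel_measurable_suminf borel_measurable_times borel_measurable_indicator borel_open) auto
  have uc: "\<exists>\<delta>>0. \<forall>a b. \<bar>h a - h b\<bar> < \<delta> \<longrightarrow> dist a b < \<epsilon>" if "0 < \<epsilon>" for \<epsilon>
  proof -
    define I where "I = {i. \<exists>x. B i \<subseteq> ball x (\<epsilon> / 2)}"
    have cover: "UNIV \<subseteq> (\<Union>i\<in>I. B i)"
    proof
      fix a :: 'a
      show "a \<in> (\<Union>i\<in>I. B i)"
        using B_basis[of "ball a (\<epsilon> / 2)" a] \<open>0 < \<epsilon>\<close> by (auto simp: I_def)
    qed
    obtain J where J: "J \<subseteq> I" "finite J" "UNIV \<subseteq> (\<Union>i\<in>J. B i)"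
      by (rule compactE_image[OF compact _ cover]) (use B_open in simp_all)
    define N where "N = Max J"
    have N: "i \<le> N" if "i \<in> J" for i using J(2) that by (simp add: N_def)
    have "dist a b < \<epsilon>" if "\<bar>h a - h b\<bar> < (1 / 3) ^ N / 2" for a b
    proof -
      obtain i where i: "i \<in> J" "a \<in> B i" using J(3) by blast
      then have "b \<in> B i" using ternary_code_separates[of B a b N i] that N by (simp add: h_def)
      moreover obtain x where "B i \<subseteq> ball x (\<epsilon> / 2)" using i J(1) by (auto simp: I_def)
      ultimately have "dist x a < \<epsilon> / 2" "dist x b < \<epsilon> / 2" using i(2) by auto
      then show ?thesis using dist_triangle3[of a b x] by linarith
    qed
    then show ?thesis by (intro exI[of _ "(1 / 3) ^ N / 2"]) auto
  qed
  have "inj h"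
  proof (rule injI, rule ccontr)
    fix a b assume ab: "h a = h b" "a \<noteq> b"
    then have "\<exists>\<delta>>0. \<forall>a' b'. \<bar>h a' - h b'\<bar> < \<delta> \<longrightarrow> dist a' b' < dist a b"
      by (intro uc) simp
    then obtain \<delta> where "0 < \<delta>" "\<And>a' b'. \<bar>h a' - h b'\<bar> < \<delta> \<Longrightarrow> dist a' b' < dist a b" by blast
    from this(2)[of a b] ab(1) this(1) show False by simp
  qed
  then have inv: "inv h (h a) = a" for a by (rule inv_f_f)
  have "uniformly_continuous_on (range h) (inv h)"
    unfolding uniformly_continuous_on_def using uc inv by (simp add: dist_real_def) (metis dist_commute)
  then obtain k where k: "uniformly_continuous_on (closure (range h)) k"
    and k_eq: "\<And>x. x \<in> range h \<Longrightarrow> inv h x = k x"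
    by (rule uniformly_continuous_on_extension_on_closure) blast
  show ?thesis
  proof (rule that[OF h_meas])
    show "h a \<in> {0..3/2}" for a using ternary_code_range[of B a] by (simp add: h_def)
    show "continuous_on (closure (range h)) k" by (rule uniformly_continuous_imp_continuous[OF k])
    show "k (h a) = a" for a using k_eq[of "h a"] inv by simp
  qed
qed

text \<open>Transport the measures to the real line by the code, apply Helly's selection theorem there, and
transport the limit back along the continuous extension \<open>k\<close> of the inverse. The code itself
is not continuous in general, but only functions of the form \<open>f \<circ> k\<close> have to be tested, and these extend
continuously to the line.\<close>

theorem compact_weak_convergence:
  fixes \<mu> :: "nat \<Rightarrow> 'a::polish_space measure"
  assumes compact: "compact (UNIV :: 'a set)" and \<mu>: "\<And>n. \<mu> n \<in> space (prob_algebra borel)"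
  obtains r \<mu>' where "strict_mono (r :: nat \<Rightarrow> nat)" "\<mu>' \<in> space (prob_algebra borel)"
    "\<And>f :: 'a \<Rightarrow> real. continuous_on UNIV f \<Longrightarrow> (\<lambda>n. \<integral>a. f a \<partial>\<mu> (r n)) \<longlonglongrightarrow> (\<integral>a. f a \<partial>\<mu>')"
proof -
  obtain h :: "'a \<Rightarrow> real" and k where h: "h \<in> borel_measurable borel" "\<And>a. h a \<in> {0..3/2}"
    and k: "continuous_on (closure (range h)) k" "\<And>a. k (h a) = a"
    using compact_ternary_code[OF compact] by blast
  let ?S = "closure (range h)"
  define L where "L n = distr (\<mu> n) borel h" for n
  note \<mu>' = prob_algebraD[OF \<mu>]
  have h\<mu>: "h \<in> borel_measurable (\<mu> n)" for n
    unfolding measurable_cong_sets[OF \<mu>'(2) refl] by (rule h(1))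
  have L_int: "(\<integral>x. G x \<partial>L n) = (\<integral>a. G (h a) \<partial>\<mu> n)" if "continuous_on UNIV G" for G :: "real \<Rightarrow> real" and n
    unfolding L_def using that by (intro integral_distr[OF h\<mu>] borel_measurable_continuous_onI)
  have L_prob: "prob_space (L n)" for n
    unfolding L_def by (rule prob_space.prob_space_distr[OF \<mu>'(1) h\<mu>])
  have L_real: "real_distribution (L n)" for n
    using L_prob[of n] by (simp add: real_distribution_def real_distribution_axioms_def L_def)
  have "tight L"
    unfolding tight_def
  proof (intro conjI allI impI L_real)
    fix \<epsilon> :: real assume "0 < \<epsilon>"
    have "measure (L n) {-1<..2} = 1" for n
    proof -
      have "-1 < h a \<and> h a \<le> 2" for a using h(2)[of a] by simp
      then have "h -` {-1<..2} \<inter> space (\<mu> n) = space (\<mu> n)" by auto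
      then show ?thesis
        using prob_space.prob_space[OF \<mu>'(1)] by (simp add: L_def measure_distr[OF h\<mu>])
    qed
    then show "\<exists>a b. a < b \<and> (\<forall>n. 1 - \<epsilon> < measure (L n) {a<..b})"
      using \<open>0 < \<epsilon>\<close> by (intro exI[of _ "-1"] exI[of _ 2]) auto
  qed
  from tight_imp_convergent_subsubsequence[OF this strict_mono_id]
  obtain r \<rho> where r: "strict_mono r" and \<rho>: "real_distribution \<rho>" and conv: "weak_conv_m (L \<circ> r) \<rho>"
    by auto
  interpret R: real_distribution \<rho> by (rule \<rho>)
  have lim: "(\<lambda>n. \<integral>a. G (h a) \<partial>\<mu> (r n)) \<longlonglongrightarrow> (\<integral>x. G x \<partial>\<rho>)"
    if G: "continuous_on UNIV G" "\<And>x. norm (G x) \<le> B" for G :: "real \<Rightarrow> real" and B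
    using weak_conv_imp_integral_bdd_continuous_conv[OF _ \<rho> conv, of G B] G L_real L_int[OF G(1)]
    by (simp add: continuous_on_eq_continuous_at)
  \<comment> \<open>Weak limits do not lose mass from closed sets: test with the distance to the closure.\<close>
  have supp: "AE x in \<rho>. x \<in> ?S"
  proof -
    let ?D = "\<lambda>x. min 1 (infdist x ?S)"
    have D: "continuous_on UNIV ?D" by (intro continuous_intros)
    have Db: "norm (?D x) \<le> 1" for x using infdist_nonneg[of x ?S] by simp
    have "?D (h a) = 0" for a using closure_subset[of "range h"] by (simp add: infdist_zero subset_eq)
    then have "(\<lambda>n. 0) \<longlonglongrightarrow> (\<integral>x. ?D x \<partial>\<rho>)" using lim[OF D Db] by simp
    then have "(\<integral>x. ?D x \<partial>\<rho>) = 0" by (rule LIMSEQ_unique[OF _ tendsto_const])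
    moreover have "integrable \<rho> ?D"
      using borel_measurable_continuous_onI[OF D] Db
      by (intro R.integrable_const_bound[where B=1]) simp_all
    ultimately have "AE x in \<rho>. ?D x = 0"
      using infdist_nonneg[of _ ?S] by (subst integral_nonneg_eq_0_iff_AE[symmetric]) auto
    then show ?thesis
    proof eventually_elim
      case (elim x)
      then have "infdist x ?S = 0" by (simp add: min_def split: if_splits)
      then show ?case using in_closed_iff_infdist_zero[of ?S x] by auto
    qed
  qed
  define a0 where "a0 = k 0"
  \<comment> \<open>Off the closure, a null set of \<open>\<rho>\<close>, any value will do.\<close>
  define K where "K x = (if x \<in> ?S then k x else a0)" for x
  have K: "K \<in> borel_measurable borel"
    unfolding K_def[abs_def]
    by (rule borel_measurable_continuous_on_if[where A="?S"]) (use k(1) in auto)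
  have K_meas: "K \<in> borel_measurable \<rho>" using K by simp
  show ?thesis
  proof (rule that[OF r])
    show "distr \<rho> borel K \<in> space (prob_algebra borel)"
      using R.prob_space_distr[OF K_meas] by (simp add: space_prob_algebra)
    fix f :: "'a \<Rightarrow> real" assume f: "continuous_on UNIV f"
    have "compact (f ` UNIV)" by (rule compact_continuous_image[OF f compact])
    then obtain C where C: "\<And>a. norm (f a) \<le> C"
      using compact_imp_bounded bounded_iff by (metis rangeI)
    have "0 \<le> C" using C[of undefined] norm_ge_zero order_trans by blast
    have "continuous_on ?S (\<lambda>x. f (k x))"
      by (rule continuous_on_compose2[OF f k(1)]) auto
    then obtain G where G: "continuous_on UNIV G" "\<And>x. x \<in> ?S \<Longrightarrow> G x = f (k x)" "\<And>x. norm (G x) \<le> C"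
      using Tietze[of ?S "\<lambda>x. f (k x)" UNIV C] C \<open>0 \<le> C\<close> by auto
    have "G (h a) = f a" for a
      using G(2)[of "h a"] k(2)[of a] closure_subset[of "range h"] by auto
    then have "(\<lambda>n. \<integral>a. f a \<partial>\<mu> (r n)) \<longlonglongrightarrow> (\<integral>x. G x \<partial>\<rho>)"
      using lim[OF G(1,3)] by simp
    also have "(\<integral>x. G x \<partial>\<rho>) = (\<integral>x. f (K x) \<partial>\<rho>)"
    proof (rule integral_cong_AE)
      show "AE x in \<rho>. G x = f (K x)" using supp by eventually_elim (simp add: K_def G(2))
      show "G \<in> borel_measurable \<rho>" using borel_measurable_continuous_onI[OF G(1)] by simp
      show "(\<lambda>x. f (K x)) \<in> borel_measurable \<rho>"
        by (rule measurable_compose[OF K_meas borel_measurable_continuous_onI[OF f]])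
    qed
    also have "\<dots> = (\<integral>a. f a \<partial>distr \<rho> borel K)"
      by (rule integral_distr[symmetric, OF K_meas borel_measurable_continuous_onI[OF f]])
    finally show "(\<lambda>n. \<integral>a. f a \<partial>\<mu> (r n)) \<longlonglongrightarrow> (\<integral>a. f a \<partial>distr \<rho> borel K)" .
  qed
qed

section \<open>Optimal solutions of the balance equation\<close>

lemma finite_common_subsequence:
  assumes Y: "finite Y"
    and step: "\<And>y r. y \<in> Y \<Longrightarrow> strict_mono r \<Longrightarrow> \<exists>r'. strict_mono (r' :: nat \<Rightarrow> nat) \<and> C y (r \<circ> r')"
    and sub: "\<And>y r r'. C y r \<Longrightarrow> strict_mono r' \<Longrightarrow> C y (r \<circ> r')"
  shows "\<exists>r :: nat \<Rightarrow> nat. strict_mono r \<and> (\<forall>y\<in>Y. C y r)"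
  using Y step
proof (induction Y rule: finite_induct)
  case empty
  show ?case by (intro exI[of _ id]) (auto simp: strict_mono_id)
next
  case (insert y Y)
  then obtain r where r: "strict_mono r" "\<forall>z\<in>Y. C z r" by (metis insertCI)
  obtain r' where r': "strict_mono r'" "C y (r \<circ> r')" using insert.prems[OF insertI1 r(1)] by blast
  show ?case
    using r r' sub strict_mono_o[OF r(1) r'(1)] by (intro exI[of _ "r \<circ> r'"]) blast
qed

text \<open>The direct method: along a minimizing sequence, masses and action distributions converge on a common
subsequence, and balance equations, constraints and objective are continuous for this convergence.\<close>

theorem optimal_balanced_exists:
  fixes F :: "'l \<Rightarrow> 'y \<times> 'a::polish_space \<Rightarrow> real" and m :: "'l \<Rightarrow> real"
  assumes model: "finite_model Y (borel :: 'a measure) g P \<beta>" and compact: "compact (UNIV :: 'a set)"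
    and P_cont: "\<And>y y'. y \<in> Y \<Longrightarrow> y' \<in> Y \<Longrightarrow> continuous_on UNIV (\<lambda>a. P y (y', a))"
    and F0: "\<And>y. y \<in> Y \<Longrightarrow> continuous_on UNIV (\<lambda>a. F0 (y, a))" "\<And>z. 0 \<le> F0 z"
    and F: "\<And>l y. l \<in> L \<Longrightarrow> y \<in> Y \<Longrightarrow> continuous_on UNIV (\<lambda>a. F l (y, a))"
  defines "admissible \<equiv> \<lambda>s \<phi>. finite_model.randomized Y borel \<phi> \<and> finite_model.balanced Y g P \<beta> s \<phi> \<and>
    (\<forall>l\<in>L. finite_model.cost Y (F l) s \<phi> \<le> m l)"
  assumes nonempty: "admissible s0 \<phi>0"
  obtains s \<phi> where "admissible s \<phi>"
    "\<And>s' \<phi>'. admissible s' \<phi>' \<Longrightarrow> finite_model.cost Y F0 s \<phi> \<le> finite_model.cost Y F0 s' \<phi>'"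
proof -
  interpret finite_model Y "borel :: 'a measure" g P \<beta> by (rule model)
  define V where "V = {cost F0 s \<phi> | s \<phi>. admissible s \<phi>}"
  have ne: "V \<noteq> {}" using nonempty by (auto simp: V_def)
  have cost_nonneg: "0 \<le> cost F0 s \<phi>" if "balanced s \<phi>" for s \<phi>
    unfolding cost_def
  proof (intro sum_nonneg mult_nonneg_nonneg)
    show "0 \<le> s y" if "y \<in> Y" for y using \<open>balanced s \<phi>\<close> that unfolding balanced_def by blast
  qed (simp add: F0(2))
  then have bdd: "bdd_below V" by (intro bdd_belowI[of _ 0]) (auto simp: V_def admissible_def)
  have "\<exists>s \<phi>. admissible s \<phi> \<and> cost F0 s \<phi> < Inf V + 1 / Suc n" for n
    using cInf_lessD[OF ne, of "Inf V + 1 / Suc n"] by (auto simp: V_def)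
  then obtain s \<phi> where adm: "\<And>n. admissible (s n) (\<phi> n)" and small: "\<And>n. cost F0 (s n) (\<phi> n) < Inf V + 1 / Suc n"
    by metis
  have \<phi>: "\<phi> n y \<in> space (prob_algebra borel)" if "y \<in> Y" for n y
    using adm[of n] that by (auto simp: admissible_def randomized_def)
  have s01: "s n y \<in> {0..1}" if y: "y \<in> Y" for n y
  proof -
    have b: "randomized (\<phi> n)" "balanced (s n) (\<phi> n)" using adm[of n] by (auto simp: admissible_def)
    have nonneg: "0 \<le> s n y" if "y \<in> Y" for y using b(2) that unfolding balanced_def by blast
    have "s n y \<le> (\<Sum>y\<in>Y. s n y)"
      using nonneg finite_Y by (intro member_le_sum y) simp_all
    then show ?thesis using nonneg[OF y] balanced_sum[OF b] by simp
  qed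
  define C where "C y r \<longleftrightarrow> (\<exists>\<mu> \<sigma>. \<mu> \<in> space (prob_algebra borel) \<and> (\<lambda>n. s (r n) y) \<longlonglongrightarrow> \<sigma> \<and>
    (\<forall>f :: 'a \<Rightarrow> real. continuous_on UNIV f \<longrightarrow> (\<lambda>n. \<integral>a. f a \<partial>\<phi> (r n) y) \<longlonglongrightarrow> (\<integral>a. f a \<partial>\<mu>)))" for y and r :: "nat \<Rightarrow> nat"
  have "\<exists>r. strict_mono r \<and> (\<forall>y\<in>Y. C y r)"
  proof (rule finite_common_subsequence[OF finite_Y])
    fix y and r :: "nat \<Rightarrow> nat" assume y: "y \<in> Y"
    obtain r1 \<mu> where r1: "strict_mono r1" "\<mu> \<in> space (prob_algebra borel)"
      and lim: "\<And>f :: 'a \<Rightarrow> real. continuous_on UNIV f \<Longrightarrow> (\<lambda>n. \<integral>a. f a \<partial>\<phi> (r (r1 n)) y) \<longlonglongrightarrow> (\<integral>a. f a \<partial>\<mu>)"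
      using compact_weak_convergence[OF compact \<phi>[OF y], of r] by blast
    have "seq_compact {0..1::real}" by (intro compact_imp_seq_compact compact_Icc)
    moreover have "\<forall>n. s (r (r1 n)) y \<in> {0..1}" using s01[OF y] by blast
    ultimately obtain \<sigma> r2 where r2: "strict_mono r2" "((\<lambda>n. s (r (r1 n)) y) \<circ> r2) \<longlonglongrightarrow> \<sigma>"
      unfolding seq_compact_def by meson
    show "\<exists>r'. strict_mono r' \<and> C y (r \<circ> r')"
      unfolding C_def
    proof (intro exI[of _ "r1 \<circ> r2"] exI[of _ \<mu>] exI[of _ \<sigma>] conjI allI impI)
      show "strict_mono (r1 \<circ> r2)" using r1(1) r2(1) by (rule strict_mono_o)
      show "(\<lambda>n. s ((r \<circ> (r1 \<circ> r2)) n) y) \<longlonglongrightarrow> \<sigma>" using r2(2) by (simp add: comp_def)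
      fix f :: "'a \<Rightarrow> real" assume "continuous_on UNIV f"
      from LIMSEQ_subseq_LIMSEQ[OF lim[OF this] r2(1)]
      show "(\<lambda>n. \<integral>a. f a \<partial>\<phi> ((r \<circ> (r1 \<circ> r2)) n) y) \<longlonglongrightarrow> (\<integral>a. f a \<partial>\<mu>)" by (simp add: comp_def)
    qed (rule r1(2))
  next
    fix y and r r' :: "nat \<Rightarrow> nat" assume C: "C y r" and r': "strict_mono r'"
    then obtain \<mu> \<sigma> where "\<mu> \<in> space (prob_algebra borel)" "(\<lambda>n. s (r n) y) \<longlonglongrightarrow> \<sigma>"
      "\<And>f :: 'a \<Rightarrow> real. continuous_on UNIV f \<Longrightarrow> (\<lambda>n. \<integral>a. f a \<partial>\<phi> (r n) y) \<longlonglongrightarrow> (\<integral>a. f a \<partial>\<mu>)"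
      unfolding C_def by blast
    from this(1) LIMSEQ_subseq_LIMSEQ[OF this(2) r'] LIMSEQ_subseq_LIMSEQ[OF this(3) r']
    show "C y (r \<circ> r')" unfolding C_def comp_def by blast
  qed
  then obtain r where r: "strict_mono r" and C: "\<And>y. y \<in> Y \<Longrightarrow> C y r" by blast
  then obtain \<phi>' s' where \<phi>': "\<And>y. y \<in> Y \<Longrightarrow> \<phi>' y \<in> space (prob_algebra borel)"
    and s': "\<And>y. y \<in> Y \<Longrightarrow> (\<lambda>n. s (r n) y) \<longlonglongrightarrow> s' y"
    and lim: "\<And>y f. y \<in> Y \<Longrightarrow> continuous_on UNIV (f :: 'a \<Rightarrow> real) \<Longrightarrow>
      (\<lambda>n. \<integral>a. f a \<partial>\<phi> (r n) y) \<longlonglongrightarrow> (\<integral>a. f a \<partial>\<phi>' y)"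
    unfolding C_def by metis
  have cost_lim: "(\<lambda>n. cost G (s (r n)) (\<phi> (r n))) \<longlonglongrightarrow> cost G s' \<phi>'"
    if "\<And>y. y \<in> Y \<Longrightarrow> continuous_on UNIV (\<lambda>a. G (y, a))" for G
    unfolding cost_def by (intro tendsto_sum tendsto_mult s' lim that)
  have "balanced s' \<phi>'"
    unfolding balanced_def
  proof (intro ballI conjI)
    fix y assume y: "y \<in> Y"
    show "0 \<le> s' y" using s01[OF y] by (intro LIMSEQ_le_const[OF s'[OF y]]) auto
    have "s (r n) y = (1 - \<beta>) * g y + \<beta> * cost (P y) (s (r n)) (\<phi> (r n))" for n
      using adm[of "r n"] y unfolding admissible_def balanced_def by blast
    then have "(\<lambda>n. (1 - \<beta>) * g y + \<beta> * cost (P y) (s (r n)) (\<phi> (r n))) \<longlonglongrightarrow> s' y"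
      using s'[OF y] by simp
    moreover have "(\<lambda>n. (1 - \<beta>) * g y + \<beta> * cost (P y) (s (r n)) (\<phi> (r n))) \<longlonglongrightarrow>
        (1 - \<beta>) * g y + \<beta> * cost (P y) s' \<phi>'"
      by (intro tendsto_intros cost_lim P_cont y)
    ultimately show "s' y = (1 - \<beta>) * g y + \<beta> * cost (P y) s' \<phi>'" by (rule LIMSEQ_unique)
  qed
  moreover have "cost (F l) s' \<phi>' \<le> m l" if l: "l \<in> L" for l
    by (rule LIMSEQ_le_const2[OF cost_lim[OF F[OF l]]]) (use adm l in \<open>auto simp: admissible_def\<close>)
  ultimately have adm': "admissible s' \<phi>'" using \<phi>' by (auto simp: admissible_def randomized_def)
  have "(\<lambda>n. Inf V + 1 / Suc (r n)) \<longlonglongrightarrow> Inf V + 0"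
    using LIMSEQ_subseq_LIMSEQ[OF LIMSEQ_Suc[OF lim_const_over_n[of 1]] r]
    by (intro tendsto_add tendsto_const) (simp add: comp_def)
  from LIMSEQ_le[OF cost_lim[OF F0(1)] this] small
  have "cost F0 s' \<phi>' \<le> Inf V" by (auto intro: less_imp_le)
  moreover have "Inf V \<le> cost F0 s'' \<phi>''" if "admissible s'' \<phi>''" for s'' \<phi>''
    using that by (intro cInf_lower bdd) (auto simp: V_def)
  ultimately show ?thesis using that[OF adm'] by (meson order_trans)
qed

section \<open>Total variation distance\<close>

lemma tv_dist_bdd:
  assumes "prob_space \<mu>" "prob_space \<nu>"
  shows "bdd_above ((\<lambda>B. \<bar>measure \<mu> B - measure \<nu> B\<bar>) ` sets \<mu>)"
proof (rule bdd_aboveI2)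
  fix B
  have "0 \<le> measure \<mu> B" "measure \<mu> B \<le> 1" "0 \<le> measure \<nu> B" "measure \<nu> B \<le> 1"
    using assms by (simp_all add: prob_space.prob_le_1)
  then show "\<bar>measure \<mu> B - measure \<nu> B\<bar> \<le> 1" by linarith
qed

lemma measure_diff_le_tv_dist:
  assumes "prob_space \<mu>" "prob_space \<nu>" "B \<in> sets \<mu>"
  shows "\<bar>measure \<mu> B - measure \<nu> B\<bar> \<le> tv_dist \<mu> \<nu>"
  unfolding tv_dist_def by (rule cSUP_upper[OF assms(3) tv_dist_bdd[OF assms(1,2)]])

lemma tv_dist_triangle:
  assumes "prob_space \<mu>" "prob_space \<nu>" "prob_space \<rho>" "sets \<mu> = sets \<nu>" "sets \<rho> = sets \<nu>"
  shows "tv_dist \<mu> \<rho> \<le> tv_dist \<mu> \<nu> + tv_dist \<rho> \<nu>"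
  unfolding tv_dist_def[of \<mu> \<rho>]
proof (rule cSUP_least)
  show "sets \<mu> \<noteq> {}" using sets.empty_sets by blast
  fix B assume "B \<in> sets \<mu>"
  then have "\<bar>measure \<mu> B - measure \<nu> B\<bar> \<le> tv_dist \<mu> \<nu>" "\<bar>measure \<rho> B - measure \<nu> B\<bar> \<le> tv_dist \<rho> \<nu>"
    using assms by (auto intro: measure_diff_le_tv_dist)
  then show "\<bar>measure \<mu> B - measure \<rho> B\<bar> \<le> tv_dist \<mu> \<nu> + tv_dist \<rho> \<nu>" by linarith
qed

lemma staircase_approximation:
  assumes x: "0 \<le> x" "x \<le> (1::real)" and m: "0 < m"
  shows "\<bar>x - (\<Sum>j=1..m. indicator {x. real j \<le> real m * x} x) / real m\<bar> \<le> 1 / real m"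
proof -
  have mx: "0 \<le> real m * x" "real m * x \<le> real m" using x m by (auto simp: mult_left_le)
  define k where "k = nat \<lfloor>real m * x\<rfloor>"
  have k: "real j \<le> real m * x \<longleftrightarrow> j \<le> k" for j :: nat
    unfolding k_def using mx(1) by (subst le_nat_iff) (simp, simp only: le_floor_iff of_int_of_nat_eq)
  have "k \<le> m" unfolding k_def using mx(2) by linarith
  have "(\<Sum>j=1..m. indicator {x. real j \<le> real m * x} x) = (\<Sum>j=1..m. if j \<le> k then 1 else 0 :: real)"
    by (intro sum.cong refl) (simp add: indicator_def k)
  also have "\<dots> = real (card {j \<in> {1..m}. j \<le> k})" by (simp add: sum.inter_filter[symmetric])
  also have "{j \<in> {1..m}. j \<le> k} = {1..k}" using \<open>k \<le> m\<close> by auto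
  also have "real (card {1..k}) = of_int \<lfloor>real m * x\<rfloor>" using mx(1) by (simp add: k_def)
  finally have s: "(\<Sum>j=1..m. indicator {x. real j \<le> real m * x} x) = (of_int \<lfloor>real m * x\<rfloor> :: real)" .
  have "\<bar>real m * x - of_int \<lfloor>real m * x\<rfloor>\<bar> \<le> 1" by linarith
  then have "\<bar>real m * x - of_int \<lfloor>real m * x\<rfloor>\<bar> / real m \<le> 1 / real m"
    using m by (intro divide_right_mono) auto
  moreover have "\<bar>real m * x - of_int \<lfloor>real m * x\<rfloor>\<bar> / real m = \<bar>x - of_int \<lfloor>real m * x\<rfloor> / real m\<bar>"
  proof -
    have "(real m * x - of_int \<lfloor>real m * x\<rfloor>) / real m = x - of_int \<lfloor>real m * x\<rfloor> / real m"
      using m by (simp add: diff_divide_distrib)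
    then show ?thesis using m by (metis abs_divide abs_of_nat)
  qed
  ultimately show ?thesis unfolding s by simp
qed

text \<open>Total variation is defined through events; integrands with values in \<open>[0, 1]\<close> are uniform limits of
averages of indicators of their superlevel sets.\<close>

lemma integral_diff_le_tv_dist_unit:
  fixes f :: "'s \<Rightarrow> real"
  assumes \<mu>: "\<mu> \<in> space (prob_algebra N)" and \<nu>: "\<nu> \<in> space (prob_algebra N)"
    and f: "f \<in> borel_measurable N" "\<And>x. x \<in> space N \<Longrightarrow> 0 \<le> f x \<and> f x \<le> 1"
  shows "\<bar>(\<integral>x. f x \<partial>\<mu>) - (\<integral>x. f x \<partial>\<nu>)\<bar> \<le> tv_dist \<mu> \<nu>"
proof -
  let ?E = "\<lambda>m j. {x \<in> space N. real j \<le> real m * f x}"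
  define F where "F m x = (\<Sum>j=1..m. indicator (?E m j) x) / real m" for m x
  have E: "?E m j \<in> sets N" for m j using f(1) by measurable
  have step: "\<bar>(\<integral>x. F m x \<partial>\<mu>) - (\<integral>x. F m x \<partial>\<nu>)\<bar> \<le> tv_dist \<mu> \<nu>" if m: "0 < m" for m
  proof -
    have I: "(\<integral>x. F m x \<partial>\<rho>) = (\<Sum>j=1..m. measure \<rho> (?E m j)) / real m" if \<rho>: "\<rho> \<in> space (prob_algebra N)" for \<rho>
    proof -
      note r = prob_algebraD[OF \<rho>]
      interpret prob_space \<rho> by (rule r(1))
      have Er: "?E m j \<in> sets \<rho>" for j using E r(2) by simp
      have "(\<integral>x. (\<Sum>j=1..m. indicator (?E m j) x) \<partial>\<rho>) = (\<Sum>j=1..m. \<integral>x. indicator (?E m j) x \<partial>\<rho> :: real)"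
        using Er by (intro Bochner_Integration.integral_sum integrable_real_indicator) (auto simp: less_top[symmetric])
      also have "\<dots> = (\<Sum>j=1..m. measure \<rho> (?E m j))"
        using sets.sets_into_space[OF Er] by (simp add: Int_absorb2)
      finally show ?thesis by (simp add: F_def)
    qed
    have "(\<integral>x. F m x \<partial>\<mu>) - (\<integral>x. F m x \<partial>\<nu>) = (\<Sum>j=1..m. measure \<mu> (?E m j) - measure \<nu> (?E m j)) / real m"
      unfolding I[OF \<mu>] I[OF \<nu>] by (simp add: sum_subtractf diff_divide_distrib)
    also have "\<bar>\<dots>\<bar> \<le> (\<Sum>j=1..m. \<bar>measure \<mu> (?E m j) - measure \<nu> (?E m j)\<bar>) / real m"
      using m by (simp add: divide_right_mono sum_abs)
    also have "\<dots> \<le> (\<Sum>j=1..m. tv_dist \<mu> \<nu>) / real m"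
      using E prob_algebraD[OF \<mu>] prob_algebraD[OF \<nu>]
      by (intro divide_right_mono sum_mono measure_diff_le_tv_dist) auto
    also have "\<dots> = tv_dist \<mu> \<nu>" using m by simp
    finally show ?thesis .
  qed
  have approx: "\<bar>(\<integral>x. f x \<partial>\<rho>) - (\<integral>x. F m x \<partial>\<rho>)\<bar> \<le> 1 / real m" if \<rho>: "\<rho> \<in> space (prob_algebra N)" and m: "0 < m" for \<rho> m
  proof -
    have F: "F m \<in> borel_measurable N"
      unfolding F_def[abs_def] using E by (intro borel_measurable_divide borel_measurable_sum borel_measurable_indicator) auto
    have d: "\<bar>f x - F m x\<bar> \<le> 1 / real m" if "x \<in> space N" for x
      using staircase_approximation[of "f x" m] f(2)[OF that] m that by (simp add: F_def indicator_def)
    have if1: "integrable \<rho> f"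
      using f(2) by (intro prob_algebra_bounded_integral(1)[OF \<rho> f(1), of 1]) auto
    have "\<bar>F m x\<bar> \<le> 1 + 1 / real m" if "x \<in> space N" for x
      using d[OF that] f(2)[OF that] by linarith
    then have if2: "integrable \<rho> (F m)"
      by (intro prob_algebra_bounded_integral(1)[OF \<rho> F])
    show ?thesis
      unfolding Bochner_Integration.integral_diff[OF if1 if2, symmetric]
      by (intro prob_algebra_bounded_integral(2)[OF \<rho> borel_measurable_diff[OF f(1) F] d])
  qed
  have "\<bar>(\<integral>x. f x \<partial>\<mu>) - (\<integral>x. f x \<partial>\<nu>)\<bar> \<le> tv_dist \<mu> \<nu> + 2 * (1 / real (Suc m))" for m
    using step[of "Suc m"] approx[OF \<mu>, of "Suc m"] approx[OF \<nu>, of "Suc m"] by linarith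
  moreover have "(\<lambda>m. tv_dist \<mu> \<nu> + 2 * (1 / real (Suc m))) \<longlonglongrightarrow> tv_dist \<mu> \<nu> + 2 * 0"
    using LIMSEQ_Suc[OF lim_const_over_n[of 1]] by (intro tendsto_intros) simp
  ultimately show ?thesis
    by (intro LIMSEQ_le_const[where X="\<lambda>m. tv_dist \<mu> \<nu> + 2 * (1 / real (Suc m))"]) auto
qed

lemma integral_diff_le_tv_dist:
  fixes f :: "'s \<Rightarrow> real"
  assumes \<mu>: "\<mu> \<in> space (prob_algebra N)" and \<nu>: "\<nu> \<in> space (prob_algebra N)"
    and f: "f \<in> borel_measurable N" "\<And>x. x \<in> space N \<Longrightarrow> \<bar>f x\<bar> \<le> C" and C: "0 < C"
  shows "\<bar>(\<integral>x. f x \<partial>\<mu>) - (\<integral>x. f x \<partial>\<nu>)\<bar> \<le> 2 * C * tv_dist \<mu> \<nu>"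
proof -
  \<comment> \<open>Rescale to \<open>[0, 1]\<close>; this is where the factor 2 comes from.\<close>
  define h where "h x = (f x + C) / (2 * C)" for x
  have h: "h \<in> borel_measurable N" "\<And>x. x \<in> space N \<Longrightarrow> 0 \<le> h x \<and> h x \<le> 1"
  proof -
    show "h \<in> borel_measurable N" unfolding h_def[abs_def] using f(1) by measurable
    fix x assume "x \<in> space N"
    then have "- C \<le> f x" "f x \<le> C" using f(2) by (auto simp: abs_le_iff minus_le_iff)
    then show "0 \<le> h x \<and> h x \<le> 1" using C by (simp add: h_def)
  qed
  have I: "(\<integral>x. f x \<partial>\<rho>) = 2 * C * (\<integral>x. h x \<partial>\<rho>) - C" if \<rho>: "\<rho> \<in> space (prob_algebra N)" for \<rho>
  proof -
    have i: "integrable \<rho> f" by (rule prob_algebra_bounded_integral(1)[OF \<rho> f])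
    interpret prob_space \<rho> by (rule prob_algebraD(1)[OF \<rho>])
    have "(\<integral>x. h x \<partial>\<rho>) = ((\<integral>x. f x \<partial>\<rho>) + C) / (2 * C)"
      unfolding h_def using i by (simp add: prob_space)
    then show ?thesis using C by (simp add: field_simps)
  qed
  have "\<bar>(\<integral>x. f x \<partial>\<mu>) - (\<integral>x. f x \<partial>\<nu>)\<bar> = 2 * C * \<bar>(\<integral>x. h x \<partial>\<mu>) - (\<integral>x. h x \<partial>\<nu>)\<bar>"
  proof -
    have "(\<integral>x. f x \<partial>\<mu>) - (\<integral>x. f x \<partial>\<nu>) = 2 * C * ((\<integral>x. h x \<partial>\<mu>) - (\<integral>x. h x \<partial>\<nu>))"
      unfolding I[OF \<mu>] I[OF \<nu>] by (simp add: right_diff_distrib)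
    then show ?thesis using C by (simp add: abs_mult)
  qed
  also have "\<dots> \<le> 2 * C * tv_dist \<mu> \<nu>"
    using C by (intro mult_left_mono integral_diff_le_tv_dist_unit[OF \<mu> \<nu> h]) auto
  finally show ?thesis .
qed

lemma tv_dist_self: "tv_dist \<mu> \<mu> = 0"
proof -
  have "sets \<mu> \<noteq> {}" using sets.empty_sets by blast
  then show ?thesis by (simp add: tv_dist_def)
qed

lemma tv_continuous_measure:
  fixes p :: "'z::topological_space \<Rightarrow> 's measure"
  assumes tv: "tv_continuous p" and p: "\<And>z. p z \<in> space (prob_algebra N)" and B: "B \<in> sets N"
  shows "continuous_on UNIV (\<lambda>z. measure (p z) B)"
  unfolding continuous_on_def
proof
  fix z
  have t: "((\<lambda>z'. tv_dist (p z') (p z)) \<longlongrightarrow> 0) (at z)" using tv by (simp add: tv_continuous_def)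
  have "norm (measure (p z') B - measure (p z) B) \<le> tv_dist (p z') (p z)" for z'
    unfolding real_norm_def
    by (rule measure_diff_le_tv_dist) (use prob_algebraD[OF p] B in simp_all)
  then have "((\<lambda>z'. measure (p z') B - measure (p z) B) \<longlongrightarrow> 0) (at z)"
    by (intro Lim_null_comparison[OF always_eventually t] allI)
  then show "((\<lambda>z. measure (p z) B) \<longlongrightarrow> measure (p z) B) (at z)" by (rule Lim_null[THEN iffD2])
qed

text \<open>Heine-Cantor for the pseudometric \<open>tv_dist\<close>, by a Lebesgue number of the cover by balls on which
the kernel moves by less than \<open>\<delta> / 2\<close>.\<close>

lemma tv_continuous_uniform:
  fixes p :: "'z::metric_space \<Rightarrow> 's measure"
  assumes tv: "tv_continuous p" and p: "\<And>z. p z \<in> space (prob_algebra N)"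
    and compact: "compact (UNIV :: 'z set)" and \<delta>: "0 < \<delta>"
  obtains \<eta> where "0 < \<eta>" "\<And>z z'. dist z z' < \<eta> \<Longrightarrow> tv_dist (p z) (p z') \<le> \<delta>"
proof -
  note p' = prob_algebraD[OF p]
  define \<G> where "\<G> = {ball z r | z r. \<forall>z'\<in>ball z r. tv_dist (p z') (p z) < \<delta> / 2}"
  have "z \<in> \<Union>\<G>" for z
  proof -
    have "((\<lambda>z'. tv_dist (p z') (p z)) \<longlongrightarrow> 0) (at z)" using tv by (simp add: tv_continuous_def)
    then have "eventually (\<lambda>z'. tv_dist (p z') (p z) < \<delta> / 2) (at z)"
      by (rule order_tendstoD(2)) (use \<delta> in simp)
    then obtain r where r: "0 < r" "\<And>z'. z' \<noteq> z \<Longrightarrow> dist z' z < r \<Longrightarrow> tv_dist (p z') (p z) < \<delta> / 2"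
      by (auto simp: eventually_at)
    have "tv_dist (p z') (p z) < \<delta> / 2" if "z' \<in> ball z r" for z'
      using r(2)[of z'] that \<delta> by (cases "z' = z") (auto simp: tv_dist_self dist_commute)
    then have "ball z r \<in> \<G>" unfolding \<G>_def by blast
    then show ?thesis using r(1) by (intro UnionI[of "ball z r"]) simp_all
  qed
  then have cover: "UNIV \<subseteq> \<Union>\<G>" by blast
  have "open G" if "G \<in> \<G>" for G using that by (auto simp: \<G>_def)
  then have "\<exists>\<eta>>0. \<forall>z. \<exists>G\<in>\<G>. ball z \<eta> \<subseteq> G"
  proof (rule Heine_Borel_lemma[OF compact cover])
    fix e :: real assume e: "0 < e" "\<And>z. z \<in> UNIV \<Longrightarrow> \<exists>G\<in>\<G>. ball z e \<subseteq> G"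
    show "\<exists>\<eta>>0. \<forall>z. \<exists>G\<in>\<G>. ball z \<eta> \<subseteq> G"
      using e(1) e(2)[OF UNIV_I] by (intro exI[of _ e] conjI allI)
  qed
  then obtain \<eta> where \<eta>: "0 < \<eta>" "\<And>z. \<exists>G\<in>\<G>. ball z \<eta> \<subseteq> G" by blast
  show ?thesis
  proof (rule that[OF \<eta>(1)])
    fix z z' :: 'z assume "dist z z' < \<eta>"
    then have "z \<in> ball z \<eta>" "z' \<in> ball z \<eta>" using \<eta>(1) by auto
    then obtain w where "tv_dist (p z) (p w) < \<delta> / 2" "tv_dist (p z') (p w) < \<delta> / 2"
      using \<eta>(2)[of z] unfolding \<G>_def by blast
    then show "tv_dist (p z) (p z') \<le> \<delta>"
      using tv_dist_triangle[of "p z" "p w" "p z'"] p' by (simp add: p')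
  qed
qed

section \<open>The three models of one grid\<close>

lemma compact_continuous_real:
  fixes f :: "'z::metric_space \<Rightarrow> real"
  assumes compact: "compact (UNIV :: 'z set)" and f: "continuous_on UNIV f"
  shows "\<exists>C>0. \<forall>z. \<bar>f z\<bar> \<le> C"
    and "0 < e \<Longrightarrow> \<exists>\<eta>>0. \<forall>z z'. dist z z' < \<eta> \<longrightarrow> \<bar>f z - f z'\<bar> \<le> e"
proof -
  have "bounded (range f)"
    by (intro compact_imp_bounded compact_continuous_image f compact)
  then show "\<exists>C>0. \<forall>z. \<bar>f z\<bar> \<le> C" by (auto simp: bounded_pos)
  assume e: "0 < e"
  have "uniformly_continuous_on UNIV f" by (rule compact_uniformly_continuous[OF f compact])
  from uniformly_continuous_onE[OF this e]
  obtain \<eta> where "0 < \<eta>" "\<And>z z'. dist z' z < \<eta> \<Longrightarrow> dist (f z') (f z) < e" by (metis UNIV_I)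
  then show "\<exists>\<eta>>0. \<forall>z z'. dist z z' < \<eta> \<longrightarrow> \<bar>f z - f z'\<bar> \<le> e"
    by (intro exI[of _ \<eta>]) (auto simp: dist_real_def less_imp_le)
qed

text \<open>Fixing one grid keeps its index out of all arguments but the last, which lets the mesh tend to zero.\<close>

locale grid_model =
  fixes p :: "'x::polish_space \<times> 'a::polish_space \<Rightarrow> 'x measure" and \<gamma> :: "'x measure" and \<beta> :: real
    and n :: nat and Y :: "'x set" and Q :: "'x \<Rightarrow> 'x" and \<nu> :: "'x measure"
  assumes compact_X: "compact (UNIV :: 'x set)" and compact_A: "compact (UNIV :: 'a set)"
    and kernel: "p \<in> borel \<Otimes>\<^sub>M borel \<rightarrow>\<^sub>M prob_algebra borel"
    and initial: "prob_space \<gamma>" "sets \<gamma> = sets borel"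
    and discounting: "0 < \<beta>" "\<beta> < 1"
    and quant: "is_quantizer n Y Q"
    and weight: "finite_measure \<nu>" "sets \<nu> = sets borel"
    and pos: "\<And>y. y \<in> Y \<Longrightarrow> 0 < emeasure \<nu> (Q -` {y})"
    and tv: "tv_continuous p"
begin

abbreviation "original \<equiv> borel_mdp p \<gamma>"
abbreviation "extended \<equiv> bar_mdp Q \<nu> p \<gamma>"
abbreviation "finite_approx \<equiv> finite_mdp Y Q \<nu> p \<gamma>"
abbreviation "avg \<equiv> cell_avg Q \<nu>"

definition grid_init :: "'x \<Rightarrow> real" where
  "grid_init y = measure \<gamma> (Q -` {y})"

text \<open>The probability of entering the cell of \<open>y\<close>, averaged over the present cell. It is written as an
averaged cost, so that its continuity in the action needs no separate argument.\<close>

definition grid_trans :: "'x \<Rightarrow> 'x \<times> 'a \<Rightarrow> real" where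
  "grid_trans y = avg (\<lambda>z. measure (p z) (Q -` {y}))"

lemmas grid_facts = quantizer_facts[OF quant weight pos kernel initial]

lemma compact_XA: "compact (UNIV :: ('x \<times> 'a) set)"
  using compact_Times[OF compact_X compact_A] by simp

lemma p_prob: "p z \<in> space (prob_algebra borel)"
  by (rule measurable_space[OF kernel]) (simp add: space_pair_measure)

lemma section_kernel: "(\<lambda>z. p (z, a)) \<in> borel \<rightarrow>\<^sub>M prob_algebra borel"
  by (rule measurable_compose[OF _ kernel]) simp

lemma cell_prob: "y \<in> Y \<Longrightarrow> cell_measure Q \<nu> y \<in> space (prob_algebra borel)"
  by (rule cell_measure_prob[OF quant weight pos kernel initial])

lemma section_measurable:
  fixes f :: "'x \<times> 'a \<Rightarrow> real"
  assumes "continuous_on UNIV f"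
  shows "(\<lambda>z. f (z, a)) \<in> borel_measurable borel"
  by (intro borel_measurable_continuous_onI continuous_on_compose2[OF assms] continuous_intros) auto

text \<open>Uniform continuity of \<open>f\<close> is needed because the modulus has to be the same at all points of the cell.\<close>

lemma avg_continuous:
  fixes f :: "'x \<times> 'a \<Rightarrow> real"
  assumes f: "continuous_on UNIV f" and y: "y \<in> Y"
  shows "continuous_on UNIV (\<lambda>a. avg f (y, a))"
  unfolding continuous_on_iff
proof (intro ballI allI impI)
  fix a :: 'a and e :: real assume e: "0 < e"
  obtain C where C: "\<And>z. \<bar>f z\<bar> \<le> C" using compact_continuous_real(1)[OF compact_XA f] by blast
  obtain \<eta> where \<eta>: "0 < \<eta>" "\<And>z z'. dist z z' < \<eta> \<Longrightarrow> \<bar>f z - f z'\<bar> \<le> e / 2"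
    using compact_continuous_real(2)[OF compact_XA f, of "e / 2"] e by auto
  note pa = prob_algebra_bounded_integral[OF cell_prob[OF y]]
  have "dist (avg f (y, a')) (avg f (y, a)) < e" if a': "dist a' a < \<eta>" for a'
  proof -
    have i: "integrable (cell_measure Q \<nu> y) (\<lambda>z. f (z, b))" for b
      by (rule pa(1)[OF section_measurable[OF f] C])
    have "avg f (y, a') - avg f (y, a) = (\<integral>z. f (z, a') - f (z, a) \<partial>cell_measure Q \<nu> y)"
      unfolding cell_avg_def using Bochner_Integration.integral_diff[OF i i] by simp
    also have "\<bar>\<dots>\<bar> \<le> e / 2"
    proof (rule pa(2)[OF borel_measurable_diff[OF section_measurable[OF f] section_measurable[OF f]]])
      show "\<bar>f (z, a') - f (z, a)\<bar> \<le> e / 2" for z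
        using a' by (intro \<eta>(2)) (simp add: dist_Pair_Pair)
    qed
    finally show ?thesis using e by (simp add: dist_real_def)
  qed
  then show "\<exists>d>0. \<forall>a'\<in>UNIV. dist a' a < d \<longrightarrow> dist (avg f (y, a')) (avg f (y, a)) < e"
    using \<eta>(1) by blast
qed

lemma avg_bounded:
  fixes f :: "'x \<times> 'a \<Rightarrow> real"
  assumes f: "continuous_on UNIV f" "\<And>z. \<bar>f z\<bar> \<le> C" and y: "y \<in> Y"
  shows "\<bar>avg f (y, a)\<bar> \<le> C"
  unfolding cell_avg_def prod.case
  by (rule prob_algebra_bounded_integral(2)[OF cell_prob[OF y] section_measurable[OF f(1)] f(2)])

lemma measure_p_continuous: "continuous_on UNIV (\<lambda>z. measure (p z) (Q -` {y}))"
  by (rule tv_continuous_measure[OF tv p_prob grid_facts(4)])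

lemma grid_trans_continuous: "y' \<in> Y \<Longrightarrow> continuous_on UNIV (\<lambda>a. grid_trans y (y', a))"
  unfolding grid_trans_def by (rule avg_continuous[OF measure_p_continuous])

lemma sum_cells:
  assumes "\<mu> \<in> space (prob_algebra borel)"
  shows "(\<Sum>y\<in>Y. measure \<mu> (Q -` {y})) = 1"
proof -
  note \<mu> = prob_algebraD[OF assms]
  interpret prob_space \<mu> by (rule \<mu>(1))
  have "(\<Sum>y\<in>Y. measure \<mu> (Q -` {y})) = measure \<mu> (\<Union>y\<in>Y. Q -` {y})"
    using grid_facts(1,4) \<mu>(2) by (intro finite_measure_finite_Union[symmetric]) (auto simp: disjoint_family_on_def)
  also have "(\<Union>y\<in>Y. Q -` {y}) = space \<mu>" using grid_facts(2) \<mu>(3) by auto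
  finally show ?thesis by (simp add: prob_space)
qed

sublocale finite_model Y "borel :: 'a measure" grid_init grid_trans \<beta>
proof
  show "finite Y" by (rule grid_facts(1))
  show "0 < \<beta>" "\<beta> < 1" by (rule discounting)+
  show "(\<Sum>y\<in>Y. grid_init y) = 1"
    unfolding grid_init_def using initial by (intro sum_cells) (simp add: space_prob_algebra)
  show "(\<lambda>a. grid_trans y (y', a)) \<in> borel_measurable borel" if "y' \<in> Y" for y y'
    by (intro borel_measurable_continuous_onI grid_trans_continuous that)
  show "0 \<le> grid_trans y z" for y z
    by (simp add: grid_trans_def cell_avg_def split_beta')
  show "(\<Sum>y\<in>Y. grid_trans y z) = 1" if "z \<in> Y \<times> space borel" for z
  proof -
    have z: "fst z \<in> Y" using that by auto
    note cp = cell_prob[OF z]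
    have i: "integrable (cell_measure Q \<nu> (fst z)) (\<lambda>x. measure (p (x, snd z)) (Q -` {y}))" for y
      by (rule prob_algebra_bounded_integral(1)[OF cp section_measurable[OF measure_p_continuous], where C=1])
         (simp add: prob_space.prob_le_1[OF prob_algebraD(1)[OF p_prob]])
    have "(\<Sum>y\<in>Y. grid_trans y z) = (\<integral>x. (\<Sum>y\<in>Y. measure (p (x, snd z)) (Q -` {y})) \<partial>cell_measure Q \<nu> (fst z))"
      unfolding grid_trans_def cell_avg_def split_beta' by (rule Bochner_Integration.integral_sum[OF i, symmetric])
    also have "\<dots> = 1"
      using sum_cells[OF p_prob] prob_space.prob_space[OF prob_algebraD(1)[OF cp]] by simp
    finally show ?thesis .
  qed
qed

lemma bounded_cost_avg:
  fixes f :: "'x \<times> 'a \<Rightarrow> real"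
  assumes f: "continuous_on UNIV f"
  shows "bounded_cost (avg f)"
proof -
  obtain C where C: "\<And>z. \<bar>f z\<bar> \<le> C" using compact_continuous_real(1)[OF compact_XA f] by blast
  have "\<forall>z\<in>Y \<times> space borel. \<bar>avg f z\<bar> \<le> C" using avg_bounded[OF f C] by auto
  then show ?thesis
    unfolding bounded_cost_def
    using borel_measurable_continuous_onI[OF avg_continuous[OF f]] by blast
qed

lemma measure_cell_bind:
  assumes y: "y \<in> Y" and B: "B \<in> sets borel"
  shows "measure (cell_measure Q \<nu> y \<bind> (\<lambda>z. p (z, a))) B = (\<integral>z. measure (p (z, a)) B \<partial>cell_measure Q \<nu> y)"
proof -
  have i: "(\<integral>x. indicator B x \<partial>\<mu>) = measure \<mu> B" if "sets \<mu> = sets borel" for \<mu> :: "'x measure"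
    using that B sets_eq_imp_space_eq[OF that] by simp
  have "measure (cell_measure Q \<nu> y \<bind> (\<lambda>z. p (z, a))) B = (\<integral>x. indicator B x \<partial>(cell_measure Q \<nu> y \<bind> (\<lambda>z. p (z, a))))"
    by (rule i[symmetric], rule sets_bind'[OF cell_prob[OF y] section_kernel])
  also have "\<dots> = (\<integral>z. (\<integral>x. indicator B x \<partial>p (z, a)) \<partial>cell_measure Q \<nu> y)"
    by (rule integral_bind_prob_algebra[OF cell_prob[OF y] section_kernel, where C=1]) (use B in \<open>auto simp: indicator_def\<close>)
  also have "\<dots> = (\<integral>z. measure (p (z, a)) B \<partial>cell_measure Q \<nu> y)"
    by (simp only: i[OF prob_algebraD(2)[OF p_prob]])
  finally show ?thesis .
qed

lemma extended_aggregated: "aggregated_mdp Y borel grid_init grid_trans \<beta> extended Q"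
proof (intro aggregated_mdp.intro aggregated_mdp_axioms.intro)
  show "finite_model Y (borel :: 'a measure) grid_init grid_trans \<beta>" by unfold_locales
  show "wf_mdp extended" by (rule wf_bar_mdp[OF quant weight pos kernel initial])
  show "actions extended = borel" by (simp add: bar_mdp_def borel_mdp_def)
  show "Q \<in> states extended \<rightarrow>\<^sub>M count_space Y" using grid_facts(3) by (simp add: bar_mdp_def borel_mdp_def)
  have cell: "{x \<in> space (states extended). Q x = y} = Q -` {y}" for y
    by (auto simp: bar_mdp_def borel_mdp_def)
  show "measure (init extended) {x \<in> space (states extended). Q x = y} = grid_init y" for y
    unfolding cell by (simp add: bar_mdp_def borel_mdp_def grid_init_def)
  show "measure (trans extended (x, a)) {x' \<in> space (states extended). Q x' = y} = grid_trans y (Q x, a)" for x a y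
    unfolding cell using measure_cell_bind[OF grid_facts(2)[of x] grid_facts(4)[of y], of a]
    by (simp add: bar_mdp_def borel_mdp_def grid_trans_def cell_avg_def)
qed

lemma finite_aggregated: "aggregated_mdp Y borel grid_init grid_trans \<beta> finite_approx (\<lambda>y. y)"
proof (intro aggregated_mdp.intro aggregated_mdp_axioms.intro)
  show "finite_model Y (borel :: 'a measure) grid_init grid_trans \<beta>" by unfold_locales
  show "wf_mdp finite_approx" by (rule wf_finite_mdp[OF quant weight pos kernel initial])
  show "actions finite_approx = borel" by (simp add: finite_mdp_def)
  show "(\<lambda>y. y) \<in> states finite_approx \<rightarrow>\<^sub>M count_space Y" by (simp add: finite_mdp_def)
  have st: "states finite_approx = count_space Y" by (simp add: finite_mdp_def)
  have cell: "{x \<in> space (states finite_approx). x = y} = {y}" if "y \<in> Y" for y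
    using that st by auto
  have Qm: "Q \<in> \<mu> \<rightarrow>\<^sub>M count_space Y" if "sets \<mu> = sets borel" for \<mu> :: "'x measure"
    unfolding measurable_cong_sets[OF that refl] by (rule grid_facts(3))
  have push: "measure (distr \<mu> (count_space Y) Q) {y} = measure \<mu> (Q -` {y})"
    if "sets \<mu> = sets borel" "y \<in> Y" for \<mu> :: "'x measure" and y
    using measure_distr[OF Qm[OF that(1)], of "{y}"] that sets_eq_imp_space_eq[OF that(1)] by simp
  show "measure (init finite_approx) {x \<in> space (states finite_approx). x = y} = grid_init y" if "y \<in> Y" for y
    unfolding cell[OF that] using push[OF initial(2) that] by (simp add: finite_mdp_def grid_init_def)
  show "measure (trans finite_approx (x, a)) {x' \<in> space (states finite_approx). x' = y} = grid_trans y (x, a)"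
    if "x \<in> space (states finite_approx)" "y \<in> Y" for x a y
  proof -
    have x: "x \<in> Y" using that st by simp
    have "trans finite_approx (x, a) = distr (cell_measure Q \<nu> x \<bind> (\<lambda>z. p (z, a))) (count_space Y) Q"
      by (rule finite_mdp_trans[OF quant weight pos kernel initial x])
    then have "measure (trans finite_approx (x, a)) {y} = measure (cell_measure Q \<nu> x \<bind> (\<lambda>z. p (z, a))) (Q -` {y})"
      using push[OF sets_bind'[OF cell_prob[OF x] section_kernel] that(2)] by simp
    also have "\<dots> = grid_trans y (x, a)"
      using measure_cell_bind[OF x grid_facts(4)[of y], of a] by (simp add: grid_trans_def cell_avg_def)
    finally show ?thesis unfolding cell[OF that(2)] .
  qed
qed

lemma lift_avg: "aggregated_mdp.lift Q (avg f) = bar_cost Q \<nu> (f :: 'x \<times> 'a \<Rightarrow> real)"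
  by (simp add: aggregated_mdp.lift_def[OF extended_aggregated] cell_avg_def bar_cost_def)

text \<open>The averaging measure is concentrated on the cell of \<open>x\<close>, all of whose points are at distance less than
\<open>1 / n\<close> from the grid point \<open>Q x\<close>, hence less than \<open>2 / n\<close> from \<open>x\<close>.\<close>

lemma cell_average_close:
  fixes H :: "'x \<Rightarrow> real"
  assumes H: "H \<in> borel_measurable borel" "\<And>z. \<bar>H z\<bar> \<le> C"
    and close: "\<And>z. dist z x < 2 / real n \<Longrightarrow> \<bar>H z - H x\<bar> \<le> e"
  shows "\<bar>H x - (\<integral>z. H z \<partial>cell_measure Q \<nu> (Q x))\<bar> \<le> e"
proof -
  let ?\<mu> = "cell_measure Q \<nu> (Q x)"
  note \<mu> = cell_prob[OF grid_facts(2)[of x]]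
  interpret prob_space ?\<mu> by (rule prob_algebraD(1)[OF \<mu>])
  have d: "dist z (Q z) < 1 / real n" for z using quant by (simp add: is_quantizer_def)
  have "AE z in ?\<mu>. Q z = Q x"
    unfolding cell_measure_def using grid_facts(4) weight(2) by (intro AE_uniform_measureI) auto
  then have ae: "AE z in ?\<mu>. \<bar>H z - H x\<bar> \<le> e"
  proof eventually_elim
    case (elim z)
    have "dist z x \<le> dist z (Q z) + dist x (Q x)" using elim dist_triangle2[of z x "Q x"] by simp
    also have "\<dots> < 2 / real n" using d[of z] d[of x] by simp
    finally show ?case by (rule close)
  qed
  have i: "integrable ?\<mu> H" by (rule prob_algebra_bounded_integral(1)[OF \<mu> H])
  have "(\<integral>z. H z \<partial>?\<mu>) \<le> H x + e" by (rule integral_le_const[OF i]) (use ae in eventually_elim, linarith)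
  moreover have "H x - e \<le> (\<integral>z. H z \<partial>?\<mu>)" by (rule integral_ge_const[OF i]) (use ae in eventually_elim, linarith)
  ultimately show ?thesis by linarith
qed

lemma original_wf: "wf_mdp original"
  by (rule wf_borel_mdp[OF kernel initial])

lemma policies_extended: "policies extended = policies original"
  by (simp add: policies_def history_def bar_mdp_def borel_mdp_def)

text \<open>The cell average of \<open>z \<mapsto> \<integral>g d p(z, a)\<close> is compared with its value at the state: this turns the
total variation modulus of \<open>p\<close> into the one-step error required by \<open>disc_cost_compare\<close>.\<close>

lemma extended_disc_cost_close:
  fixes f :: "'x \<times> 'a \<Rightarrow> real"
  assumes pol: "\<pi> \<in> policies original"
    and f: "continuous_on UNIV f" "\<And>z. \<bar>f z\<bar> \<le> C" and C: "0 < C"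
    and tv_close: "\<And>z z'. dist z z' < 2 / real n \<Longrightarrow> tv_dist (p z) (p z') \<le> \<delta>" and \<delta>: "0 \<le> \<delta>"
    and f_close: "\<And>z z'. dist z z' < 2 / real n \<Longrightarrow> \<bar>f z - f z'\<bar> \<le> \<epsilon>"
  shows "\<bar>disc_cost \<beta> original f \<pi> - disc_cost \<beta> extended (bar_cost Q \<nu> f) \<pi>\<bar> \<le> 2 * C * \<delta> / (1 - \<beta>) + \<epsilon>"
proof (rule disc_cost_compare[OF original_wf _ _ _ pol discounting, where C=C])
  interpret E: aggregated_mdp Y borel grid_init grid_trans \<beta> extended Q by (rule extended_aggregated)
  have st: "states original = borel" "actions original = borel" by (simp_all add: borel_mdp_def)
  show "wf_mdp extended" by (rule E.wf)
  show "states extended = states original" "actions extended = actions original"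
    by (simp_all add: bar_mdp_def borel_mdp_def)
  show "f \<in> borel_measurable (states original \<Otimes>\<^sub>M actions original)"
    unfolding st borel_prod by (rule borel_measurable_continuous_onI[OF f(1)])
  show "\<bar>f z\<bar> \<le> C" for z by (rule f(2))
  show "bar_cost Q \<nu> f \<in> borel_measurable (states original \<Otimes>\<^sub>M actions original)"
    using E.lift_measurable[OF bounded_cost_avg[OF f(1)]] unfolding lift_avg
    by (simp add: bar_mdp_def borel_mdp_def)
  show "\<bar>f z - bar_cost Q \<nu> f z\<bar> \<le> \<epsilon>" for z
  proof (cases z)
    case (Pair x a)
    have "\<bar>f (x, a) - (\<integral>z. f (z, a) \<partial>cell_measure Q \<nu> (Q x))\<bar> \<le> \<epsilon>"
      by (rule cell_average_close[OF section_measurable[OF f(1)] f(2) f_close]) (simp add: dist_Pair_Pair)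
    then show ?thesis by (simp add: Pair bar_cost_def)
  qed
  fix t h and g :: "'x \<Rightarrow> real"
  assume "g \<in> borel_measurable (states original)" "\<And>x. x \<in> space (states original) \<Longrightarrow> \<bar>g x\<bar> \<le> C"
  then have g: "g \<in> borel_measurable borel" "\<And>x. \<bar>g x\<bar> \<le> C" by (simp_all add: st)
  show "\<bar>(\<integral>x. g x \<partial>next_state original t h) - (\<integral>x. g x \<partial>next_state extended t h)\<bar> \<le> 2 * C * \<delta>"
  proof (cases t)
    case 0
    then show ?thesis using C \<delta> by (simp add: next_state_def bar_mdp_def borel_mdp_def)
  next
    case (Suc u)
    obtain x a where xa: "h u = (x, a)" by fastforce
    let ?H = "\<lambda>z. \<integral>x. g x \<partial>p (z, a)"
    have "\<bar>?H x - (\<integral>z. ?H z \<partial>cell_measure Q \<nu> (Q x))\<bar> \<le> 2 * C * \<delta>"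
    proof (rule cell_average_close[where C=C])
      show "?H \<in> borel_measurable borel"
        by (rule measurable_compose[OF measurable_prob_algebraD[OF section_kernel] integral_measurable_subprob_algebra[OF g(1)]])
      show "\<bar>?H z\<bar> \<le> C" for z by (rule prob_algebra_bounded_integral(2)[OF p_prob g])
      fix z assume "dist z x < 2 / real n"
      then have "tv_dist (p (z, a)) (p (x, a)) \<le> \<delta>" by (intro tv_close) (simp add: dist_Pair_Pair)
      then have "2 * C * tv_dist (p (z, a)) (p (x, a)) \<le> 2 * C * \<delta>" using C by (intro mult_left_mono) auto
      with integral_diff_le_tv_dist[OF p_prob p_prob g C]
      show "\<bar>?H z - ?H x\<bar> \<le> 2 * C * \<delta>" by (rule order_trans)
    qed
    also have "(\<integral>z. ?H z \<partial>cell_measure Q \<nu> (Q x)) = (\<integral>x. g x \<partial>(cell_measure Q \<nu> (Q x) \<bind> (\<lambda>z. p (z, a))))"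
      by (rule integral_bind_prob_algebra[symmetric, OF cell_prob[OF grid_facts(2)] section_kernel g])
    finally show ?thesis by (simp add: Suc xa next_state_def bar_mdp_def borel_mdp_def)
  qed
qed

text \<open>One optimal solution of the balance equation is optimal in the finite and in the extended model at
once.\<close>

lemma optimal_pair_exists:
  assumes c: "continuous_on UNIV c" "\<And>z. 0 \<le> c z" and d: "\<And>l. l \<in> {1..q} \<Longrightarrow> continuous_on UNIV (d l)"
    and nonempty: "randomized \<phi>0" "balanced s0 \<phi>0" "\<And>l. l \<in> {1..q} \<Longrightarrow> cost (avg (d l)) s0 \<phi>0 \<le> m l"
  shows "\<exists>\<phi>. optimal_pair \<beta> p \<gamma> c q d m Y Q \<nu> \<phi>"
proof -
  interpret E: aggregated_mdp Y borel grid_init grid_trans \<beta> extended Q by (rule extended_aggregated)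
  interpret Fin: aggregated_mdp Y borel grid_init grid_trans \<beta> finite_approx "\<lambda>y. y" by (rule finite_aggregated)
  have c_nonneg: "0 \<le> avg c z" for z using c(2) by (simp add: cell_avg_def split_beta')
  obtain s \<phi> where adm: "randomized \<phi> \<and> balanced s \<phi> \<and> (\<forall>l\<in>{1..q}. cost (avg (d l)) s \<phi> \<le> m l)"
    and min: "\<And>s' \<phi>'. randomized \<phi>' \<and> balanced s' \<phi>' \<and> (\<forall>l\<in>{1..q}. cost (avg (d l)) s' \<phi>' \<le> m l) \<Longrightarrow>
      cost (avg c) s \<phi> \<le> cost (avg c) s' \<phi>'"
  proof (rule optimal_balanced_exists[OF _ compact_A grid_trans_continuous avg_continuous[OF c(1)] c_nonneg,
        where L="{1..q}" and F="\<lambda>l. avg (d l)" and m=m])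
    show "finite_model Y (borel :: 'a measure) grid_init grid_trans \<beta>" by unfold_locales
    show "continuous_on UNIV (\<lambda>a. avg (d l) (y, a))" if "l \<in> {1..q}" "y \<in> Y" for l y
      by (rule avg_continuous[OF d[OF that(1)] that(2)])
    show "randomized \<phi>0 \<and> balanced s0 \<phi>0 \<and> (\<forall>l\<in>{1..q}. cost (avg (d l)) s0 \<phi>0 \<le> m l)"
      using nonempty by blast
  qed blast+
  have r: "randomized \<phi>" and b: "balanced s \<phi>" and f: "\<And>l. l \<in> {1..q} \<Longrightarrow> cost (avg (d l)) s \<phi> \<le> m l"
    using adm by blast+
  note prems = r b f bounded_cost_avg[OF c(1)] bounded_cost_avg[OF d]
  have "optimal \<beta> extended (bar_cost Q \<nu> c) q (\<lambda>l. bar_cost Q \<nu> (d l)) m (stationary (extension Q \<phi>))"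
    using E.optimal_lift[where F="\<lambda>l. avg (d l)", OF prems] min unfolding lift_avg extension_def by blast
  moreover have "optimal \<beta> finite_approx (avg c) q (\<lambda>l. avg (d l)) m (stationary \<phi>)"
  proof -
    have "Fin.lift F = F" for F by (simp add: Fin.lift_def)
    then show ?thesis using Fin.optimal_lift[where F="\<lambda>l. avg (d l)", OF prems] min by simp
  qed
  moreover have "\<phi> \<in> stationary_kernels finite_approx"
    using Fin.randomized_stationary[OF r] by simp
  ultimately show ?thesis unfolding optimal_pair_def by blast
qed

text \<open>Mixing is done on the level of the balance equation of the extended model, where it again produces a
stationary policy; no randomization between the two given policies is needed.\<close>

lemma mixture_exists:
  assumes \<pi>: "\<pi>1 \<in> policies original" "\<pi>2 \<in> policies original" and \<theta>: "0 \<le> \<theta>" "\<theta> \<le> 1"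
  obtains s \<phi> where "randomized \<phi>" "balanced s \<phi>"
    "\<And>f. continuous_on UNIV f \<Longrightarrow> cost (avg f) s \<phi> =
      \<theta> * disc_cost \<beta> extended (bar_cost Q \<nu> f) \<pi>1 + (1 - \<theta>) * disc_cost \<beta> extended (bar_cost Q \<nu> f) \<pi>2"
proof -
  interpret E: aggregated_mdp Y borel grid_init grid_trans \<beta> extended Q by (rule extended_aggregated)
  have \<pi>': "\<pi>1 \<in> policies extended" "\<pi>2 \<in> policies extended" using \<pi> by (simp_all add: policies_extended)
  obtain s1 \<phi>1 where 1: "randomized \<phi>1" "balanced s1 \<phi>1"
    "\<And>F. bounded_cost F \<Longrightarrow> disc_cost \<beta> extended (E.lift F) \<pi>1 = cost F s1 \<phi>1"
    by (rule E.policy_to_balanced[OF \<pi>'(1)]) blast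
  obtain s2 \<phi>2 where 2: "randomized \<phi>2" "balanced s2 \<phi>2"
    "\<And>F. bounded_cost F \<Longrightarrow> disc_cost \<beta> extended (E.lift F) \<pi>2 = cost F s2 \<phi>2"
    by (rule E.policy_to_balanced[OF \<pi>'(2)]) blast
  obtain s \<phi> where *: "randomized \<phi>" "balanced s \<phi>"
    "\<And>F. bounded_cost F \<Longrightarrow> cost F s \<phi> = \<theta> * cost F s1 \<phi>1 + (1 - \<theta>) * cost F s2 \<phi>2"
    by (rule balanced_mixture[OF 1(1,2) 2(1,2) \<theta>]) blast
  show ?thesis
  proof (rule that[OF *(1,2)])
    fix f :: "'x \<times> 'a \<Rightarrow> real" assume "continuous_on UNIV f"
    from bounded_cost_avg[OF this]
    show "cost (avg f) s \<phi> =
      \<theta> * disc_cost \<beta> extended (bar_cost Q \<nu> f) \<pi>1 + (1 - \<theta>) * disc_cost \<beta> extended (bar_cost Q \<nu> f) \<pi>2"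
      unfolding lift_avg[symmetric] by (simp only: 1(3) 2(3) *(3))
  qed
qed

end

section \<open>The approximation theorem\<close>

text \<open>The point is that the threshold for \<open>n\<close> does not depend on the policy.\<close>

lemma extended_disc_cost_uniform:
  fixes p :: "'x::polish_space \<times> 'a::polish_space \<Rightarrow> 'x measure"
  assumes grid: "\<And>n. n \<ge> 1 \<Longrightarrow> grid_model p \<gamma> \<beta> n (Y n) (Q n) (\<nu> n)"
    and f: "continuous_on UNIV f" and e: "0 < e"
  shows "eventually (\<lambda>n. \<forall>\<pi>\<in>policies (borel_mdp p \<gamma>).
    \<bar>disc_cost \<beta> (borel_mdp p \<gamma>) f \<pi> - disc_cost \<beta> (bar_mdp (Q n) (\<nu> n) p \<gamma>) (bar_cost (Q n) (\<nu> n) f) \<pi>\<bar> \<le> e) sequentially"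
proof -
  interpret G1: grid_model p \<gamma> \<beta> 1 "Y 1" "Q 1" "\<nu> 1" by (rule grid) simp
  note \<beta> = G1.discounting
  obtain C where C: "0 < C" "\<And>z. \<bar>f z\<bar> \<le> C" using compact_continuous_real(1)[OF G1.compact_XA f] by blast
  \<comment> \<open>Half of the error budget goes to the kernel, half to the cost function.\<close>
  define \<delta> where "\<delta> = e * (1 - \<beta>) / (4 * C)"
  have \<delta>: "0 < \<delta>" "2 * C * \<delta> / (1 - \<beta>) + e / 2 = e"
    using e \<beta> C(1) by (simp_all add: \<delta>_def field_simps)
  obtain \<eta>1 where \<eta>1: "0 < \<eta>1" "\<And>z z'. dist z z' < \<eta>1 \<Longrightarrow> tv_dist (p z) (p z') \<le> \<delta>"
    by (rule tv_continuous_uniform[OF G1.tv G1.p_prob G1.compact_XA \<delta>(1)]) blast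
  obtain \<eta>2 where \<eta>2: "0 < \<eta>2" "\<And>z z'. dist z z' < \<eta>2 \<Longrightarrow> \<bar>f z - f z'\<bar> \<le> e / 2"
    using compact_continuous_real(2)[OF G1.compact_XA f, of "e / 2"] e by auto
  have "(\<lambda>n. 2 / real n) \<longlonglongrightarrow> 0" by (rule lim_const_over_n)
  then have "eventually (\<lambda>n. 2 / real n < min \<eta>1 \<eta>2) sequentially"
    using \<eta>1(1) \<eta>2(1) by (intro order_tendstoD(2)) auto
  with eventually_ge_at_top[of 1] show ?thesis
  proof eventually_elim
    case (elim n)
    interpret G: grid_model p \<gamma> \<beta> n "Y n" "Q n" "\<nu> n" by (rule grid[OF elim(1)])
    show ?case
    proof
      fix \<pi> assume "\<pi> \<in> policies (borel_mdp p \<gamma>)"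
      from G.extended_disc_cost_close[OF this f C(2,1), of \<delta> "e / 2"]
      show "\<bar>disc_cost \<beta> (borel_mdp p \<gamma>) f \<pi> - disc_cost \<beta> (bar_mdp (Q n) (\<nu> n) p \<gamma>) (bar_cost (Q n) (\<nu> n) f) \<pi>\<bar> \<le> e"
        using \<eta>1(2) \<eta>2(2) elim(2) \<delta> by (simp add: less_imp_le)
    qed
  qed
qed

lemma disc_cost_nonneg:
  assumes "wf_mdp M" "\<pi> \<in> policies M" "0 < \<beta>" "\<beta> < 1"
    and "f \<in> borel_measurable (states M \<Otimes>\<^sub>M actions M)" "\<And>z. \<bar>f z\<bar> \<le> C" "\<And>z. 0 \<le> f z"
  shows "0 \<le> disc_cost \<beta> M f \<pi>"
  using disc_cost_eq_occupation_integral[OF assms(1-6)] assms(7) by simp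

theorem theorem2:
  fixes p :: "'x::polish_space \<times> 'a::polish_space \<Rightarrow> 'x measure"
    and \<gamma> :: "'x measure"
    and c :: "'x \<times> 'a \<Rightarrow> real"
    and q :: nat
    and d :: "nat \<Rightarrow> 'x \<times> 'a \<Rightarrow> real"
    and k :: "nat \<Rightarrow> real"
    and \<beta> :: real
    and Xn :: "nat \<Rightarrow> 'x set"
    and Q :: "nat \<Rightarrow> 'x \<Rightarrow> 'x"
    and \<nu> :: "nat \<Rightarrow> 'x measure"
    and \<kappa> :: real
  assumes compact_X: "compact (UNIV :: 'x set)"
    and compact_A: "compact (UNIV :: 'a set)"
    and kernel: "p \<in> borel \<Otimes>\<^sub>M borel \<rightarrow>\<^sub>M prob_algebra borel"
    and initial: "prob_space \<gamma>" "sets \<gamma> = sets borel"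
    and cost: "continuous_on UNIV c" "\<And>z. 0 \<le> c z"
    and constr: "\<And>l. l \<in> {1..q} \<Longrightarrow> continuous_on UNIV (d l)"
      "\<And>l z. l \<in> {1..q} \<Longrightarrow> 0 \<le> d l z"
    and k_nonneg: "\<And>l. l \<in> {1..q} \<Longrightarrow> 0 \<le> k l"
    and discount: "0 < \<beta>" "\<beta> < 1"
    and slater: "\<exists>\<pi>\<in>policies (borel_mdp p \<gamma>).
      \<forall>l\<in>{1..q}. disc_cost \<beta> (borel_mdp p \<gamma>) (d l) \<pi> < k l"
    and quantizers: "\<And>n. n \<ge> 1 \<Longrightarrow> is_quantizer n (Xn n) (Q n)"
    and weights: "\<And>n. n \<ge> 1 \<Longrightarrow> finite_measure (\<nu> n) \<and> sets (\<nu> n) = sets borel"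
      "\<And>n y. n \<ge> 1 \<Longrightarrow> y \<in> Xn n \<Longrightarrow> 0 < emeasure (\<nu> n) (Q n -` {y})"
    and tv: "tv_continuous p"
    and kappa: "0 < \<kappa>"
  shows "\<exists>\<epsilon>>0. \<exists>n\<ge>1.
    (\<exists>\<phi>. optimal_pair \<beta> p \<gamma> c q d (\<lambda>l. k l - \<epsilon>) (Xn n) (Q n) (\<nu> n) \<phi>) \<and>
    (\<forall>\<phi>. optimal_pair \<beta> p \<gamma> c q d (\<lambda>l. k l - \<epsilon>) (Xn n) (Q n) (\<nu> n) \<phi> \<longrightarrow>
      extension (Q n) \<phi> \<in> stationary_kernels (borel_mdp p \<gamma>) \<and>
      stationary (extension (Q n) \<phi>) \<in> feasible \<beta> (borel_mdp p \<gamma>) q d k \<and>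
      \<bar>disc_cost \<beta> (borel_mdp p \<gamma>) c (stationary (extension (Q n) \<phi>))
        - opt_value \<beta> (borel_mdp p \<gamma>) c q d k\<bar> < \<kappa>)"
proof -
  let ?M = "borel_mdp p \<gamma>"
  let ?J = "disc_cost \<beta> ?M"
  let ?JE = "\<lambda>n f. disc_cost \<beta> (bar_mdp (Q n) (\<nu> n) p \<gamma>) (bar_cost (Q n) (\<nu> n) f)"
  have grid: "grid_model p \<gamma> \<beta> n (Xn n) (Q n) (\<nu> n)" if "n \<ge> 1" for n
    using compact_X compact_A kernel initial discount quantizers[OF that] weights(1)[OF that] weights(2)[OF that] tv
    by (intro grid_model.intro) blast+
  have wf: "wf_mdp ?M" by (rule wf_borel_mdp[OF kernel initial])
  have compact_XA: "compact (UNIV :: ('x \<times> 'a) set)"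
    using compact_Times[OF compact_X compact_A] by simp
  obtain B where B: "\<And>z. \<bar>c z\<bar> \<le> B" using compact_continuous_real(1)[OF compact_XA cost(1)] by blast
  have c_meas: "c \<in> borel_measurable (states ?M \<Otimes>\<^sub>M actions ?M)"
    unfolding borel_mdp_def mdp.simps borel_prod by (rule borel_measurable_continuous_onI[OF cost(1)])
  have J_nonneg: "0 \<le> ?J c \<pi>" if "\<pi> \<in> policies ?M" for \<pi>
    by (rule disc_cost_nonneg[OF wf that discount c_meas B cost(2)])
  obtain \<pi>0 where \<pi>0: "\<pi>0 \<in> policies ?M" "\<And>l. l \<in> {1..q} \<Longrightarrow> ?J (d l) \<pi>0 < k l"
    using slater by blast
  \<comment> \<open>The 1 only keeps the set nonempty when there are no constraints.\<close>
  define s where "s = Min (insert 1 ((\<lambda>l. k l - ?J (d l) \<pi>0) ` {1..q}))"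
  have s: "0 < s" unfolding s_def using \<pi>0(2) by (subst Min_gr_iff) auto
  have slack: "?J (d l) \<pi>0 \<le> k l - s" if "l \<in> {1..q}" for l
  proof -
    have "s \<le> k l - ?J (d l) \<pi>0" unfolding s_def using that by (intro Min_le) auto
    then show ?thesis by simp
  qed
  define V where "V = opt_value \<beta> ?M c q d k"
  let ?F = "feasible \<beta> ?M q d k"
  have \<pi>0_feasible: "\<pi>0 \<in> ?F" using \<pi>0 by (auto simp: feasible_def intro: less_imp_le)
  have F_policy: "\<pi> \<in> policies ?M" if "\<pi> \<in> ?F" for \<pi> using that by (simp add: feasible_def)
  have bdd: "bdd_below (?J c ` ?F)" using J_nonneg F_policy by (intro bdd_belowI2[of _ 0]) blast
  have V_le: "V \<le> ?J c \<pi>" if "\<pi> \<in> ?F" for \<pi>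
    unfolding V_def opt_value_def by (rule cINF_lower[OF bdd that])
  have V_nonneg: "0 \<le> V"
    unfolding V_def opt_value_def using \<pi>0_feasible J_nonneg F_policy by (intro cINF_greatest) auto
  have "V < V + \<kappa> / 4" using kappa by simp
  then obtain \<pi>1 where \<pi>1: "\<pi>1 \<in> ?F" "?J c \<pi>1 < V + \<kappa> / 4"
    unfolding V_def opt_value_def using cINF_less_iff[OF _ bdd] \<pi>0_feasible by blast
  define J0 where "J0 = ?J c \<pi>0"
  have J0: "0 \<le> J0" unfolding J0_def by (rule J_nonneg[OF \<pi>0(1)])
  \<comment> \<open>Weight of the Slater policy: its cost \<open>J0\<close> then contributes at most \<open>\<kappa> / 4\<close>.\<close>
  define \<theta> where "\<theta> = min 1 (\<kappa> / (4 * (J0 + 1)))"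
  have \<theta>: "0 < \<theta>" "\<theta> \<le> 1" using kappa J0 by (simp_all add: \<theta>_def)
  have \<theta>J0: "\<theta> * J0 \<le> \<kappa> / 4"
  proof -
    have "\<theta> * J0 \<le> \<kappa> / (4 * (J0 + 1)) * (J0 + 1)" using \<theta> J0 kappa by (intro mult_mono) (auto simp: \<theta>_def)
    also have "\<dots> = \<kappa> / 4" using J0 by (simp add: field_simps)
    finally show ?thesis .
  qed
  \<comment> \<open>The mixture has slack \<open>\<theta> s = 2 \<epsilon>\<close>: one half is given up by tightening the bounds, the other half
    absorbs the approximation error \<open>e\<close>.\<close>
  define \<epsilon> where "\<epsilon> = \<theta> * s / 2"
  have \<epsilon>: "0 < \<epsilon>" using \<theta> s by (simp add: \<epsilon>_def)
  define e where "e = min \<epsilon> (\<kappa> / 8)"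
  have e: "0 < e" "e \<le> \<epsilon>" "e \<le> \<kappa> / 8" using \<epsilon> kappa by (simp_all add: e_def)
  have "eventually (\<lambda>n. \<forall>f\<in>insert c (d ` {1..q}). \<forall>\<pi>\<in>policies ?M. \<bar>?J f \<pi> - ?JE n f \<pi>\<bar> \<le> e) sequentially"
  proof (rule eventually_ball_finite)
    show "\<forall>f\<in>insert c (d ` {1..q}). eventually (\<lambda>n. \<forall>\<pi>\<in>policies ?M. \<bar>?J f \<pi> - ?JE n f \<pi>\<bar> \<le> e) sequentially"
      using extended_disc_cost_uniform[OF grid _ e(1)] cost(1) constr(1) by blast
  qed simp
  then have "eventually (\<lambda>n. n \<ge> 1 \<and> (\<forall>f\<in>insert c (d ` {1..q}). \<forall>\<pi>\<in>policies ?M. \<bar>?J f \<pi> - ?JE n f \<pi>\<bar> \<le> e)) sequentially"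
    by (intro eventually_conj eventually_ge_at_top)
  then obtain n where n: "n \<ge> 1"
    and close_c: "\<And>\<pi>. \<pi> \<in> policies ?M \<Longrightarrow> \<bar>?J c \<pi> - ?JE n c \<pi>\<bar> \<le> e"
    and close_d: "\<And>l \<pi>. l \<in> {1..q} \<Longrightarrow> \<pi> \<in> policies ?M \<Longrightarrow> \<bar>?J (d l) \<pi> - ?JE n (d l) \<pi>\<bar> \<le> e"
    unfolding eventually_sequentially by blast
  interpret G: grid_model p \<gamma> \<beta> n "Xn n" "Q n" "\<nu> n" by (rule grid[OF n])
  interpret E: aggregated_mdp "Xn n" borel G.grid_init G.grid_trans \<beta> "bar_mdp (Q n) (\<nu> n) p \<gamma>" "Q n"
    by (rule G.extended_aggregated)
  obtain w \<psi> where \<psi>: "G.randomized \<psi>" "G.balanced w \<psi>"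
    and mix: "\<And>f. continuous_on UNIV f \<Longrightarrow>
      G.cost (cell_avg (Q n) (\<nu> n) f) w \<psi> = \<theta> * ?JE n f \<pi>0 + (1 - \<theta>) * ?JE n f \<pi>1"
    by (rule G.mixture_exists[OF \<pi>0(1) F_policy[OF \<pi>1(1)]]) (use \<theta> in auto)
  have combine: "\<theta> * ?JE n f \<pi>0 + (1 - \<theta>) * ?JE n f \<pi>1 \<le> \<theta> * a + (1 - \<theta>) * b + e"
    if "?JE n f \<pi>0 \<le> a + e" "?JE n f \<pi>1 \<le> b + e" for f a b
  proof -
    have "\<theta> * ?JE n f \<pi>0 + (1 - \<theta>) * ?JE n f \<pi>1 \<le> \<theta> * (a + e) + (1 - \<theta>) * (b + e)"
      using that \<theta> by (intro add_mono mult_left_mono) auto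
    then show ?thesis by (simp add: algebra_simps)
  qed
  have mix_d: "G.cost (cell_avg (Q n) (\<nu> n) (d l)) w \<psi> \<le> k l - \<epsilon>" if l: "l \<in> {1..q}" for l
  proof -
    have "?J (d l) \<pi>1 \<le> k l" using \<pi>1(1) l by (simp add: feasible_def)
    then have "\<theta> * ?JE n (d l) \<pi>0 + (1 - \<theta>) * ?JE n (d l) \<pi>1 \<le> \<theta> * (k l - s) + (1 - \<theta>) * k l + e"
      using slack[OF l] close_d[OF l \<pi>0(1)] close_d[OF l F_policy[OF \<pi>1(1)]] by (intro combine) auto
    also have "\<dots> = k l - 2 * \<epsilon> + e" by (simp add: \<epsilon>_def algebra_simps)
    also have "\<dots> \<le> k l - \<epsilon>" using e(2) by simp
    finally show ?thesis by (simp add: mix[OF constr(1)[OF l]])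
  qed
  have mix_c: "G.cost (cell_avg (Q n) (\<nu> n) c) w \<psi> \<le> V + \<kappa> / 2 + e"
  proof -
    have "\<theta> * ?JE n c \<pi>0 + (1 - \<theta>) * ?JE n c \<pi>1 \<le> \<theta> * J0 + (1 - \<theta>) * (V + \<kappa> / 4) + e"
      using close_c[OF \<pi>0(1)] close_c[OF F_policy[OF \<pi>1(1)]] \<pi>1(2) by (intro combine) (auto simp: J0_def)
    also have "(1 - \<theta>) * (V + \<kappa> / 4) \<le> 1 * (V + \<kappa> / 4)"
      using \<theta> V_nonneg kappa by (intro mult_right_mono) auto
    finally show ?thesis using \<theta>J0 by (simp add: mix[OF cost(1)])
  qed
  have "\<exists>\<phi>. optimal_pair \<beta> p \<gamma> c q d (\<lambda>l. k l - \<epsilon>) (Xn n) (Q n) (\<nu> n) \<phi>"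
    by (rule G.optimal_pair_exists[OF cost constr(1) \<psi> mix_d])
  moreover have "extension (Q n) \<phi> \<in> stationary_kernels ?M \<and>
      stationary (extension (Q n) \<phi>) \<in> ?F \<and> \<bar>?J c (stationary (extension (Q n) \<phi>)) - V\<bar> < \<kappa>"
    if \<phi>: "optimal_pair \<beta> p \<gamma> c q d (\<lambda>l. k l - \<epsilon>) (Xn n) (Q n) (\<nu> n) \<phi>" for \<phi>
  proof -
    let ?\<pi> = "stationary (extension (Q n) \<phi>)"
    have "G.randomized \<phi>"
      using \<phi> by (auto simp: optimal_pair_def stationary_kernels_def finite_mdp_def G.randomized_def measurable_count_space_eq1)
    from E.randomized_stationary[OF this]
    have ker: "extension (Q n) \<phi> \<in> stationary_kernels ?M"
      by (simp add: extension_def stationary_kernels_def bar_mdp_def borel_mdp_def)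
    have pol: "?\<pi> \<in> policies ?M" by (rule stationary_policy[OF ker])
    have d_le: "?JE n (d l) ?\<pi> \<le> k l - \<epsilon>" if "l \<in> {1..q}" for l
      using \<phi> that by (auto simp: optimal_pair_def optimal_def feasible_def)
    have feas: "?\<pi> \<in> ?F"
      using pol d_le close_d[OF _ pol] e(2) unfolding feasible_def by fastforce
    have lifted: "?JE n f (stationary (\<lambda>x. \<psi> (Q n x))) = G.cost (cell_avg (Q n) (\<nu> n) f) w \<psi>"
      if "continuous_on UNIV f" for f
      using E.balanced_to_policy[OF \<psi> G.bounded_cost_avg[OF that]] by (simp add: G.lift_avg)
    have "stationary (\<lambda>x. \<psi> (Q n x)) \<in>
        feasible \<beta> (bar_mdp (Q n) (\<nu> n) p \<gamma>) q (\<lambda>l. bar_cost (Q n) (\<nu> n) (d l)) (\<lambda>l. k l - \<epsilon>)"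
      using stationary_policy[OF E.randomized_stationary[OF \<psi>(1)]] mix_d lifted[OF constr(1)]
      by (simp add: feasible_def)
    then have "?JE n c ?\<pi> \<le> ?JE n c (stationary (\<lambda>x. \<psi> (Q n x)))"
      using \<phi> by (auto simp: optimal_pair_def optimal_def)
    then have "?JE n c ?\<pi> \<le> V + \<kappa> / 2 + e" using mix_c lifted[OF cost(1)] by simp
    then have "?J c ?\<pi> \<le> V + 3 * \<kappa> / 4" using close_c[OF pol] e(3) by linarith
    then show ?thesis using ker feas V_le[OF feas] kappa by auto
  qed
  ultimately show ?thesis using \<epsilon> n unfolding V_def by blast
qed

end
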